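(* Fix $\alpha<2$, $p>0$. Let $\mu=TS^p_\alpha(R,b)$ be a $p$-tempered $\alpha$-stable distribution on $\mathbb R^d$ with Rosi\'nski measure $R$ and shift $b$, let $M$ be the L\'evy measure of $\mu$, and let $\sigma\neq0$ be a finite Borel measure on $\mathbb S^{d-1}$. If $\varrho>\alpha\vee0$ then $$\mu\in RV_{-\varrho}(\sigma)\iff M\in RV_{-\varrho}(\sigma)\iff R\in RV_{-\varrho}(\sigma).$$ Moreover, if $M\in RV_{-\varrho}(\sigma)$ then for all $D\in\mathfrak B(\mathbb S^{d-1})$ with $\sigma(\partial D)=0$ and $\sigma(D)>0$ $$\lim_{r\to\infty}\frac{R(|x|>r,\ x/|x|\in D)}{M(|x|>r,\ x/|x|\in D)}=\frac{p}{\Gamma\left(\frac{\varrho-\alpha}{p}\right)}.$$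
   Context: $ID(0,M,b)$ is the infinitely divisible distribution on $\mathbb R^d$ with no Gaussian part, L\'evy measure $M$, and characteristic function $\exp\left\{i\langle b,z\rangle+\int_{\mathbb R^d}\left(e^{i\langle z,x\rangle}-1-i\frac{\langle z,x\rangle}{1+|x|^2}\right)M(dx)\right\}$. For $\alpha<2$, $p>0$, $TS^p_\alpha(R,b)$ denotes the $p$-tempered $\alpha$-stable distribution with Rosi\'nski measure $R$ and shift $b\in\mathbb R^d$, i.e. $ID(0,M,b)$ with $$M(A)=\int_{\mathbb R^d}\int_0^\infty1_A(tx)\,t^{-1-\alpha}e^{-t^p}\,dt\,R(dx),\qquad A\in\mathfrak B(\mathbb R^d),$$ where $R$ is a Borel measure on $\mathbb R^d$ with $R(\{0\})=0$ and $\int(|x|^2\wedge|x|^\alpha)R(dx)<\infty$ if $\alpha\in(0,2)$, $\int(|x|^2\wedge[1+\log^+|x|])R(dx)<\infty$ if $\alpha=0$, $\int(|x|^2\wedge1)R(dx)<\infty$ if $\alpha<0$. (These are exactly the conditions under which $M$ is a L\'evy measure when $R\ne 0$, and $M$ determines $R$.) Regular variation: let $\varrho\ge0$ and let $\nu$ be a Borel measure on $\mathbb R^d$ such that $\nu(\{|x|>T\})<\infty$ for some $T>0$ and $\nu(\{|x|>s\})>0$ for all $s>0$. For a finite Borel measure $\sigma\ne0$ on the unit sphere $\mathbb S^{d-1}$, we write $\nu\in RV_{-\varrho}(\sigma)$ ($\nu$ has regularly varying tails with index $\varrho$) if for all $t>0$ and all $D\in\mathfrak B(\mathbb S^{d-1})$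 with $\sigma(\partial D)=0$ $$\lim_{r\to\infty}\frac{\nu(|x|>rt,\ x/|x|\in D)}{\nu(|x|>r)}=t^{-\varrho}\frac{\sigma(D)}{\sigma(\mathbb S^{d-1})}.$$ *)

theory Defs
  imports "HOL-Probability.Probability"
begin

definition levy_measure :: "'a::euclidean_space measure \<Rightarrow> bool" where
  "levy_measure M \<longleftrightarrow>
     sets M = sets borel \<and> emeasure M {0} = 0 \<and>
     (\<integral>\<^sup>+ x. ennreal (min ((norm x)\<^sup>2) 1) \<partial>M) < \<infinity>"

definition char_fun :: "'a::euclidean_space measure \<Rightarrow> 'a \<Rightarrow> complex" where
  "char_fun \<mu> z = (CLINT x|\<mu>. iexp (z \<bullet> x))"

text \<open>\<open>is_ID M b \<mu>\<close> renders \<open>\<mu> = ID(0, M, b)\<close>. The integrand below is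
  \<open>M\<close>-integrable whenever \<open>M\<close> is a Levy measure, so the integral is a genuine one.\<close>

definition is_ID :: "'a::euclidean_space measure \<Rightarrow> 'a \<Rightarrow> 'a measure \<Rightarrow> bool" where
  "is_ID M b \<mu> \<longleftrightarrow>
     levy_measure M \<and> prob_space \<mu> \<and> sets \<mu> = sets borel \<and>
     (\<forall>z. char_fun \<mu> z =
        exp (\<i> * of_real (b \<bullet> z) +
             (CLINT x|M. iexp (z \<bullet> x) - 1 - \<i> * of_real ((z \<bullet> x) / (1 + (norm x)\<^sup>2)))))"

definition rosinski_measure :: "real \<Rightarrow> 'a::euclidean_space measure \<Rightarrow> bool" where
  "rosinski_measure \<alpha> R \<longleftrightarrow>
     sets R = sets borel \<and> emeasure R {0} = 0 \<and>
     (if \<alpha> > 0 then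
        (\<integral>\<^sup>+ x. ennreal (min ((norm x)\<^sup>2) (norm x powr \<alpha>)) \<partial>R) < \<infinity>
      else if \<alpha> = 0 then
        (\<integral>\<^sup>+ x. ennreal (min ((norm x)\<^sup>2) (1 + max 0 (ln (norm x)))) \<partial>R) < \<infinity>
      else
        (\<integral>\<^sup>+ x. ennreal (min ((norm x)\<^sup>2) 1) \<partial>R) < \<infinity>)"

definition TS_levy_measure ::
    "real \<Rightarrow> real \<Rightarrow> 'a::euclidean_space measure \<Rightarrow> 'a measure" where
  "TS_levy_measure p \<alpha> R = measure_of UNIV (sets borel)
     (\<lambda>A. \<integral>\<^sup>+ x. (\<integral>\<^sup>+ t\<in>{0<..}. indicator A (t *\<^sub>R x) *
              ennreal (t powr (- 1 - \<alpha>) * exp (- (t powr p))) \<partial>lborel) \<partial>R)"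

lemma sets_TS_levy_measure [simp, measurable_cong]:
  "sets (TS_levy_measure p \<alpha> R) = sets (borel :: 'a::euclidean_space measure)"
  unfolding TS_levy_measure_def
  using sets.sigma_sets_eq[of "borel :: 'a::euclidean_space measure"]
  by (simp add: sets_measure_of_conv)

text \<open>The set function in the definition is countably additive, so \<open>measure_of\<close> does not
  degenerate.\<close>

lemma emeasure_TS_levy_measure:
  fixes R :: "'a::euclidean_space measure"
  assumes R [measurable_cong]: "sets R = sets borel" and A: "A \<in> sets borel"
  shows "emeasure (TS_levy_measure p \<alpha> R) A =
     (\<integral>\<^sup>+ x. (\<integral>\<^sup>+ t\<in>{0<..}. indicator A (t *\<^sub>R x) *
              ennreal (t powr (- 1 - \<alpha>) * exp (- (t powr p))) \<partial>lborel) \<partial>R)"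
proof (rule emeasure_measure_of[OF TS_levy_measure_def])
  let ?k = "\<lambda>t. ennreal (t powr (- 1 - \<alpha>) * exp (- (t powr p)))"
  let ?f = "\<lambda>A. \<integral>\<^sup>+ x. (\<integral>\<^sup>+ t\<in>{0<..}. indicator A (t *\<^sub>R x) * ?k t \<partial>lborel) \<partial>R"
  show "sets borel \<subseteq> Pow (UNIV :: 'a set)" by auto
  show "A \<in> sets (TS_levy_measure p \<alpha> R)" using A by simp
  show "positive (sets (TS_levy_measure p \<alpha> R)) ?f" by (simp add: positive_def)
  show "countably_additive (sets (TS_levy_measure p \<alpha> R)) ?f"
  proof (rule countably_additiveI)
    fix F :: "nat \<Rightarrow> 'a set"
    assume "range F \<subseteq> sets (TS_levy_measure p \<alpha> R)" and dj: "disjoint_family F"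
    then have F [measurable]: "F i \<in> sets borel" for i by auto
    have "(\<Sum>i. ?f (F i)) =
        (\<integral>\<^sup>+ x. (\<Sum>i. \<integral>\<^sup>+ t\<in>{0<..}. indicator (F i) (t *\<^sub>R x) * ?k t \<partial>lborel) \<partial>R)"
      by (rule nn_integral_suminf[symmetric]) measurable
    also have "\<dots> =
        (\<integral>\<^sup>+ x. (\<integral>\<^sup>+ t. (\<Sum>i. indicator (F i) (t *\<^sub>R x) * ?k t * indicator {0<..} t) \<partial>lborel) \<partial>R)"
      by (intro nn_integral_cong nn_integral_suminf[symmetric]) measurable
    also have "\<dots> = ?f (\<Union>i. F i)"
      by (simp only: ennreal_suminf_multc suminf_indicator[OF dj])
    finally show "(\<Sum>i. ?f (F i)) = ?f (\<Union>i. F i)" .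
  qed
qed

text \<open>\<open>is_TS p \<alpha> R b \<mu>\<close> renders \<open>\<mu> = TS\<^sup>p\<^sub>\<alpha>(R, b)\<close>.\<close>

definition is_TS ::
    "real \<Rightarrow> real \<Rightarrow> 'a::euclidean_space measure \<Rightarrow> 'a \<Rightarrow> 'a measure \<Rightarrow> bool" where
  "is_TS p \<alpha> R b \<mu> \<longleftrightarrow> rosinski_measure \<alpha> R \<and> is_ID (TS_levy_measure p \<alpha> R) b \<mu>"

abbreviation borel_sphere :: "'a::euclidean_space measure" where
  "borel_sphere \<equiv> restrict_space borel (sphere 0 1)"

definition directional_tail :: "real \<Rightarrow> 'a::euclidean_space set \<Rightarrow> 'a set" where
  "directional_tail r D = {x. norm x > r \<and> x /\<^sub>R norm x \<in> D}"

text \<open>The boundary of \<open>D\<close> is taken in the relative topology of the unit sphere; in the ambient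
  space the boundary of \<open>D\<close> would in general be all of its closure. Tails of \<open>\<nu>\<close> are finite
  from some point on, so using the real-valued \<^term>\<open>measure\<close> does not affect the limit.\<close>

definition continuity_set :: "'a::euclidean_space measure \<Rightarrow> 'a set \<Rightarrow> bool" where
  "continuity_set \<sigma> D \<longleftrightarrow>
     D \<in> sets borel_sphere \<and> emeasure \<sigma> (top_of_set (sphere 0 1) frontier_of D) = 0"

definition regularly_varying ::
    "'a::euclidean_space measure \<Rightarrow> real \<Rightarrow> 'a measure \<Rightarrow> bool" where
  "regularly_varying \<nu> \<rho> \<sigma> \<longleftrightarrow>
     sets \<nu> = sets borel \<and>
     (\<exists>T>0. emeasure \<nu> {x. norm x > T} < \<infinity>) \<and>
     (\<forall>s>0. emeasure \<nu> {x. norm x > s} > 0) \<and>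
     (\<forall>t>0. \<forall>D. continuity_set \<sigma> D \<longrightarrow>
        ((\<lambda>r. measure \<nu> (directional_tail (r * t) D) / measure \<nu> {x. norm x > r})
          \<longlongrightarrow> t powr (- \<rho>) * (measure \<sigma> D / measure \<sigma> (sphere 0 1))) at_top)"

end

theory Submission
  imports Defs "HOL-Real_Asymp.Real_Asymp"
begin

text \<open>
  Two separate mechanisms are at work: one relates the law \<open>\<mu>\<close> to its Levy measure \<open>M\<close>, the other
  relates \<open>M\<close> to the Rosinski measure \<open>R\<close>.

  \<^bold>\<open>From \<open>\<mu>\<close> to \<open>M\<close>: one big jump.\<close> For a sum of many small independent jumps, being far out in a
  direction means, up to an event of much smaller probability, that exactly one jump is that large and
  that the sum is a small perturbation of it. Quantitatively (\<open>ID_tail_upper\<close>, \<open>ID_tail_lower\<close>), for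
  sets \<open>B\<close> away from the origin, \<open>\<mu>(B)\<close> and \<open>M(B)\<close> bound each other after a slight thickening of \<open>B\<close>,
  with an error consisting of the square of \<open>M(|x| > L)\<close> (two big jumps) and of a Chernoff bound for the
  sum of the jumps of size at most \<open>L\<close>. To prove this, \<open>\<mu>\<close> is approximated by random walks with finitely
  many independent steps, whose step law is a small multiple of the restriction of \<open>M\<close> to
  \<open>|x| > 1/(n+1)\<close> with the rest of the mass at \<open>0\<close>. Pathwise inequalities and product integrals give the
  two bounds for the walks uniformly in \<open>n\<close>; the characteristic functions of the walks converge to that
  of \<open>\<mu>\<close>, and Gaussian smoothing turns this into convergence of measures up to thickening
  (\<open>char_fun_tendsto_imp_lower\<close>, \<open>char_fun_tendsto_imp_upper\<close>).

  If the tail of \<open>M\<close> is dominated by a regularly varying function \<open>f\<close>, then for \<open>L = \<epsilon> r\<close> and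
  thickening radius \<open>\<delta> r\<close> the exponential rate in the Chernoff bound can be taken of order \<open>log r / r\<close>, and both
  errors are \<open>o(f(r))\<close> (\<open>one_big_jump_asymptotics\<close>). For \<open>f\<close> one takes the tail of whichever of \<open>\<mu>\<close> and
  \<open>M\<close> is assumed regularly varying; when it is \<open>\<mu>\<close>, the domination comes from the lower bound with a
  fixed exponential rate (\<open>levy_tail_le_law_tail\<close>). The symmetric pair of estimates then transfers
  regular variation either way (\<open>regularly_varying_transfer\<close>), since almost every thickening of a
  continuity set is a continuity set.

  \<^bold>\<open>From \<open>M\<close> to \<open>R\<close>: Abel and Tauber.\<close> By Fubini, the tail of \<open>M\<close> in a set of directions is a
  multiplicative convolution,
  \<open>M(|x| > r, x/|x| \<in> D) = \<integral> R(|x| > r/t, x/|x| \<in> D) t^(-1-\<alpha>) exp(-t^p) dt\<close>. If \<open>R\<close> is regularly varying, Potter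
  bounds allow dominated convergence, and the constant \<open>\<Gamma>((\<rho> - \<alpha>)/p)/p\<close> is the \<open>\<rho>\<close>-th moment of the
  kernel (\<open>tempered_tail_abelian\<close>). Conversely, replacing \<open>r\<close> by \<open>r (j+1)^(1/p)\<close> and rescaling \<open>t\<close> inserts a
  factor \<open>exp(-j t^p)\<close> into the integral. Regular variation of \<open>M\<close> therefore says that all integrals of
  \<open>t \<mapsto> R(|x| > r/t, x/|x| \<in> D)\<close> against \<open>exp(-j t^p)\<close> times the kernel converge, after normalisation, to those
  of a multiple of \<open>t\<^sup>\<rho>\<close>. By the Weierstrass theorem in the variable \<open>exp(-t^p)\<close> the same holds with continuous
  test functions, and monotonicity in \<open>t\<close> upgrades this to pointwise convergence
  (\<open>monotone_from_exponential_moments\<close>), as in Karamata's proof of his Tauberian theorem.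
\<close>

section \<open>Weak convergence from characteristic functions\<close>

definition thickening :: "real \<Rightarrow> 'a::metric_space set \<Rightarrow> 'a set" where
  "thickening d A = {x. \<exists>a\<in>A. dist x a < d}"

lemma open_thickening: "open (thickening d A)"
proof -
  have "thickening d A = (\<Union>a\<in>A. ball a d)"
    by (auto simp: thickening_def dist_commute)
  then show ?thesis by auto
qed

lemma thickening_borel [measurable]: "thickening d A \<in> sets borel"
  by (simp add: open_thickening)

lemma thickening_thickening_subset: "thickening c (thickening d A) \<subseteq> thickening (c + d) A"
proof
  fix x assume "x \<in> thickening c (thickening d A)"
  then obtain y a where "dist x y < c" "dist y a < d" "a \<in> A" by (auto simp: thickening_def)
  then have "dist x a < c + d" using dist_triangle[of x a y] by linarith
  then show "x \<in> thickening (c + d) A" using \<open>a \<in> A\<close> by (auto simp: thickening_def)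
qed

text \<open>
  The coordinates are independent standard normal variables, so the characteristic function is the
  product of the one-dimensional ones.
\<close>

lemma ex_gaussian_vector:
  "\<exists>G :: 'a::euclidean_space measure. prob_space G \<and> sets G = sets borel \<and>
     (\<forall>z. char_fun G z = of_real (exp (- (norm z)\<^sup>2 / 2)))"
proof -
  let ?N = "\<lambda>_::'a. std_normal_distribution"
  let ?f = "\<lambda>f::'a \<Rightarrow> real. \<Sum>b\<in>Basis. f b *\<^sub>R b"
  interpret P: product_prob_space ?N "Basis :: 'a set"
    by (intro product_prob_spaceI prob_space_normal_density) simp
  define G where "G = distr (Pi\<^sub>M Basis ?N) borel ?f"
  have f[measurable]: "?f \<in> measurable (Pi\<^sub>M Basis ?N) borel"
    by measurable
  have "prob_space G" unfolding G_def
    by (intro P.P.prob_space_distr f)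
  moreover have "char_fun G z = of_real (exp (- (norm z)\<^sup>2 / 2))" for z
  proof -
    have "char_fun G z = (CLINT f|Pi\<^sub>M Basis ?N. iexp (z \<bullet> ?f f))"
      unfolding char_fun_def G_def by (rule integral_distr) measurable
    also have "\<dots> = (CLINT f|Pi\<^sub>M Basis ?N. (\<Prod>b\<in>Basis. iexp ((z \<bullet> b) * f b)))"
      by (simp add: inner_sum_right sum_distrib_left mult.commute exp_sum)
    also have "\<dots> = (\<Prod>b\<in>(Basis::'a set). (CLINT x|std_normal_distribution. iexp ((z \<bullet> b) * x)))"
    proof (rule P.product_integral_prod)
      fix b :: 'a
      have "finite_measure std_normal_distribution"
        by (intro prob_space.finite_measure prob_space_normal_density) simp
      then show "complex_integrable std_normal_distribution (\<lambda>x. iexp ((z \<bullet> b) * x))"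
        by (rule finite_measure.integrable_const_bound[where B=1]) auto
    qed simp
    also have "\<dots> = (\<Prod>b\<in>(Basis::'a set). of_real (exp (- ((z \<bullet> b)\<^sup>2) / 2)))"
      using char_std_normal_distribution by (simp add: char_def fun_eq_iff)
    also have "\<dots> = of_real (exp (\<Sum>b\<in>(Basis::'a set). - ((z \<bullet> b)\<^sup>2) / 2))"
      by (simp add: exp_sum)
    also have "(\<Sum>b\<in>(Basis::'a set). - ((z \<bullet> b)\<^sup>2) / 2) = - (norm z)\<^sup>2 / 2"
      unfolding power2_norm_eq_inner euclidean_inner[of z z]
      by (simp add: power2_eq_square sum_negf sum_divide_distrib)
    finally show ?thesis .
  qed
  ultimately show ?thesis by (intro exI[of _ G]) (auto simp: G_def)
qed

text \<open>
  Parseval's identity: the Gaussian kernel is itself a Gaussian characteristic function, so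
  Fubini expresses the convolution of \<open>\<nu>\<close> with it through \<open>char_fun \<nu>\<close>. This is what makes Gaussian
  smoothings of measures accessible from their characteristic functions.
\<close>

lemma gaussian_kernel_integral:
  fixes \<nu> :: "'a::euclidean_space measure"
  assumes G: "prob_space G" "sets G = sets borel"
    "\<And>z. char_fun G z = of_real (exp (- (norm z)\<^sup>2 / 2))"
    and nu: "prob_space \<nu>" "sets \<nu> = sets borel"
  shows "of_real (\<integral>x. exp (- (norm (c *\<^sub>R (y - x)))\<^sup>2 / 2) \<partial>\<nu>) =
     (CLINT z|G. iexp (- (c *\<^sub>R z) \<bullet> y) * char_fun \<nu> (c *\<^sub>R z))"
proof -
  interpret G: prob_space G by fact
  interpret nu: prob_space \<nu> by fact
  interpret P: pair_prob_space \<nu> G ..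
  note [measurable_cong] = G(2) nu(2)
  have int: "complex_integrable (\<nu> \<Otimes>\<^sub>M G) (\<lambda>(x, z). iexp ((c *\<^sub>R (x - y)) \<bullet> z))"
    by (rule P.integrable_const_bound[where B=1]) (auto simp: case_prod_unfold)
  have "of_real (\<integral>x. exp (- (norm (c *\<^sub>R (y - x)))\<^sup>2 / 2) \<partial>\<nu>) =
      (CLINT x|\<nu>. char_fun G (c *\<^sub>R (x - y)))"
    by (simp add: G(3) norm_minus_commute)
  also have "\<dots> = (CLINT x|\<nu>. CLINT z|G. iexp ((c *\<^sub>R (x - y)) \<bullet> z))"
    by (simp add: char_fun_def)
  also have "\<dots> = (CLINT z|G. CLINT x|\<nu>. iexp ((c *\<^sub>R (x - y)) \<bullet> z))"
    by (rule P.Fubini_integral[symmetric]) (rule int)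
  also have "\<dots> = (CLINT z|G. CLINT x|\<nu>. iexp (- (c *\<^sub>R z) \<bullet> y) * iexp ((c *\<^sub>R z) \<bullet> x))"
  proof (intro Bochner_Integration.integral_cong refl)
    fix z x
    have "(c *\<^sub>R (x - y)) \<bullet> z = - (c *\<^sub>R z) \<bullet> y + (c *\<^sub>R z) \<bullet> x"
      by (simp add: inner_diff_left inner_commute[of z] right_diff_distrib)
    then show "iexp ((c *\<^sub>R (x - y)) \<bullet> z) = iexp (- (c *\<^sub>R z) \<bullet> y) * iexp ((c *\<^sub>R z) \<bullet> x)"
      by (simp only: exp_add[symmetric] distrib_left[symmetric] of_real_add[symmetric])
  qed
  also have "\<dots> = (CLINT z|G. iexp (- (c *\<^sub>R z) \<bullet> y) * char_fun \<nu> (c *\<^sub>R z))"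
    by (simp add: char_fun_def)
  finally show ?thesis .
qed

lemma char_fun_measurable:
  fixes \<nu> :: "'a::euclidean_space measure"
  assumes "prob_space \<nu>" "sets \<nu> = sets borel"
  shows "char_fun \<nu> \<in> borel_measurable borel"
proof -
  interpret prob_space \<nu> by fact
  note [measurable_cong] = assms(2)
  show ?thesis unfolding char_fun_def by measurable
qed

lemma norm_char_fun_le_1:
  fixes \<nu> :: "'a::euclidean_space measure"
  assumes "prob_space \<nu>" "sets \<nu> = sets borel"
  shows "norm (char_fun \<nu> z) \<le> 1"
proof -
  interpret prob_space \<nu> by fact
  have "norm (char_fun \<nu> z) \<le> (\<integral>x. norm (iexp (z \<bullet> x)) \<partial>\<nu>)"
    unfolding char_fun_def by (rule integral_norm_bound)
  also have "\<dots> = 1" by (simp add: prob_space)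
  finally show ?thesis .
qed

lemma gaussian_kernel_integral_tendsto:
  fixes \<nu> :: "'a::euclidean_space measure" and \<nu>n :: "nat \<Rightarrow> 'a measure"
  assumes n: "\<And>n. prob_space (\<nu>n n)" "\<And>n. sets (\<nu>n n) = sets borel"
    and nu: "prob_space \<nu>" "sets \<nu> = sets borel"
    and lim: "\<And>z. (\<lambda>n. char_fun (\<nu>n n) z) \<longlonglongrightarrow> char_fun \<nu> z"
  shows "(\<lambda>n. \<integral>x. exp (- (norm (c *\<^sub>R (y - x)))\<^sup>2 / 2) \<partial>\<nu>n n) \<longlonglongrightarrow>
     (\<integral>x. exp (- (norm (c *\<^sub>R (y - x)))\<^sup>2 / 2) \<partial>\<nu>)"
proof -
  obtain G :: "'a measure" where G: "prob_space G" "sets G = sets borel"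
    "\<And>z. char_fun G z = of_real (exp (- (norm z)\<^sup>2 / 2))" using ex_gaussian_vector by blast
  interpret G: prob_space G by fact
  note [measurable_cong] = G(2)
  note [measurable] = char_fun_measurable[OF nu] char_fun_measurable[OF n]
  have "(\<lambda>n. CLINT z|G. iexp (- (c *\<^sub>R z) \<bullet> y) * char_fun (\<nu>n n) (c *\<^sub>R z)) \<longlonglongrightarrow>
     (CLINT z|G. iexp (- (c *\<^sub>R z) \<bullet> y) * char_fun \<nu> (c *\<^sub>R z))"
  proof (rule integral_dominated_convergence[where w="\<lambda>_. 1"])
    show "(\<lambda>z. iexp (- (c *\<^sub>R z) \<bullet> y) * char_fun \<nu> (c *\<^sub>R z)) \<in> borel_measurable G"
      by measurable
    show "(\<lambda>z. iexp (- (c *\<^sub>R z) \<bullet> y) * char_fun (\<nu>n n) (c *\<^sub>R z)) \<in> borel_measurable G" for n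
      by measurable
    show "integrable G (\<lambda>_. 1::real)" by simp
    show "AE z in G. (\<lambda>n. iexp (- (c *\<^sub>R z) \<bullet> y) * char_fun (\<nu>n n) (c *\<^sub>R z))
        \<longlonglongrightarrow> iexp (- (c *\<^sub>R z) \<bullet> y) * char_fun \<nu> (c *\<^sub>R z)"
      by (intro AE_I2 tendsto_mult_left lim)
    show "AE z in G. norm (iexp (- (c *\<^sub>R z) \<bullet> y) * char_fun (\<nu>n n) (c *\<^sub>R z)) \<le> 1" for n
      by (intro AE_I2) (simp add: norm_mult norm_char_fun_le_1[OF n])
  qed
  then have "(\<lambda>n. complex_of_real (\<integral>x. exp (- (norm (c *\<^sub>R (y - x)))\<^sup>2 / 2) \<partial>\<nu>n n)) \<longlonglongrightarrow>
     of_real (\<integral>x. exp (- (norm (c *\<^sub>R (y - x)))\<^sup>2 / 2) \<partial>\<nu>)"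
    unfolding gaussian_kernel_integral[OF G nu] gaussian_kernel_integral[OF G n] .
  then show ?thesis by (simp only: tendsto_of_real_iff)
qed

lemma gaussian_mass:
  shows "(\<integral>\<^sup>+x. ennreal (exp (- (norm x)\<^sup>2 / 2)) \<partial>(lborel :: 'a::euclidean_space measure))
    = ennreal (sqrt (2 * pi) ^ DIM('a))"
proof -
  have 1: "(\<integral>\<^sup>+t. ennreal (exp (- t\<^sup>2 / 2)) \<partial>lborel) = ennreal (sqrt (2 * pi))"
  proof -
    have "(\<integral>\<^sup>+t. ennreal (std_normal_density t) \<partial>lborel) = 1"
      using prob_space.emeasure_space_1[OF prob_space_normal_density[of 1 0]]
      by (simp add: emeasure_density)
    then have "ennreal (sqrt (2 * pi)) * (\<integral>\<^sup>+t. ennreal (std_normal_density t) \<partial>lborel) = ennreal (sqrt (2 * pi))"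
      by simp
    then show ?thesis
      by (subst (asm) nn_integral_cmult[symmetric])
        (simp_all add: std_normal_density_def ennreal_mult[symmetric])
  qed
  have "(\<integral>\<^sup>+x. ennreal (exp (- (norm x)\<^sup>2 / 2)) \<partial>(lborel :: 'a measure)) =
      (\<integral>\<^sup>+x. (\<Prod>b\<in>Basis. ennreal (exp (- (x \<bullet> b)\<^sup>2 / 2))) \<partial>(lborel :: 'a measure))"
  proof (intro nn_integral_cong)
    fix x :: 'a
    have "- (norm x)\<^sup>2 / 2 = (\<Sum>b\<in>Basis. - (x \<bullet> b)\<^sup>2 / 2)"
      unfolding power2_norm_eq_inner euclidean_inner[of x x]
      by (simp add: power2_eq_square sum_negf sum_divide_distrib)
    then show "ennreal (exp (- (norm x)\<^sup>2 / 2)) = (\<Prod>b\<in>Basis. ennreal (exp (- (x \<bullet> b)\<^sup>2 / 2)))"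
      by (simp add: exp_sum prod_ennreal)
  qed
  also have "\<dots> = (\<Prod>b\<in>(Basis::'a set). (\<integral>\<^sup>+t. ennreal (exp (- t\<^sup>2 / 2)) \<partial>lborel))"
    by (rule nn_integral_lborel_prod[where f="\<lambda>_ t. ennreal (exp (- t\<^sup>2 / 2))"]) auto
  also have "\<dots> = ennreal (sqrt (2 * pi) ^ DIM('a))"
    unfolding 1 by (simp add: ennreal_power)
  finally show ?thesis .
qed

text \<open>
  The standard Gaussian law, given by its density so that Fatou's lemma applies to its convolutions.
\<close>

definition gauss_measure :: "'a::euclidean_space measure" where
  "gauss_measure = density lborel
     (\<lambda>x. ennreal (exp (- (norm x)\<^sup>2 / 2)) / ennreal (sqrt (2 * pi) ^ DIM('a)))"

lemma sets_gauss_measure [simp, measurable_cong]: "sets gauss_measure = sets borel"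
  by (simp add: gauss_measure_def)

lemma prob_space_gauss_measure: "prob_space (gauss_measure :: 'a::euclidean_space measure)"
proof
  show "emeasure (gauss_measure :: 'a measure) (space gauss_measure) = 1"
    unfolding gauss_measure_def
    using gaussian_mass[where 'a='a]
    by (subst emeasure_density) (auto simp: nn_integral_divide)
qed

lemma emeasure_gauss_measure_affine:
  fixes A :: "'a::euclidean_space set"
  assumes h: "h > 0" and A[measurable]: "A \<in> sets borel"
  shows "emeasure gauss_measure {u. x + h *\<^sub>R u \<in> A} =
     (\<integral>\<^sup>+y. ennreal (exp (- (norm ((1/h) *\<^sub>R (y - x)))\<^sup>2 / 2)) * indicator A y \<partial>lborel)
       / ennreal (h ^ DIM('a) * sqrt (2 * pi) ^ DIM('a))"
proof -
  let ?k = "\<lambda>y. ennreal (exp (- (norm ((1/h) *\<^sub>R (y - x)))\<^sup>2 / 2)) * indicator A y"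
  have "(\<integral>\<^sup>+y. ?k y \<partial>lborel) =
      (\<integral>\<^sup>+y. ?k y \<partial>density (distr lborel borel (\<lambda>u. x + h *\<^sub>R u)) (\<lambda>_. ennreal (h ^ DIM('a))))"
    using h by (subst lborel_affine[of h x]) auto
  also have "\<dots> = ennreal (h ^ DIM('a)) * (\<integral>\<^sup>+u. ?k (x + h *\<^sub>R u) \<partial>lborel)"
    by (simp add: nn_integral_density nn_integral_distr nn_integral_cmult)
  finally have 1: "(\<integral>\<^sup>+y. ?k y \<partial>lborel) = ennreal (h ^ DIM('a)) * (\<integral>\<^sup>+u. ?k (x + h *\<^sub>R u) \<partial>lborel)" .
  have "emeasure gauss_measure {u. x + h *\<^sub>R u \<in> A} =
      (\<integral>\<^sup>+u. ennreal (exp (- (norm u)\<^sup>2 / 2)) / ennreal (sqrt (2 * pi) ^ DIM('a)) * indicator {u. x + h *\<^sub>R u \<in> A} u \<partial>lborel)"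
    unfolding gauss_measure_def by (rule emeasure_density) measurable
  also have "\<dots> = (\<integral>\<^sup>+u. ?k (x + h *\<^sub>R u) / ennreal (sqrt (2 * pi) ^ DIM('a)) \<partial>lborel)"
    using h by (intro nn_integral_cong) (auto simp: indicator_def)
  also have "\<dots> = (\<integral>\<^sup>+u. ?k (x + h *\<^sub>R u) \<partial>lborel) / ennreal (sqrt (2 * pi) ^ DIM('a))"
    by (rule nn_integral_divide) measurable
  also have "\<dots> = (ennreal (h ^ DIM('a)) * (\<integral>\<^sup>+u. ?k (x + h *\<^sub>R u) \<partial>lborel)) /
      ennreal (h ^ DIM('a) * sqrt (2 * pi) ^ DIM('a))"
  proof -
    have c: "ennreal (h ^ DIM('a) * sqrt (2 * pi) ^ DIM('a)) = ennreal (sqrt (2 * pi) ^ DIM('a)) * ennreal (h ^ DIM('a))"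
      using h by (subst ennreal_mult[symmetric]) (simp_all add: mult.commute)
    show ?thesis
      unfolding c mult.commute[of "ennreal (h ^ DIM('a))" "integral\<^sup>N _ _"]
      using h by (subst divide_mult_eq) auto
  qed
  finally show ?thesis unfolding 1[symmetric] .
qed

lemma gauss_measure_concentrates:
  assumes "d > 0" "\<eta> > 0"
  shows "\<exists>h>0. emeasure gauss_measure {u::'a::euclidean_space. norm (h *\<^sub>R u) \<ge> d} \<le> ennreal \<eta>"
proof -
  interpret G: prob_space "gauss_measure :: 'a measure" by (rule prob_space_gauss_measure)
  let ?A = "\<lambda>n::nat. {u::'a. norm u \<ge> real n * d}"
  have "(\<lambda>n. measure gauss_measure (?A n)) \<longlonglongrightarrow> measure gauss_measure (\<Inter>n. ?A n)"
  proof (rule G.finite_Lim_measure_decseq)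
    have "real m * d \<le> norm u" if "m \<le> n" "real n * d \<le> norm u" for m n and u :: 'a
    proof -
      have "real m * d \<le> real n * d" using that(1) assms by (intro mult_right_mono) auto
      then show ?thesis using that(2) by linarith
    qed
    then show "decseq ?A" by (auto simp: decseq_def)
  qed auto
  moreover have "(\<Inter>n. ?A n) = {}"
  proof -
    have "\<exists>n::nat. norm u < real n * d" for u :: 'a
      using reals_Archimedean3[OF \<open>d > 0\<close>] by blast
    then show ?thesis by (force simp flip: not_less)
  qed
  ultimately have "(\<lambda>n. measure gauss_measure (?A n)) \<longlonglongrightarrow> 0" by simp
  then have "eventually (\<lambda>n. measure gauss_measure (?A n) < \<eta>) sequentially"
    using assms by (intro order_tendstoD)
  then obtain n where n: "measure gauss_measure (?A n) < \<eta>" "n > 0"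
    using eventually_happens[OF eventually_conj[OF _ eventually_gt_at_top[of 0]]] by force
  have eq: "{u::'a. norm ((1 / real n) *\<^sub>R u) \<ge> d} = ?A n"
    using n by (auto simp: field_simps)
  show ?thesis
  proof (intro exI[of _ "1 / real n"] conjI)
    show "emeasure gauss_measure {u::'a. norm ((1 / real n) *\<^sub>R u) \<ge> d} \<le> ennreal \<eta>"
      using n unfolding eq by (simp add: G.emeasure_eq_measure ennreal_leI)
  qed (use n in auto)
qed

text \<open>
  The convolution of \<open>\<nu>\<close> with a centred Gaussian law of scale \<open>h\<close>, evaluated at \<open>A\<close>, is the
  integral over \<open>A\<close> of a density, and the density at \<open>y\<close> is a Gaussian kernel integral.
\<close>

lemma smoothed_measure_density:
  fixes \<nu> :: "'a::euclidean_space measure"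
  assumes nu: "prob_space \<nu>" "sets \<nu> = sets borel" and h: "h > 0" and A[measurable]: "A \<in> sets borel"
  shows "(\<integral>\<^sup>+x. emeasure gauss_measure {u. x + h *\<^sub>R u \<in> A} \<partial>\<nu>) =
    (\<integral>\<^sup>+y. ennreal (\<integral>x. exp (- (norm ((1/h) *\<^sub>R (y - x)))\<^sup>2 / 2) \<partial>\<nu>) * indicator A y \<partial>lborel)
       / ennreal (h ^ DIM('a) * sqrt (2 * pi) ^ DIM('a))"
proof -
  interpret nu: prob_space \<nu> by fact
  interpret P: pair_sigma_finite \<nu> "lborel :: 'a measure" ..
  note [measurable_cong] = nu(2)
  let ?k = "\<lambda>x y. ennreal (exp (- (norm ((1/h) *\<^sub>R (y - x)))\<^sup>2 / 2))"
  let ?c = "ennreal (h ^ DIM('a) * sqrt (2 * pi) ^ DIM('a))"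
  have "(\<integral>\<^sup>+x. emeasure gauss_measure {u. x + h *\<^sub>R u \<in> A} \<partial>\<nu>) =
     (\<integral>\<^sup>+x. (\<integral>\<^sup>+y. ?k x y * indicator A y \<partial>lborel) / ?c \<partial>\<nu>)"
    by (simp add: emeasure_gauss_measure_affine[OF h A])
  also have "\<dots> = (\<integral>\<^sup>+x. (\<integral>\<^sup>+y. ?k x y * indicator A y \<partial>lborel) \<partial>\<nu>) / ?c"
    by (rule nn_integral_divide) measurable
  also have "(\<integral>\<^sup>+x. (\<integral>\<^sup>+y. ?k x y * indicator A y \<partial>lborel) \<partial>\<nu>) =
      (\<integral>\<^sup>+y. (\<integral>\<^sup>+x. ?k x y * indicator A y \<partial>\<nu>) \<partial>lborel)"
    by (rule P.Fubini'[symmetric]) measurable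
  also have "\<dots> = (\<integral>\<^sup>+y. ennreal (\<integral>x. exp (- (norm ((1/h) *\<^sub>R (y - x)))\<^sup>2 / 2) \<partial>\<nu>) * indicator A y \<partial>lborel)"
  proof (intro nn_integral_cong)
    fix y
    have "(\<integral>\<^sup>+x. ?k x y \<partial>\<nu>) = ennreal (\<integral>x. exp (- (norm ((1/h) *\<^sub>R (y - x)))\<^sup>2 / 2) \<partial>\<nu>)"
      by (intro nn_integral_eq_integral nu.integrable_const_bound[where B=1]) auto
    then show "(\<integral>\<^sup>+x. ?k x y * indicator A y \<partial>\<nu>) =
       ennreal (\<integral>x. exp (- (norm ((1/h) *\<^sub>R (y - x)))\<^sup>2 / 2) \<partial>\<nu>) * indicator A y"
      by (simp add: nn_integral_multc)
  qed
  finally show ?thesis .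
qed

text \<open>
  One half of a portmanteau theorem. The smoothed densities converge pointwise by Parseval, so
  Fatou's lemma compares the smoothed measures on any Borel set; the smoothing moves mass by less than
  \<open>d/2\<close> up to probability \<open>\<eta>/4\<close>, which costs half of the thickening on each side.
\<close>

lemma char_fun_tendsto_imp_lower:
  fixes \<nu> :: "'a::euclidean_space measure" and \<nu>n :: "nat \<Rightarrow> 'a measure"
  assumes n: "\<And>n. prob_space (\<nu>n n)" "\<And>n. sets (\<nu>n n) = sets borel"
    and nu: "prob_space \<nu>" "sets \<nu> = sets borel"
    and lim: "\<And>z. (\<lambda>n. char_fun (\<nu>n n) z) \<longlonglongrightarrow> char_fun \<nu> z"
    and A: "A \<in> sets borel" and d: "d > 0" and eta: "\<eta> > 0"
  shows "\<forall>\<^sub>F n in sequentially. measure \<nu> A \<le> measure (\<nu>n n) (thickening d A) + \<eta>"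
proof -
  interpret nu: prob_space \<nu> by fact
  interpret n: prob_space "\<nu>n n" for n by fact
  interpret G: prob_space "gauss_measure :: 'a measure" by (rule prob_space_gauss_measure)
  note [measurable_cong] = nu(2) n(2)
  note [measurable] = A
  obtain h where h: "h > 0" and hG: "emeasure gauss_measure {u::'a. norm (h *\<^sub>R u) \<ge> d/2} \<le> ennreal (\<eta>/4)"
    using gauss_measure_concentrates[of "d/2" "\<eta>/4"] d eta by auto
  define N where "N = {u::'a. norm (h *\<^sub>R u) \<ge> d/2}"
  have N[measurable]: "N \<in> sets borel" unfolding N_def by measurable
  define A1 where "A1 = thickening (d/2) A"
  have A1[measurable]: "A1 \<in> sets borel" by (simp add: A1_def)
  define S where "S \<kappa> = (\<integral>\<^sup>+x. emeasure gauss_measure {u. x + h *\<^sub>R u \<in> A1} \<partial>\<kappa>)" for \<kappa> :: "'a measure"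
  have meas[measurable]: "(\<lambda>x. emeasure gauss_measure {u. x + h *\<^sub>R u \<in> A1}) \<in> borel_measurable borel"
    unfolding emeasure_gauss_measure_affine[OF h A1] by measurable
  have "S \<nu> \<le> liminf (\<lambda>n. S (\<nu>n n))"
  proof -
    let ?c = "ennreal (h ^ DIM('a) * sqrt (2 * pi) ^ DIM('a))"
    let ?g = "\<lambda>\<kappa> y. ennreal (\<integral>x. exp (- (norm ((1/h) *\<^sub>R (y - x)))\<^sup>2 / 2) \<partial>\<kappa>) * indicator A1 y / ?c"
    have S: "S \<kappa> = (\<integral>\<^sup>+y. ?g \<kappa> y \<partial>lborel)" if k: "prob_space \<kappa>" and k2[measurable_cong]: "sets \<kappa> = sets borel" for \<kappa> :: "'a measure"
    proof -
      interpret k: prob_space \<kappa> by fact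
      show ?thesis
        unfolding S_def smoothed_measure_density[OF k k2 h A1]
        by (rule nn_integral_divide[symmetric]) measurable
    qed
    have "(\<integral>\<^sup>+y. ?g \<nu> y \<partial>lborel) = (\<integral>\<^sup>+y. liminf (\<lambda>n. ?g (\<nu>n n) y) \<partial>lborel)"
    proof (intro nn_integral_cong)
      fix y
      have "(\<lambda>n. ?g (\<nu>n n) y) \<longlonglongrightarrow> ?g \<nu> y"
      proof (cases "y \<in> A1")
        case True
        have c: "0 < h ^ DIM('a) * sqrt (2 * pi) ^ DIM('a)" using h by simp
        have "(\<lambda>n. ennreal (\<integral>x. exp (- (norm ((1/h) *\<^sub>R (y - x)))\<^sup>2 / 2) \<partial>\<nu>n n) / ?c) \<longlonglongrightarrow>
          ennreal (\<integral>x. exp (- (norm ((1/h) *\<^sub>R (y - x)))\<^sup>2 / 2) \<partial>\<nu>) / ?c"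
          using c gaussian_kernel_integral_tendsto[OF n nu lim, of "1/h" y]
          by (subst (1 2) divide_ennreal) (auto intro!: tendsto_ennrealI tendsto_divide integral_nonneg)
        then show ?thesis using True by simp
      qed simp
      then show "?g \<nu> y = liminf (\<lambda>n. ?g (\<nu>n n) y)"
        by (intro lim_imp_Liminf[symmetric]) auto
    qed
    also have "\<dots> \<le> liminf (\<lambda>n. \<integral>\<^sup>+y. ?g (\<nu>n n) y \<partial>lborel)"
      by (rule nn_integral_liminf) measurable
    finally show ?thesis using S[OF nu] S[OF n] by simp
  qed
  moreover have "ennreal (measure \<nu> A - \<eta>/4) \<le> S \<nu>"
  proof -
    have "ennreal (1 - \<eta>/4) * indicator A x \<le> emeasure gauss_measure {u. x + h *\<^sub>R u \<in> A1}" for x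
    proof (cases "x \<in> A")
      case True
      have "measure gauss_measure (UNIV - N) = 1 - measure gauss_measure N"
        using G.prob_compl[of N] by (simp add: gauss_measure_def)
      moreover have "measure gauss_measure N \<le> \<eta>/4"
        using hG eta unfolding N_def[symmetric] by (simp add: G.emeasure_eq_measure)
      ultimately have "1 - \<eta>/4 \<le> measure gauss_measure (UNIV - N)" by simp
      also have "\<dots> \<le> measure gauss_measure {u. x + h *\<^sub>R u \<in> A1}"
      proof (rule G.finite_measure_mono)
        show "UNIV - N \<subseteq> {u. x + h *\<^sub>R u \<in> A1}"
          using True by (auto simp: A1_def thickening_def N_def dist_norm intro!: bexI[of _ x])
        show "{u. x + h *\<^sub>R u \<in> A1} \<in> sets gauss_measure" by measurable
      qed
      finally show ?thesis using True by (simp add: G.emeasure_eq_measure)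
    qed simp
    then have "(\<integral>\<^sup>+x. ennreal (1 - \<eta>/4) * indicator A x \<partial>\<nu>) \<le> S \<nu>"
      unfolding S_def by (intro nn_integral_mono)
    then have "ennreal (1 - \<eta>/4) * ennreal (measure \<nu> A) \<le> S \<nu>"
      by (simp add: nn_integral_cmult nu.emeasure_eq_measure)
    moreover have "ennreal (measure \<nu> A - \<eta>/4) \<le> ennreal (1 - \<eta>/4) * ennreal (measure \<nu> A)"
    proof (cases "1 - \<eta>/4 \<ge> 0")
      case True
      have "\<eta>/4 * measure \<nu> A \<le> \<eta>/4 * 1" using eta by (intro mult_left_mono) auto
      then show ?thesis using True by (simp add: ennreal_mult'[symmetric] ennreal_leI algebra_simps)
    next
      case False
      moreover have "measure \<nu> A \<le> 1" by simp
      ultimately have "measure \<nu> A - \<eta>/4 \<le> 0" by linarith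
      then show ?thesis by (subst ennreal_neg) auto
    qed
    ultimately show ?thesis by order
  qed
  moreover have Sn: "S (\<nu>n n) \<le> ennreal (measure (\<nu>n n) (thickening d A) + \<eta>/4)" for n
  proof -
    have "emeasure gauss_measure {u. x + h *\<^sub>R u \<in> A1} \<le> indicator (thickening d A) x + ennreal (\<eta>/4)" for x
    proof (cases "x \<in> thickening d A")
      case True
      then show ?thesis using G.emeasure_le_1 by (simp add: add_increasing2)
    next
      case False
      have "{u. x + h *\<^sub>R u \<in> A1} \<subseteq> N"
      proof
        fix u assume "u \<in> {u. x + h *\<^sub>R u \<in> A1}"
        then obtain a where a: "a \<in> A" "dist (x + h *\<^sub>R u) a < d/2" by (auto simp: A1_def thickening_def)
        have "dist x a \<ge> d" using False a(1) by (auto simp: thickening_def not_less)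
        moreover have "dist x a \<le> dist x (x + h *\<^sub>R u) + dist (x + h *\<^sub>R u) a" by (rule dist_triangle)
        moreover have "dist x (x + h *\<^sub>R u) = norm (h *\<^sub>R u)" by (simp add: dist_norm)
        ultimately show "u \<in> N" using a(2) by (simp add: N_def)
      qed
      then have "emeasure gauss_measure {u. x + h *\<^sub>R u \<in> A1} \<le> emeasure gauss_measure N"
        by (intro emeasure_mono) auto
      also have "\<dots> \<le> ennreal (\<eta>/4)" using hG by (simp add: N_def)
      finally show ?thesis using False by simp
    qed
    then have "S (\<nu>n n) \<le> (\<integral>\<^sup>+x. indicator (thickening d A) x + ennreal (\<eta>/4) \<partial>\<nu>n n)"
      unfolding S_def by (intro nn_integral_mono)
    also have "\<dots> = ennreal (measure (\<nu>n n) (thickening d A) + \<eta>/4)"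
      using eta by (subst nn_integral_add) (auto simp: n.emeasure_eq_measure n.prob_space)
    finally show ?thesis .
  qed
  show ?thesis
  proof (cases "measure \<nu> A - \<eta>/2 \<ge> 0")
    case True
    then have "ennreal (measure \<nu> A - \<eta>/2) < ennreal (measure \<nu> A - \<eta>/4)"
      using eta by (intro ennreal_lessI) auto
    with calculation have "ennreal (measure \<nu> A - \<eta>/2) < liminf (\<lambda>n. S (\<nu>n n))" by order
    then have "\<forall>\<^sub>F n in sequentially. ennreal (measure \<nu> A - \<eta>/2) < S (\<nu>n n)"
      by (rule less_LiminfD)
    then show ?thesis
    proof eventually_elim
      case (elim n)
      then have "ennreal (measure \<nu> A - \<eta>/2) < ennreal (measure (\<nu>n n) (thickening d A) + \<eta>/4)"
        using Sn[of n] by order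
      then have "measure \<nu> A - \<eta>/2 < measure (\<nu>n n) (thickening d A) + \<eta>/4"
        using True by (subst (asm) ennreal_less_iff) auto
      then show ?case using eta by simp
    qed
  next
    case False
    then show ?thesis using eta by (intro always_eventually allI) (simp add: add_increasing)
  qed
qed

text \<open>
  Apply the lower bound to the complement of the thickened set.
\<close>

lemma char_fun_tendsto_imp_upper:
  fixes \<nu> :: "'a::euclidean_space measure" and \<nu>n :: "nat \<Rightarrow> 'a measure"
  assumes n: "\<And>n. prob_space (\<nu>n n)" "\<And>n. sets (\<nu>n n) = sets borel"
    and nu: "prob_space \<nu>" "sets \<nu> = sets borel"
    and lim: "\<And>z. (\<lambda>n. char_fun (\<nu>n n) z) \<longlonglongrightarrow> char_fun \<nu> z"
    and A: "A \<in> sets borel" and d: "d > 0" and eta: "\<eta> > 0"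
  shows "\<forall>\<^sub>F n in sequentially. measure (\<nu>n n) A \<le> measure \<nu> (thickening d A) + \<eta>"
proof -
  interpret nu: prob_space \<nu> by fact
  interpret n: prob_space "\<nu>n n" for n by fact
  note [measurable_cong] = nu(2) n(2)
  note [measurable] = A
  let ?B = "UNIV - thickening d A"
  have sub: "thickening d ?B \<subseteq> UNIV - A" by (force simp: thickening_def dist_commute)
  have "\<forall>\<^sub>F n in sequentially. measure \<nu> ?B \<le> measure (\<nu>n n) (thickening d ?B) + \<eta>"
    by (rule char_fun_tendsto_imp_lower[OF n nu lim _ d eta]) auto
  then show ?thesis
  proof eventually_elim
    case (elim m)
    have "measure (\<nu>n m) (thickening d ?B) \<le> measure (\<nu>n m) (UNIV - A)"
      using sub n(2) by (intro n.finite_measure_mono) auto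
    moreover have "measure (\<nu>n m) (UNIV - A) = 1 - measure (\<nu>n m) A"
      using n.prob_compl[of A m] n(2) A sets_eq_imp_space_eq[OF n(2)[of m]] by simp
    moreover have "measure \<nu> ?B = 1 - measure \<nu> (thickening d A)"
      using nu.prob_compl[of "thickening d A"] nu(2) sets_eq_imp_space_eq[OF nu(2)] by simp
    ultimately show ?case using elim by linarith
  qed
qed

section \<open>Random walks approximating an infinitely divisible law\<close>

text \<open>
  The law of a single nonzero jump. For \<open>K = 0\<close> the normalisation is meaningless and a point mass
  keeps it a probability measure; it then enters \<open>jump_law\<close> with weight \<open>0\<close>.
\<close>

definition jump_shape :: "'a::euclidean_space measure \<Rightarrow> 'a measure" where
  "jump_shape K = (if measure K UNIV = 0 then return borel 0 else density K (\<lambda>_. ennreal (1 / measure K UNIV)))"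

text \<open>
  The law \<open>(1 - |K|/N) \<delta>\<^sub>0 + K/N\<close>, realised as a Bernoulli variable deciding whether there is a jump
  at all, times an independent jump.
\<close>

definition jump_law :: "'a::euclidean_space measure \<Rightarrow> nat \<Rightarrow> 'a measure" where
  "jump_law K N = distr (measure_pmf (bernoulli_pmf (measure K UNIV / real N)) \<Otimes>\<^sub>M jump_shape K)
     borel (\<lambda>(b, x). if b then x else 0)"

lemma sets_jump_law [simp, measurable_cong]: "sets (jump_law K N) = sets borel"
  by (simp add: jump_law_def)

text \<open>
  The factor \<open>2\<close> in the bound on the mass keeps the atom of \<open>jump_law K N\<close> at \<open>0\<close> at least \<open>1/2\<close>, so that
  dropping one of the \<open>N\<close> steps changes an exponential moment by a factor of at most \<open>2\<close>.
\<close>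

locale jump_intensity = finite_measure K for K :: "'a::euclidean_space measure" +
  fixes N :: nat
  assumes sets_K [measurable_cong]: "sets K = sets borel"
    and N_pos: "N > 0" and mass_le: "2 * measure K UNIV \<le> real N"
begin

lemma space_K [simp]: "space K = UNIV"
  using sets_eq_imp_space_eq[OF sets_K] by simp

lemma sets_jump_shape [measurable_cong]: "sets (jump_shape K) = sets borel"
  by (simp add: jump_shape_def sets_K)

lemma prob_space_jump_shape: "prob_space (jump_shape K)"
proof (cases "measure K UNIV = 0")
  case False
  then have "measure K UNIV > 0" by (simp add: zero_less_measure_iff order_less_le)
  then show ?thesis
    by (intro prob_spaceI) (simp add: jump_shape_def emeasure_density emeasure_eq_measure ennreal_mult'[symmetric])
qed (simp add: jump_shape_def prob_space_return)

lemma divide_N_times_N: "x / ennreal (real N) * ennreal (real N) = x"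
  using N_pos ennreal_mult_divide_eq[of "ennreal (real N)" x]
  by (simp add: ennreal_divide_times ennreal_times_divide mult.commute)

lemma jump_probability_bounds: "0 \<le> measure K UNIV / real N" "measure K UNIV / real N \<le> 1"
  using N_pos mass_le measure_nonneg[of K UNIV] by (simp_all add: field_simps)

lemma nn_integral_jump_shape:
  assumes "f \<in> borel_measurable borel"
  shows "ennreal (measure K UNIV / real N) * (\<integral>\<^sup>+x. f x \<partial>jump_shape K) = (\<integral>\<^sup>+x. f x \<partial>K) / ennreal (real N)"
proof (cases "measure K UNIV = 0")
  case True
  then have "emeasure K (space K) = 0" by (simp add: emeasure_eq_measure)
  then have "(\<integral>\<^sup>+x. f x \<partial>K) = 0"
    using nn_integral_null_set[of "space K" K f] by (simp add: null_sets_def)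
  then show ?thesis using True by simp
next
  case False
  note [measurable] = assms
  have pos: "measure K UNIV > 0" using False by (simp add: order_less_le)
  have "(\<integral>\<^sup>+x. f x \<partial>jump_shape K) = ennreal (1 / measure K UNIV) * (\<integral>\<^sup>+x. f x \<partial>K)"
    using False by (simp add: jump_shape_def nn_integral_density nn_integral_cmult)
  then have "ennreal (measure K UNIV / real N) * (\<integral>\<^sup>+x. f x \<partial>jump_shape K) =
     (ennreal (measure K UNIV / real N) * ennreal (1 / measure K UNIV)) * (\<integral>\<^sup>+x. f x \<partial>K)"
    by (simp add: mult.assoc)
  also have "ennreal (measure K UNIV / real N) * ennreal (1 / measure K UNIV) = ennreal (1 / real N)"
    using pos N_pos by (subst ennreal_mult[symmetric]) auto
  also have "ennreal (1 / real N) = 1 / ennreal (real N)"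
    using N_pos by (subst divide_ennreal[symmetric]) auto
  finally show ?thesis by (simp add: ennreal_times_divide mult.commute)
qed

lemma integral_jump_shape:
  fixes f :: "'a \<Rightarrow> complex"
  assumes [measurable]: "f \<in> borel_measurable borel"
  shows "of_real (measure K UNIV / real N) * (\<integral>x. f x \<partial>jump_shape K) = (\<integral>x. f x \<partial>K) / of_nat N"
proof (cases "measure K UNIV = 0")
  case True
  then have "emeasure K (space K) = 0" by (simp add: emeasure_eq_measure)
  then have "AE x in K. f x = 0"
    by (intro AE_I'[of "space K"]) (auto simp: null_sets_def)
  then have "(\<integral>x. f x \<partial>K) = 0"
    by (simp add: integral_eq_zero_AE)
  then show ?thesis using True by simp
next
  case False
  have "(\<integral>x. f x \<partial>jump_shape K) = (1 / measure K UNIV) *\<^sub>R (\<integral>x. f x \<partial>K)"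
    using False by (simp add: jump_shape_def integral_density)
  then show ?thesis using False by (simp add: scaleR_conv_of_real)
qed

lemma prob_space_jump_law: "prob_space (jump_law K N)"
proof -
  interpret n: prob_space "jump_shape K" by (rule prob_space_jump_shape)
  interpret P: pair_prob_space "measure_pmf (bernoulli_pmf (measure K UNIV / real N))" "jump_shape K" ..
  show ?thesis unfolding jump_law_def by (rule P.prob_space_distr) measurable
qed

lemma nn_integral_jump_law:
  assumes f[measurable]: "f \<in> borel_measurable borel"
  shows "(\<integral>\<^sup>+x. f x \<partial>jump_law K N) =
     ennreal (1 - measure K UNIV / real N) * f 0 + (\<integral>\<^sup>+x. f x \<partial>K) / ennreal (real N)"
proof -
  interpret n: prob_space "jump_shape K" by (rule prob_space_jump_shape)
  let ?p = "measure K UNIV / real N"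
  let ?B = "measure_pmf (bernoulli_pmf ?p)"
  interpret P: pair_prob_space ?B "jump_shape K" ..
  have "(\<integral>\<^sup>+x. f x \<partial>jump_law K N) = (\<integral>\<^sup>+y. f (case y of (b, x) \<Rightarrow> if b then x else 0) \<partial>(?B \<Otimes>\<^sub>M jump_shape K))"
    unfolding jump_law_def by (rule nn_integral_distr) measurable
  also have "\<dots> = (\<integral>\<^sup>+b. \<integral>\<^sup>+x. f (if b then x else 0) \<partial>jump_shape K \<partial>?B)"
    by (subst n.nn_integral_fst[symmetric]) (auto intro: measurable_compose[OF _ f])
  also have "\<dots> = ennreal ?p * (\<integral>\<^sup>+x. f x \<partial>jump_shape K) + ennreal (1 - ?p) * f 0"
    using jump_probability_bounds by (simp add: nn_integral_bernoulli_pmf n.emeasure_space_1 mult.commute)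
  finally show ?thesis by (simp add: nn_integral_jump_shape add.commute)
qed

lemma integral_jump_law:
  fixes f :: "'a \<Rightarrow> complex"
  assumes f[measurable]: "f \<in> borel_measurable borel" and bd: "\<And>x. norm (f x) \<le> C"
  shows "(\<integral>x. f x \<partial>jump_law K N) = f 0 + (\<integral>x. f x - f 0 \<partial>K) / of_nat N"
proof -
  interpret n: prob_space "jump_shape K" by (rule prob_space_jump_shape)
  let ?p = "measure K UNIV / real N"
  let ?B = "measure_pmf (bernoulli_pmf ?p)"
  interpret P: pair_prob_space ?B "jump_shape K" ..
  have [measurable]: "(\<lambda>y. f (case y of (b, x) \<Rightarrow> if b then x else 0)) \<in> borel_measurable (?B \<Otimes>\<^sub>M jump_shape K)"
    by measurable
  have "(\<integral>x. f x \<partial>jump_law K N) = (\<integral>y. f (case y of (b, x) \<Rightarrow> if b then x else 0) \<partial>(?B \<Otimes>\<^sub>M jump_shape K))"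
    unfolding jump_law_def by (rule integral_distr) measurable
  also have "\<dots> = (\<integral>b. \<integral>x. f (if b then x else 0) \<partial>jump_shape K \<partial>?B)"
    by (subst P.integral_fst'[symmetric]) (auto intro!: P.integrable_const_bound[where B=C] bd)
  also have "\<dots> = of_real ?p * (\<integral>x. f x \<partial>jump_shape K) + of_real (1 - ?p) * f 0"
    using jump_probability_bounds by (subst integral_measure_pmf[of UNIV]) (auto simp: UNIV_bool n.prob_space scaleR_conv_of_real)
  also have "\<dots> = f 0 + ((\<integral>x. f x \<partial>K) - of_real (measure K UNIV) * f 0) / of_nat N"
    using integral_jump_shape[OF f] N_pos by (simp add: field_simps)
  also have "(\<integral>x. f x \<partial>K) - of_real (measure K UNIV) * f 0 = (\<integral>x. f x - f 0 \<partial>K)"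
    by (subst Bochner_Integration.integral_diff)
      (auto intro!: integrable_const_bound[where B=C] bd simp: scaleR_conv_of_real cong: measurable_cong_sets)
  finally show ?thesis by simp
qed

definition walk :: "'a \<Rightarrow> (nat \<Rightarrow> 'a) \<Rightarrow> 'a" where
  "walk c \<omega> = c + (\<Sum>j<N. \<omega> j)"

definition steps :: "(nat \<Rightarrow> 'a) measure" where
  "steps = Pi\<^sub>M {..<N} (\<lambda>_. jump_law K N)"

definition walk_law :: "'a \<Rightarrow> 'a measure" where
  "walk_law c = distr steps borel (walk c)"

lemma product_prob_space_jump_law: "product_prob_space (\<lambda>_::nat. jump_law K N)"
  by (intro product_prob_spaceI prob_space_jump_law)

lemma steps_component: "j < N \<Longrightarrow> (\<lambda>\<omega>. \<omega> j) \<in> measurable steps borel"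
  unfolding steps_def using measurable_component_singleton[of j "{..<N}" "\<lambda>_. jump_law K N"]
  by (simp cong: measurable_cong_sets)

lemma walk_measurable [measurable]: "walk c \<in> measurable steps borel"
  unfolding walk_def
  by (intro borel_measurable_add borel_measurable_const borel_measurable_sum) (simp add: steps_component)

lemma prob_space_steps: "prob_space steps"
proof -
  interpret product_prob_space "\<lambda>_::nat. jump_law K N" "{..<N}" by (rule product_prob_space_jump_law)
  show ?thesis unfolding steps_def by (rule P.prob_space_axioms)
qed

lemma sets_walk_law [simp, measurable_cong]: "sets (walk_law c) = sets borel"
  by (simp add: walk_law_def)

lemma prob_space_walk_law: "prob_space (walk_law c)"
  unfolding walk_law_def by (rule prob_space.prob_space_distr[OF prob_space_steps]) measurable

lemma nn_integral_steps_prod: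
  assumes "\<And>i. i < N \<Longrightarrow> f i \<in> borel_measurable borel"
  shows "(\<integral>\<^sup>+\<omega>. (\<Prod>i<N. f i (\<omega> i)) \<partial>steps) = (\<Prod>i<N. \<integral>\<^sup>+x. f i x \<partial>jump_law K N)"
proof -
  interpret product_prob_space "\<lambda>_::nat. jump_law K N" "{..<N}" by (rule product_prob_space_jump_law)
  show ?thesis unfolding steps_def using assms
    by (intro product_nn_integral_prod) (auto cong: measurable_cong_sets)
qed

lemma char_fun_jump_law:
  "char_fun (jump_law K N) z = 1 + (CLINT x|K. iexp (z \<bullet> x) - 1) / of_nat N"
  unfolding char_fun_def using integral_jump_law[of "\<lambda>x. iexp (z \<bullet> x)" 1] by simp

lemma char_fun_walk_law:
  "char_fun (walk_law c) z = iexp (z \<bullet> c) * (1 + (CLINT x|K. iexp (z \<bullet> x) - 1) / of_nat N) ^ N"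
proof -
  interpret product_prob_space "\<lambda>_::nat. jump_law K N" "{..<N}" by (rule product_prob_space_jump_law)
  have "char_fun (walk_law c) z = (CLINT \<omega>|steps. iexp (z \<bullet> walk c \<omega>))"
    unfolding char_fun_def walk_law_def by (rule integral_distr) measurable
  also have "\<dots> = (CLINT \<omega>|steps. iexp (z \<bullet> c) * (\<Prod>i<N. iexp (z \<bullet> \<omega> i)))"
    by (simp add: walk_def inner_add_right inner_sum_right distrib_left sum_distrib_left exp_add exp_sum)
  also have "\<dots> = iexp (z \<bullet> c) * (CLINT \<omega>|steps. (\<Prod>i<N. iexp (z \<bullet> \<omega> i)))"
    by (rule integral_mult_right_zero)
  also have "(CLINT \<omega>|steps. (\<Prod>i<N. iexp (z \<bullet> \<omega> i))) = (\<Prod>i<N. char_fun (jump_law K N) z)"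
    unfolding steps_def char_fun_def
  proof (rule product_integral_prod)
    show "complex_integrable (jump_law K N) (\<lambda>x. iexp (z \<bullet> x))" for i
      by (rule M.integrable_const_bound[where B=1]) (simp, measurable)
  qed simp
  finally show ?thesis by (simp add: char_fun_jump_law)
qed

text \<open>
  This is \<open>(1 + w/N)\<^sup>N \<approx> e\<^sup>w\<close> with an explicit error: both \<open>1 + w/N\<close> and \<open>e\<^bsup>w/N\<^esup>\<close> have modulus at most
  \<open>1\<close>, so their \<open>N\<close>-th powers differ by at most \<open>N\<close> times their difference, which is of order
  \<open>|w|\<^sup>2/N\<^sup>2\<close>.
\<close>

lemma char_fun_walk_law_approx:
  "norm (char_fun (walk_law c) z - iexp (z \<bullet> c) * exp (CLINT x|K. iexp (z \<bullet> x) - 1))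
     \<le> 12 * (measure K UNIV)\<^sup>2 / real N"
proof -
  let ?w = "CLINT x|K. iexp (z \<bullet> x) - 1"
  define u where "u = ?w / of_nat N"
  note [measurable_cong] = sets_K
  have [measurable]: "(\<lambda>x. iexp (z \<bullet> x) - 1) \<in> borel_measurable K"
    by measurable
  have bd: "norm (iexp t - 1) \<le> 2" for t :: real
    using norm_triangle_ineq4[of "iexp t" 1] by simp
  have "norm ?w \<le> (\<integral>x. norm (iexp (z \<bullet> x) - 1) \<partial>K)" by (rule integral_norm_bound)
  also have "\<dots> \<le> (\<integral>x. 2 \<partial>K)"
    by (intro integral_mono integrable_const_bound[where B=2]) (auto simp: bd)
  finally have w: "norm ?w \<le> 2 * measure K UNIV" by simp
  have "Re ?w = (\<integral>x. Re (iexp (z \<bullet> x) - 1) \<partial>K)"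
    by (rule integral_Re[symmetric], rule integrable_const_bound[where B=2]) (auto simp: bd)
  also have "\<dots> \<le> (\<integral>x. 0 \<partial>K)"
    by (intro integral_mono' ) (auto simp: Re_exp)
  finally have Re: "Re ?w \<le> 0" by simp
  have u1: "norm u \<le> 1"
    using w mass_le N_pos by (simp add: u_def norm_divide divide_le_eq)
  have "norm (exp u - (\<Sum>k\<le>1. u ^ k / fact k)) \<le> exp \<bar>Re u\<bar> * norm u ^ Suc 1 / fact 1"
    by (rule Taylor_exp)
  also have "\<dots> \<le> 3 * norm u ^ Suc 1 / fact 1"
  proof -
    have "exp \<bar>Re u\<bar> \<le> exp 1" using u1 abs_Re_le_cmod[of u] by simp
    also have "exp 1 \<le> (3::real)" by (rule exp_le)
    finally show ?thesis by (intro divide_right_mono mult_right_mono) auto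
  qed
  finally have 3: "norm ((1 + u) - exp u) \<le> 3 * (norm u)\<^sup>2"
    by (simp add: norm_minus_commute power2_eq_square)
  have "norm ((1 + u) ^ N - exp u ^ N) \<le> real N * norm ((1 + u) - exp u)"
  proof (rule norm_power_diff)
    show "norm (1 + u) \<le> 1"
      using norm_char_fun_le_1[OF prob_space_jump_law sets_jump_law, of z] by (simp add: char_fun_jump_law u_def)
    show "norm (exp u) \<le> 1" using Re by (simp add: u_def divide_nonpos_nonneg)
  qed
  also have "\<dots> \<le> real N * (3 * (norm u)\<^sup>2)"
    using 3 by (intro mult_left_mono) auto
  also have "\<dots> = 3 * (norm ?w)\<^sup>2 / real N"
    using N_pos by (simp add: u_def norm_divide power2_eq_square)
  also have "\<dots> \<le> 3 * (2 * measure K UNIV)\<^sup>2 / real N"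
    using w by (intro divide_right_mono mult_left_mono power_mono) auto
  finally have "norm ((1 + u) ^ N - exp u ^ N) \<le> 12 * (measure K UNIV)\<^sup>2 / real N"
    by (simp add: power_mult_distrib)
  moreover have "exp u ^ N = exp ?w"
    using N_pos by (simp add: u_def exp_of_nat_mult[symmetric])
  moreover have "char_fun (walk_law c) z - iexp (z \<bullet> c) * exp ?w = iexp (z \<bullet> c) * ((1 + u) ^ N - exp ?w)"
    by (simp add: char_fun_walk_law u_def right_diff_distrib)
  ultimately show ?thesis by (simp add: norm_mult)
qed

end

section \<open>Exponential moments of the truncated walk\<close>

definition trunc :: "real \<Rightarrow> 'a::real_normed_vector \<Rightarrow> 'a" where
  "trunc L x = (if norm x \<le> L then x else 0)"

lemma trunc_measurable [measurable]: "trunc L \<in> borel_measurable (borel :: 'a::euclidean_space measure)"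
  unfolding trunc_def by measurable

lemma norm_trunc_le: "L \<ge> 0 \<Longrightarrow> norm (trunc L x) \<le> L"
  by (simp add: trunc_def)

lemma trunc_0 [simp]: "trunc L 0 = 0"
  by (simp add: trunc_def)

text \<open>
  Chernoff's inequality in each of the \<open>2 DIM('a)\<close> coordinate directions; one coordinate of a vector
  of norm at least \<open>a\<close> has absolute value at least \<open>a / DIM('a)\<close>.
\<close>

lemma indicator_norm_le_sum_exp:
  fixes x :: "'a::euclidean_space"
  assumes "s \<ge> 0"
  shows "indicator {x. a \<le> norm x} x \<le>
    (\<Sum>b\<in>Basis. exp ((s *\<^sub>R b) \<bullet> x - s * a / DIM('a)) + exp (((- s) *\<^sub>R b) \<bullet> x - s * a / DIM('a)))"
proof (cases "a \<le> norm x")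
  case True
  have "\<exists>b\<in>Basis. a / DIM('a) \<le> \<bar>x \<bullet> b\<bar>"
  proof (rule ccontr)
    assume "\<not> ?thesis"
    then have "(\<Sum>b\<in>(Basis::'a set). \<bar>x \<bullet> b\<bar>) < (\<Sum>b\<in>(Basis::'a set). a / DIM('a))"
      by (intro sum_strict_mono) auto
    then show False using True norm_le_l1[of x] by simp
  qed
  then obtain b where b: "b \<in> Basis" "a / DIM('a) \<le> \<bar>x \<bullet> b\<bar>" by blast
  then have "s * (a / DIM('a)) \<le> s * \<bar>x \<bullet> b\<bar>" using assms by (intro mult_left_mono)
  then have "1 \<le> exp (s * \<bar>x \<bullet> b\<bar> - s * a / DIM('a))" by simp
  also have "\<dots> \<le> exp ((s *\<^sub>R b) \<bullet> x - s * a / DIM('a)) + exp (((- s) *\<^sub>R b) \<bullet> x - s * a / DIM('a))"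
    by (cases "x \<bullet> b \<ge> 0") (auto simp: inner_commute add_increasing add_increasing2)
  also have "\<dots> \<le> (\<Sum>b\<in>Basis. exp ((s *\<^sub>R b) \<bullet> x - s * a / DIM('a)) + exp (((- s) *\<^sub>R b) \<bullet> x - s * a / DIM('a)))"
    using b(1) by (intro member_le_sum) auto
  finally show ?thesis using True by simp
qed (simp add: sum_nonneg)

context jump_intensity begin

definition trunc_walk :: "'a \<Rightarrow> real \<Rightarrow> (nat \<Rightarrow> 'a) \<Rightarrow> 'a" where
  "trunc_walk c L \<omega> = c + (\<Sum>j<N. trunc L (\<omega> j))"

lemma trunc_walk_measurable [measurable]: "trunc_walk c L \<in> measurable steps borel"
  unfolding trunc_walk_def
  by (intro borel_measurable_add borel_measurable_const borel_measurable_sum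
      measurable_compose[OF steps_component trunc_measurable]) simp

text \<open>
  The logarithm of the moment generating function of the compound Poisson law with intensity \<open>K\<close> and
  truncated jumps; it bounds that of the truncated walk.
\<close>

definition log_mgf :: "real \<Rightarrow> 'a \<Rightarrow> real" where
  "log_mgf L e = (\<integral>x. exp (e \<bullet> trunc L x) - 1 \<partial>K)"

lemma exp_trunc_bounds:
  assumes "L \<ge> 0"
  shows "exp (e \<bullet> trunc L x) \<le> exp (norm e * L)"
proof -
  have "e \<bullet> trunc L x \<le> norm e * norm (trunc L x)" by (rule norm_cauchy_schwarz)
  also have "\<dots> \<le> norm e * L" using assms by (intro mult_left_mono norm_trunc_le) auto
  finally show ?thesis by simp
qed

lemma integrable_exp_trunc:
  assumes "L \<ge> 0"
  shows "integrable K (\<lambda>x. exp (e \<bullet> trunc L x))"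
proof -
  note [measurable_cong] = sets_K
  show ?thesis using exp_trunc_bounds[OF assms]
    by (intro integrable_const_bound[where B="exp (norm e * L)"]) auto
qed

lemma log_mgf_ge:
  assumes "L \<ge> 0"
  shows "- measure K UNIV \<le> log_mgf L e"
proof -
  have "(\<integral>x. - 1 \<partial>K) \<le> log_mgf L e"
    unfolding log_mgf_def
    by (intro integral_mono Bochner_Integration.integrable_diff integrable_exp_trunc assms) auto
  then show ?thesis by simp
qed

lemma step_mgf_ge:
  assumes "L \<ge> 0"
  shows "1 / 2 \<le> 1 + log_mgf L e / real N"
  using log_mgf_ge[OF assms, of e] mass_le N_pos by (simp add: field_simps)

lemma step_mgf_nonneg:
  assumes "L \<ge> 0"
  shows "0 \<le> 1 + log_mgf L e / real N"
  using order_trans[OF _ step_mgf_ge[OF assms, of e], of 0] by linarith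

lemma nn_integral_exp_trunc:
  assumes "L \<ge> 0"
  shows "(\<integral>\<^sup>+x. ennreal (exp (e \<bullet> trunc L x)) \<partial>jump_law K N) = ennreal (1 + log_mgf L e / real N)"
proof -
  note [measurable_cong] = sets_K
  have "(\<integral>\<^sup>+x. ennreal (exp (e \<bullet> trunc L x)) \<partial>K) = ennreal (\<integral>x. exp (e \<bullet> trunc L x) \<partial>K)"
    by (intro nn_integral_eq_integral integrable_exp_trunc assms) auto
  also have "(\<integral>x. exp (e \<bullet> trunc L x) \<partial>K) = log_mgf L e + measure K UNIV"
    unfolding log_mgf_def
    by (subst Bochner_Integration.integral_diff) (auto intro: integrable_exp_trunc assms)
  finally have "(\<integral>\<^sup>+x. ennreal (exp (e \<bullet> trunc L x)) \<partial>jump_law K N) =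
     ennreal (1 - measure K UNIV / real N) + ennreal (log_mgf L e + measure K UNIV) / ennreal (real N)"
    by (subst nn_integral_jump_law) auto
  also have "\<dots> = ennreal (1 - measure K UNIV / real N + (log_mgf L e + measure K UNIV) / real N)"
    using log_mgf_ge[OF assms, of e] jump_probability_bounds N_pos by (subst divide_ennreal) (auto simp: ennreal_plus[symmetric] simp del: ennreal_plus)
  finally show ?thesis by (simp add: add_divide_distrib)
qed

lemma step_mgf_power_le:
  assumes "L \<ge> 0"
  shows "(1 + log_mgf L e / real N) ^ N \<le> exp (log_mgf L e)"
proof -
  have "(1 + log_mgf L e / real N) ^ N \<le> exp (log_mgf L e / real N) ^ N"
    using step_mgf_nonneg[OF assms, of e] by (intro power_mono exp_ge_add_one_self)
  also have "\<dots> = exp (log_mgf L e)" using N_pos by (simp add: exp_of_nat_mult[symmetric])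
  finally show ?thesis .
qed

lemma exp_trunc_walk: "ennreal (exp (e \<bullet> trunc_walk c L \<omega>)) =
    ennreal (exp (e \<bullet> c)) * (\<Prod>i<N. ennreal (exp (e \<bullet> trunc L (\<omega> i))))"
  by (simp add: trunc_walk_def inner_add_right inner_sum_right exp_add exp_sum prod_ennreal ennreal_mult prod_nonneg)

lemma trunc_walk_mgf:
  assumes L: "L \<ge> 0"
  shows "(\<integral>\<^sup>+\<omega>. ennreal (exp (e \<bullet> trunc_walk c L \<omega>)) \<partial>steps) \<le> ennreal (exp (e \<bullet> c + log_mgf L e))"
proof -
  have [measurable]: "(\<lambda>\<omega>. \<Prod>i<N. ennreal (exp (e \<bullet> trunc L (\<omega> i)))) \<in> borel_measurable steps"
    by (intro borel_measurable_prod_ennreal measurable_compose[OF steps_component]) auto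
  have "(\<integral>\<^sup>+\<omega>. ennreal (exp (e \<bullet> trunc_walk c L \<omega>)) \<partial>steps) =
      ennreal (exp (e \<bullet> c)) * (\<integral>\<^sup>+\<omega>. (\<Prod>i<N. ennreal (exp (e \<bullet> trunc L (\<omega> i)))) \<partial>steps)"
    unfolding exp_trunc_walk by (rule nn_integral_cmult) measurable
  also have "\<dots> = ennreal (exp (e \<bullet> c)) * ennreal (1 + log_mgf L e / real N) ^ N"
    by (subst nn_integral_steps_prod) (auto simp: nn_integral_exp_trunc[OF L])
  also have "\<dots> = ennreal (exp (e \<bullet> c) * (1 + log_mgf L e / real N) ^ N)"
    using step_mgf_nonneg[OF L, of e] by (simp add: ennreal_power ennreal_mult)
  also have "\<dots> \<le> ennreal (exp (e \<bullet> c + log_mgf L e))"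
    unfolding exp_add by (intro ennreal_leI mult_left_mono step_mgf_power_le L) auto
  finally show ?thesis .
qed

text \<open>
  If the \<open>j\<close>-th step lies in a set of big jumps, then it does not contribute to the truncated walk, so
  the product formula factors. This expresses the independence of the jump and the sum of the other steps.
\<close>

lemma trunc_walk_mgf_on_jump:
  assumes L: "L \<ge> 0" and j: "j < N" and B[measurable]: "B \<in> sets borel" and BL: "\<And>x. x \<in> B \<Longrightarrow> norm x > L"
  shows "(\<integral>\<^sup>+\<omega>. indicator B (\<omega> j) * ennreal (exp (e \<bullet> trunc_walk c L \<omega>)) \<partial>steps) \<le>
      ennreal (2 * exp (e \<bullet> c + log_mgf L e)) * (emeasure K B / ennreal (real N))"
proof -
  note [measurable_cong] = sets_K
  let ?m = "1 + log_mgf L e / real N"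
  \<comment> \<open>On \<open>B\<close> the truncation vanishes, so the \<open>j\<close>-th factor is just the indicator of \<open>B\<close>.\<close>
  define f where "f i x = (if i = j then indicator B x else 1) * ennreal (exp (e \<bullet> trunc L x))" for i and x :: 'a
  have f[measurable]: "f i \<in> borel_measurable borel" for i unfolding f_def by measurable
  have [measurable]: "(\<lambda>\<omega>. \<Prod>i<N. f i (\<omega> i)) \<in> borel_measurable steps"
    by (intro borel_measurable_prod_ennreal measurable_compose[OF steps_component f]) auto
  have prod: "(\<Prod>i<N. f i (\<omega> i)) = indicator B (\<omega> j) * (\<Prod>i<N. ennreal (exp (e \<bullet> trunc L (\<omega> i))))" for \<omega>
    using j by (simp add: f_def prod.distrib prod.delta)
  have "(\<integral>\<^sup>+\<omega>. indicator B (\<omega> j) * ennreal (exp (e \<bullet> trunc_walk c L \<omega>)) \<partial>steps) =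
      (\<integral>\<^sup>+\<omega>. ennreal (exp (e \<bullet> c)) * (\<Prod>i<N. f i (\<omega> i)) \<partial>steps)"
    unfolding exp_trunc_walk prod by (simp add: mult_ac)
  also have "\<dots> = ennreal (exp (e \<bullet> c)) * (\<integral>\<^sup>+\<omega>. (\<Prod>i<N. f i (\<omega> i)) \<partial>steps)"
    by (rule nn_integral_cmult) measurable
  also have "(\<integral>\<^sup>+\<omega>. (\<Prod>i<N. f i (\<omega> i)) \<partial>steps) = (\<Prod>i<N. \<integral>\<^sup>+x. f i x \<partial>jump_law K N)"
    by (rule nn_integral_steps_prod) measurable
  also have "\<dots> = (\<integral>\<^sup>+x. f j x \<partial>jump_law K N) * (\<Prod>i\<in>{..<N} - {j}. \<integral>\<^sup>+x. f i x \<partial>jump_law K N)"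
    using j by (intro prod.remove) auto
  also have "(\<integral>\<^sup>+x. f j x \<partial>jump_law K N) = emeasure K B / ennreal (real N)"
  proof -
    have "f j x = indicator B x" for x using BL[of x] by (auto simp: f_def trunc_def split: split_indicator)
    moreover have "0 \<notin> B" using BL[of 0] L by auto
    ultimately show ?thesis using nn_integral_jump_law[of "indicator B"]
      by (simp del: nn_integral_indicator add: sets_K nn_integral_indicator[of B K])
  qed
  also have "(\<Prod>i\<in>{..<N} - {j}. \<integral>\<^sup>+x. f i x \<partial>jump_law K N) = ennreal (?m ^ (N - 1))"
  proof -
    have "(\<Prod>i\<in>{..<N} - {j}. \<integral>\<^sup>+x. f i x \<partial>jump_law K N) = (\<Prod>i\<in>{..<N} - {j}. ennreal ?m)"
      by (intro prod.cong refl) (simp add: f_def nn_integral_exp_trunc[OF L])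
    then show ?thesis using j step_mgf_ge[OF L, of e] by (simp add: ennreal_power step_mgf_nonneg[OF L])
  qed
  also have "ennreal (exp (e \<bullet> c)) * (emeasure K B / ennreal (real N) * ennreal (?m ^ (N - 1))) =
      ennreal (exp (e \<bullet> c) * ?m ^ (N - 1)) * (emeasure K B / ennreal (real N))"
    using step_mgf_ge[OF L, of e] by (subst ennreal_mult) (auto simp: mult_ac)
  also have "\<dots> \<le> ennreal (2 * exp (e \<bullet> c + log_mgf L e)) * (emeasure K B / ennreal (real N))"
  proof (intro mult_right_mono ennreal_leI)
    have "?m ^ (N - 1) \<le> ?m ^ (N - 1) * (2 * ?m)"
      using step_mgf_ge[OF L, of e] step_mgf_nonneg[OF L, of e] mult_left_mono[of 1 "2 * ?m" "?m ^ (N - 1)"]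
      by (simp add: field_simps)
    also have "\<dots> = 2 * ?m ^ N" using N_pos by (cases N) auto
    also have "\<dots> \<le> 2 * exp (log_mgf L e)" using step_mgf_power_le[OF L, of e] by simp
    finally show "exp (e \<bullet> c) * ?m ^ (N - 1) \<le> 2 * exp (e \<bullet> c + log_mgf L e)"
      by (simp add: exp_add)
  qed simp
  finally show ?thesis .
qed

end

section \<open>One big jump for random walks\<close>

text \<open>
  The Chernoff bound for the norm of a random vector to reach \<open>a\<close>, when \<open>\<Theta>\<close> bounds the logarithmic
  moment generating function at all vectors of norm at most \<open>s\<close>.
\<close>

definition chernoff :: "'a::euclidean_space itself \<Rightarrow> real \<Rightarrow> real \<Rightarrow> real \<Rightarrow> real" where
  "chernoff _ \<Theta> s a = 2 * real DIM('a) * exp (\<Theta> - s * a / real DIM('a))"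

context jump_intensity begin

lemma weighted_trunc_walk_tail:
  assumes s: "s \<ge> 0" and g[measurable]: "g \<in> borel_measurable steps"
    and V: "\<And>b. b \<in> Basis \<Longrightarrow> (\<integral>\<^sup>+\<omega>. g \<omega> * ennreal (exp ((s *\<^sub>R b) \<bullet> trunc_walk c L \<omega>)) \<partial>steps) \<le> V"
      "\<And>b. b \<in> Basis \<Longrightarrow> (\<integral>\<^sup>+\<omega>. g \<omega> * ennreal (exp (((- s) *\<^sub>R b) \<bullet> trunc_walk c L \<omega>)) \<partial>steps) \<le> V"
  shows "(\<integral>\<^sup>+\<omega>. g \<omega> * indicator {x. a \<le> norm x} (trunc_walk c L \<omega>) \<partial>steps) \<le>
     ennreal (2 * real DIM('a) * exp (- (s * a / real DIM('a)))) * V"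
proof -
  let ?r = "ennreal (exp (- (s * a / real DIM('a))))"
  let ?h = "\<lambda>\<sigma> b \<omega>. g \<omega> * ennreal (exp ((\<sigma> *\<^sub>R b) \<bullet> trunc_walk c L \<omega>))"
  have "(\<integral>\<^sup>+\<omega>. g \<omega> * indicator {x. a \<le> norm x} (trunc_walk c L \<omega>) \<partial>steps) \<le>
    (\<integral>\<^sup>+\<omega>. (\<Sum>b\<in>(Basis::'a set). (?h s b \<omega> + ?h (- s) b \<omega>) * ?r) \<partial>steps)"
  proof (intro nn_integral_mono)
    fix \<omega>
    let ?x = "trunc_walk c L \<omega>"
    have "ennreal (indicator {x. a \<le> norm x} ?x) \<le> ennreal (\<Sum>b\<in>Basis. exp ((s *\<^sub>R b) \<bullet> ?x - s * a / DIM('a)) + exp (((- s) *\<^sub>R b) \<bullet> ?x - s * a / DIM('a)))"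
      by (intro ennreal_leI indicator_norm_le_sum_exp s)
    also have "\<dots> = (\<Sum>b\<in>(Basis::'a set). (ennreal (exp ((s *\<^sub>R b) \<bullet> ?x)) + ennreal (exp (((- s) *\<^sub>R b) \<bullet> ?x))) * ?r)"
      by (subst sum_ennreal[symmetric]) (auto simp: exp_diff exp_minus divide_inverse ennreal_mult distrib_right intro!: sum.cong)
    finally have "g \<omega> * indicator {x. a \<le> norm x} ?x \<le> g \<omega> * (\<Sum>b\<in>(Basis::'a set). (ennreal (exp ((s *\<^sub>R b) \<bullet> ?x)) + ennreal (exp (((- s) *\<^sub>R b) \<bullet> ?x))) * ?r)"
      by (intro mult_left_mono) (auto simp: ennreal_indicator)
    also have "\<dots> = (\<Sum>b\<in>(Basis::'a set). (?h s b \<omega> + ?h (- s) b \<omega>) * ?r)"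
      by (simp only: sum_distrib_left distrib_left distrib_right mult.assoc)
    finally show "g \<omega> * indicator {x. a \<le> norm x} ?x \<le> (\<Sum>b\<in>(Basis::'a set). (?h s b \<omega> + ?h (- s) b \<omega>) * ?r)" .
  qed
  also have "\<dots> = (\<Sum>b\<in>(Basis::'a set). ((\<integral>\<^sup>+\<omega>. ?h s b \<omega> \<partial>steps) + (\<integral>\<^sup>+\<omega>. ?h (- s) b \<omega> \<partial>steps)) * ?r)"
    by (subst nn_integral_sum) (auto simp: nn_integral_multc nn_integral_add)
  also have "\<dots> \<le> (\<Sum>b\<in>(Basis::'a set). (V + V) * ?r)"
    by (intro sum_mono mult_right_mono add_mono V) auto
  also have "\<dots> = ennreal (2 * real DIM('a) * exp (- (s * a / real DIM('a)))) * V"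
    by (simp add: ennreal_mult mult_2[symmetric] ennreal_of_nat_eq_real_of_nat mult_ac)
  finally show ?thesis .
qed

definition mgf_bound :: "'a \<Rightarrow> real \<Rightarrow> real \<Rightarrow> real \<Rightarrow> bool" where
  "mgf_bound c L s \<Theta> \<longleftrightarrow> (\<forall>e. norm e \<le> s \<longrightarrow> e \<bullet> c + log_mgf L e \<le> \<Theta>)"

lemma trunc_walk_tail:
  assumes L: "L \<ge> 0" and s: "s \<ge> 0" and m: "mgf_bound c L s \<Theta>"
  shows "(\<integral>\<^sup>+\<omega>. indicator {x. a \<le> norm x} (trunc_walk c L \<omega>) \<partial>steps) \<le> ennreal (chernoff TYPE('a) \<Theta> s a)"
proof -
  have "(\<integral>\<^sup>+\<omega>. 1 * indicator {x. a \<le> norm x} (trunc_walk c L \<omega>) \<partial>steps) \<le>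
     ennreal (2 * real DIM('a) * exp (- (s * a / real DIM('a)))) * ennreal (exp \<Theta>)"
  proof (rule weighted_trunc_walk_tail[OF s])
    fix b :: 'a assume b: "b \<in> Basis"
    show "(\<integral>\<^sup>+\<omega>. 1 * ennreal (exp ((s *\<^sub>R b) \<bullet> trunc_walk c L \<omega>)) \<partial>steps) \<le> ennreal (exp \<Theta>)"
      using order_trans[OF trunc_walk_mgf[OF L, of "s *\<^sub>R b" c] ennreal_leI, of "exp \<Theta>"] m[unfolded mgf_bound_def, rule_format, of "s *\<^sub>R b"] b s by simp
    show "(\<integral>\<^sup>+\<omega>. 1 * ennreal (exp (((- s) *\<^sub>R b) \<bullet> trunc_walk c L \<omega>)) \<partial>steps) \<le> ennreal (exp \<Theta>)"
      using order_trans[OF trunc_walk_mgf[OF L, of "(- s) *\<^sub>R b" c] ennreal_leI, of "exp \<Theta>"] m[unfolded mgf_bound_def, rule_format, of "(- s) *\<^sub>R b"] b s by simp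
  qed simp
  then show ?thesis by (simp add: chernoff_def ennreal_mult exp_diff exp_minus divide_inverse mult_ac)
qed

lemma trunc_walk_tail_on_jump:
  assumes L: "L \<ge> 0" and s: "s \<ge> 0" and m: "mgf_bound c L s \<Theta>" and j: "j < N"
    and B[measurable]: "B \<in> sets borel" and BL: "\<And>x. x \<in> B \<Longrightarrow> norm x > L"
  shows "(\<integral>\<^sup>+\<omega>. indicator B (\<omega> j) * indicator {x. a \<le> norm x} (trunc_walk c L \<omega>) \<partial>steps) \<le>
     ennreal (2 * chernoff TYPE('a) \<Theta> s a) * (emeasure K B / ennreal (real N))"
proof -
  let ?V = "ennreal (2 * exp \<Theta>) * (emeasure K B / ennreal (real N))"
  have *: "(\<integral>\<^sup>+\<omega>. indicator B (\<omega> j) * ennreal (exp (e \<bullet> trunc_walk c L \<omega>)) \<partial>steps) \<le> ?V" if "norm e \<le> s" for e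
  proof -
    have "exp (e \<bullet> c + log_mgf L e) \<le> exp \<Theta>" using m that by (simp add: mgf_bound_def)
    then have "ennreal (2 * exp (e \<bullet> c + log_mgf L e)) * (emeasure K B / ennreal (real N)) \<le> ?V"
      by (intro mult_right_mono ennreal_leI) auto
    with trunc_walk_mgf_on_jump[OF L j B BL, of e c] show ?thesis by (rule order_trans)
  qed
  have "(\<integral>\<^sup>+\<omega>. indicator B (\<omega> j) * indicator {x. a \<le> norm x} (trunc_walk c L \<omega>) \<partial>steps) \<le>
     ennreal (2 * real DIM('a) * exp (- (s * a / real DIM('a)))) * ?V"
    using s by (intro weighted_trunc_walk_tail * measurable_compose[OF steps_component[OF j]]) auto
  also have "\<dots> = ennreal (2 * chernoff TYPE('a) \<Theta> s a) * (emeasure K B / ennreal (real N))"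
  proof -
    have "ennreal (2 * chernoff TYPE('a) \<Theta> s a) = ennreal (2 * real DIM('a) * exp (- (s * a / real DIM('a)))) * ennreal (2 * exp \<Theta>)"
      by (subst ennreal_mult[symmetric]) (auto simp: chernoff_def exp_diff exp_minus divide_inverse mult_ac)
    then show ?thesis by (simp add: mult.assoc)
  qed
  finally show ?thesis .
qed

lemma steps_component_prob:
  assumes j: "j < N" and B[measurable]: "B \<in> sets borel" and B0: "0 \<notin> B"
  shows "(\<integral>\<^sup>+\<omega>. indicator B (\<omega> j) \<partial>steps) = emeasure K B / ennreal (real N)"
proof -
  interpret J: prob_space "jump_law K N" by (rule prob_space_jump_law)
  note [measurable_cong] = sets_K
  have "(\<integral>\<^sup>+\<omega>. indicator B (\<omega> j) \<partial>steps) = (\<integral>\<^sup>+\<omega>. (\<Prod>i<N. if i = j then indicator B (\<omega> i) else 1) \<partial>steps)"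
    using j by (simp add: prod.delta)
  also have "\<dots> = (\<Prod>i<N. \<integral>\<^sup>+x. (if i = j then indicator B x else 1) \<partial>jump_law K N)"
    by (rule nn_integral_steps_prod[where f="\<lambda>i x. if i = j then indicator B x else 1"]) simp
  also have "\<dots> = (\<Prod>i<N. if i = j then emeasure K B / ennreal (real N) else 1)"
    using nn_integral_jump_law[of "indicator B"] B0
    by (intro prod.cong refl) (simp add: J.emeasure_space_1 sets_K)
  finally show ?thesis using j by (simp add: prod.delta)
qed

lemma steps_pair_prob:
  assumes j: "j < N" "k < N" "j \<noteq> k" and B[measurable]: "B \<in> sets borel" and B0: "0 \<notin> B"
  shows "(\<integral>\<^sup>+\<omega>. indicator B (\<omega> j) * indicator B (\<omega> k) \<partial>steps) = (emeasure K B / ennreal (real N))\<^sup>2"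
proof -
  interpret J: prob_space "jump_law K N" by (rule prob_space_jump_law)
  have *: "(\<Prod>i<N. if i = j \<or> i = k then f i else 1) = f j * f k" for f :: "nat \<Rightarrow> ennreal"
  proof -
    have "(\<Prod>i<N. if i = j \<or> i = k then f i else 1) = (\<Prod>i\<in>{j, k}. f i)"
      using j by (intro prod.mono_neutral_cong_right) auto
    then show ?thesis using j by simp
  qed
  have "(\<integral>\<^sup>+\<omega>. indicator B (\<omega> j) * indicator B (\<omega> k) \<partial>steps) = (\<integral>\<^sup>+\<omega>. (\<Prod>i<N. if i = j \<or> i = k then indicator B (\<omega> i) else 1) \<partial>steps)"
    by (simp add: *)
  also have "\<dots> = (\<Prod>i<N. \<integral>\<^sup>+x. (if i = j \<or> i = k then indicator B x else 1) \<partial>jump_law K N)"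
    by (rule nn_integral_steps_prod[where f="\<lambda>i x. if i = j \<or> i = k then indicator B x else 1"]) simp
  also have "\<dots> = (\<Prod>i<N. if i = j \<or> i = k then emeasure K B / ennreal (real N) else 1)"
    using nn_integral_jump_law[of "indicator B"] B0
    by (intro prod.cong refl) (simp add: J.emeasure_space_1 sets_K)
  finally show ?thesis by (simp add: * power2_eq_square)
qed

text \<open>
  The number of ordered pairs of distinct big steps. Unlike the indicator of there being such a pair,
  it also dominates the number of big steps whenever there are at least two.
\<close>

definition two_big :: "real \<Rightarrow> (nat \<Rightarrow> 'a) \<Rightarrow> ennreal" where
  "two_big L \<omega> = (\<Sum>j<N. \<Sum>k\<in>{..<N} - {j}. indicator {x. norm x > L} (\<omega> j) * indicator {x. norm x > L} (\<omega> k))"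

lemma two_big_measurable [measurable]: "two_big L \<in> borel_measurable steps"
  unfolding two_big_def
  by (intro borel_measurable_sum borel_measurable_times_ennreal measurable_compose[OF steps_component]) auto

lemma two_big_expectation:
  assumes L: "L \<ge> 0"
  shows "(\<integral>\<^sup>+\<omega>. two_big L \<omega> \<partial>steps) \<le> (emeasure K {x. norm x > L})\<^sup>2"
proof -
  have G[measurable]: "{x::'a. norm x > L} \<in> sets borel" by measurable
  have m: "j < N \<Longrightarrow> k < N \<Longrightarrow> (\<lambda>\<omega>. indicator {x. norm x > L} (\<omega> j) * indicator {x. norm x > L} (\<omega> k) :: ennreal) \<in> borel_measurable steps" for j k
    by (intro borel_measurable_times_ennreal measurable_compose[OF steps_component]) auto
  let ?q = "(emeasure K {x. norm x > L} / ennreal (real N))\<^sup>2"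
  have "(\<integral>\<^sup>+\<omega>. two_big L \<omega> \<partial>steps) =
      (\<Sum>j<N. \<integral>\<^sup>+\<omega>. (\<Sum>k\<in>{..<N} - {j}. indicator {x. norm x > L} (\<omega> j) * indicator {x. norm x > L} (\<omega> k)) \<partial>steps)"
    unfolding two_big_def by (intro nn_integral_sum borel_measurable_sum m) auto
  also have "\<dots> = (\<Sum>j<N. \<Sum>k\<in>{..<N} - {j}. \<integral>\<^sup>+\<omega>. indicator {x. norm x > L} (\<omega> j) * indicator {x. norm x > L} (\<omega> k) \<partial>steps)"
    by (intro sum.cong refl nn_integral_sum m) auto
  also have "\<dots> = (\<Sum>j<N. \<Sum>k\<in>{..<N} - {j}. ?q)"
    using L by (intro sum.cong refl steps_pair_prob) auto
  also have "\<dots> \<le> (\<Sum>j<N. \<Sum>k<N. ?q)"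
    by (intro sum_mono sum_mono2) auto
  also have "\<dots> = (emeasure K {x. norm x > L} / ennreal (real N) * ennreal (real N))\<^sup>2"
    by (simp add: power_mult_distrib power2_eq_square mult_ac ennreal_of_nat_eq_real_of_nat)
  also have "emeasure K {x. norm x > L} / ennreal (real N) * ennreal (real N) = emeasure K {x. norm x > L}"
    by (rule divide_N_times_N)
  finally show ?thesis .
qed

lemma walk_eq_trunc_walk:
  assumes "\<And>j. j < N \<Longrightarrow> norm (\<omega> j) \<le> L"
  shows "walk c \<omega> = trunc_walk c L \<omega>"
  using assms by (simp add: walk_def trunc_walk_def trunc_def)

lemma walk_eq_big_jump:
  assumes "j < N" "norm (\<omega> j) > L" "\<And>k. k < N \<Longrightarrow> k \<noteq> j \<Longrightarrow> norm (\<omega> k) \<le> L"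
  shows "walk c \<omega> = \<omega> j + trunc_walk c L \<omega>"
proof -
  have "(\<Sum>i<N. \<omega> i) = \<omega> j + (\<Sum>i\<in>{..<N} - {j}. \<omega> i)"
    using assms(1) by (intro sum.remove) auto
  moreover have "(\<Sum>i<N. trunc L (\<omega> i)) = trunc L (\<omega> j) + (\<Sum>i\<in>{..<N} - {j}. trunc L (\<omega> i))"
    using assms(1) by (intro sum.remove) auto
  moreover have "(\<Sum>i\<in>{..<N} - {j}. trunc L (\<omega> i)) = (\<Sum>i\<in>{..<N} - {j}. \<omega> i)"
    using assms by (intro sum.cong) (auto simp: trunc_def)
  ultimately show ?thesis using assms(2) by (simp add: walk_def trunc_walk_def trunc_def)
qed

lemma two_big_ge_1:
  assumes "j < N" "k < N" "j \<noteq> k" "norm (\<omega> j) > L" "norm (\<omega> k) > L"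
  shows "1 \<le> two_big L \<omega>"
proof -
  have "(1::ennreal) = indicator {x. norm x > L} (\<omega> j) * indicator {x. norm x > L} (\<omega> k)"
    using assms by simp
  also have "\<dots> \<le> (\<Sum>k\<in>{..<N} - {j}. indicator {x. norm x > L} (\<omega> j) * indicator {x. norm x > L} (\<omega> k))"
    using assms by (intro member_le_sum[of k]) auto
  also have "\<dots> \<le> two_big L \<omega>"
    unfolding two_big_def using assms by (intro member_le_sum[of j]) auto
  finally show ?thesis .
qed

text \<open>
  If the walk is in \<open>B\<close>, then either the truncated walk is large, or there are two big steps, or there
  is exactly one, and the walk differs from it by the small truncated walk.
\<close>

lemma one_big_jump_upper:
  assumes B: "\<And>x. x \<in> B \<Longrightarrow> norm x \<ge> a"
  shows "indicator B (walk c \<omega>) \<le> (\<Sum>j<N. indicator (thickening a B \<inter> {x. norm x > L}) (\<omega> j)) +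
     indicator {x. a \<le> norm x} (trunc_walk c L \<omega>) + two_big L \<omega>"
proof (cases "walk c \<omega> \<in> B \<and> norm (trunc_walk c L \<omega>) < a")
  case False
  then show ?thesis by (auto simp: not_less add_increasing add_increasing2 split: split_indicator)
next
  case True
  obtain j where j: "j < N" "norm (\<omega> j) > L"
  proof (rule ccontr)
    assume "\<not> thesis"
    then have "walk c \<omega> = trunc_walk c L \<omega>"
      using that not_less by (intro walk_eq_trunc_walk) blast
    then show False using True B[of "walk c \<omega>"] by auto
  qed
  show ?thesis
  proof (cases "\<exists>k<N. k \<noteq> j \<and> norm (\<omega> k) > L")
    case two: True
    then obtain k where "k < N" "k \<noteq> j" "norm (\<omega> k) > L" by blast
    then have "1 \<le> two_big L \<omega>" using j by (intro two_big_ge_1[of j k]) auto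
    then show ?thesis using True by (simp add: add_increasing)
  next
    case False
    then have "walk c \<omega> = \<omega> j + trunc_walk c L \<omega>"
      using j not_less by (intro walk_eq_big_jump) blast+
    then have "\<omega> j \<in> thickening a B"
      using True unfolding thickening_def by (auto intro!: bexI[of _ "walk c \<omega>"] simp: dist_norm)
    then have "(1::ennreal) = indicator (thickening a B \<inter> {x. norm x > L}) (\<omega> j)"
      using j by simp
    also have "\<dots> \<le> (\<Sum>j<N. indicator (thickening a B \<inter> {x. norm x > L}) (\<omega> j))"
      using j by (intro member_le_sum) auto
    finally show ?thesis using True by (simp add: add_increasing2)
  qed
qed

text \<open>
  Conversely, a single big step in \<open>B\<close> together with a small truncated walk puts the walk into the
  thickening of \<open>B\<close>. The sum on the left counts the steps in \<open>B\<close>; it exceeds \<open>1\<close> only if \<open>two_big\<close> pays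
  for it.
\<close>

lemma one_big_jump_lower:
  assumes B: "\<And>x. x \<in> B \<Longrightarrow> norm x > L"
  shows "(\<Sum>j<N. indicator B (\<omega> j)) \<le> indicator (thickening a B) (walk c \<omega>) +
     (\<Sum>j<N. indicator B (\<omega> j) * indicator {x. a \<le> norm x} (trunc_walk c L \<omega>)) + two_big L \<omega>"
proof (cases "\<exists>j k. j < N \<and> k < N \<and> j \<noteq> k \<and> norm (\<omega> j) > L \<and> norm (\<omega> k) > L")
  case True
  have "(\<Sum>j<N. indicator B (\<omega> j)) \<le> two_big L \<omega>"
    unfolding two_big_def
  proof (intro sum_mono)
    fix j assume j: "j \<in> {..<N}"
    show "indicator B (\<omega> j) \<le> (\<Sum>k\<in>{..<N} - {j}. indicator {x. norm x > L} (\<omega> j) * indicator {x. norm x > L} (\<omega> k) :: ennreal)"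
    proof (cases "\<omega> j \<in> B")
      case inB: True
      obtain k where k: "k < N" "k \<noteq> j" "norm (\<omega> k) > L" 
      proof -
        obtain j1 k1 where jk: "j1 < N" "k1 < N" "j1 \<noteq> k1" "norm (\<omega> j1) > L" "norm (\<omega> k1) > L"
          using True by blast
        then show ?thesis using that[of j1] that[of k1] by (cases "j = j1") auto
      qed
      have "(1::ennreal) = indicator {x. norm x > L} (\<omega> j) * indicator {x. norm x > L} (\<omega> k)"
        using inB B k by simp
      also have "\<dots> \<le> (\<Sum>k\<in>{..<N} - {j}. indicator {x. norm x > L} (\<omega> j) * indicator {x. norm x > L} (\<omega> k))"
        using k by (intro member_le_sum[of k]) auto
      finally show ?thesis using inB by simp
    qed simp
  qed
  then show ?thesis by (simp add: add_increasing)
next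
  case False
  show ?thesis
  proof (cases "\<exists>j<N. \<omega> j \<in> B")
    case True
    then obtain j where j: "j < N" "\<omega> j \<in> B" by blast
    then have L: "norm (\<omega> j) > L" using B by simp
    have *: "norm (\<omega> k) \<le> L" if "k < N" "k \<noteq> j" for k
      using False j L that not_less by blast
    have notB: "\<omega> k \<notin> B" if "k < N" "k \<noteq> j" for k using *[OF that] B[of "\<omega> k"] by auto
    have sum1: "(\<Sum>i<N. indicator B (\<omega> i) * y) = y" for y :: ennreal
    proof -
      have "(\<Sum>i<N. indicator B (\<omega> i) * y) = (\<Sum>i\<in>{j}. indicator B (\<omega> i) * y)"
        using j notB by (intro sum.mono_neutral_right) auto
      then show ?thesis using j by simp
    qed
    have w: "walk c \<omega> = \<omega> j + trunc_walk c L \<omega>"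
      using j L * by (intro walk_eq_big_jump) auto
    have "(1::ennreal) \<le> indicator (thickening a B) (walk c \<omega>) + indicator {x. a \<le> norm x} (trunc_walk c L \<omega>)"
    proof (cases "a \<le> norm (trunc_walk c L \<omega>)")
      case False
      then have "walk c \<omega> \<in> thickening a B"
        using j unfolding thickening_def w by (auto intro!: bexI[of _ "\<omega> j"] simp: dist_norm)
      then show ?thesis by (simp add: add_increasing2)
    qed (simp add: add_increasing)
    moreover have "(\<Sum>i<N. indicator B (\<omega> i)) = (1::ennreal)" using sum1[of 1] by simp
    ultimately show ?thesis unfolding sum1 by (simp add: add_increasing2)
  next
    case False
    then have "(\<Sum>j<N. indicator B (\<omega> j)) = (0::ennreal)" by (intro sum.neutral) auto
    then show ?thesis by simp
  qed
qed

lemma sum_component_prob: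
  assumes B[measurable]: "B \<in> sets borel" and B0: "0 \<notin> B"
  shows "(\<integral>\<^sup>+\<omega>. (\<Sum>j<N. indicator B (\<omega> j)) \<partial>steps) = emeasure K B"
proof -
  have "(\<integral>\<^sup>+\<omega>. (\<Sum>j<N. indicator B (\<omega> j)) \<partial>steps) = (\<Sum>j<N. \<integral>\<^sup>+\<omega>. indicator B (\<omega> j) \<partial>steps)"
    by (intro nn_integral_sum measurable_compose[OF steps_component]) auto
  also have "\<dots> = (\<Sum>j<N. emeasure K B / ennreal (real N))"
    by (intro sum.cong refl steps_component_prob B B0) auto
  also have "\<dots> = emeasure K B"
    using divide_N_times_N[of "emeasure K B"] by (simp add: mult.commute ennreal_of_nat_eq_real_of_nat)
  finally show ?thesis .
qed

lemma emeasure_walk_law: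
  assumes "B \<in> sets borel"
  shows "emeasure (walk_law c) B = (\<integral>\<^sup>+\<omega>. indicator B (walk c \<omega>) \<partial>steps)"
proof -
  have "emeasure (walk_law c) B = (\<integral>\<^sup>+x. indicator B x \<partial>walk_law c)"
    using assms by simp
  also have "\<dots> = (\<integral>\<^sup>+\<omega>. indicator B (walk c \<omega>) \<partial>steps)"
    unfolding walk_law_def using assms by (intro nn_integral_distr walk_measurable) auto
  finally show ?thesis .
qed

text \<open>
  Take expectations in the pathwise bound; the expected number of steps in a set is its \<open>K\<close>-measure.
\<close>

lemma walk_law_upper:
  assumes L: "L \<ge> 0" and s: "s \<ge> 0" and m: "mgf_bound c L s \<Theta>"
    and B[measurable]: "B \<in> sets borel" and Ba: "\<And>x. x \<in> B \<Longrightarrow> norm x \<ge> a"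
  shows "emeasure (walk_law c) B \<le> emeasure K (thickening a B \<inter> {x. norm x > L}) +
     ennreal (chernoff TYPE('a) \<Theta> s a) + (emeasure K {x. norm x > L})\<^sup>2"
proof -
  have [measurable]: "(\<lambda>\<omega>. \<Sum>j<N. indicator (thickening a B \<inter> {x. norm x > L}) (\<omega> j) :: ennreal) \<in> borel_measurable steps"
    by (intro borel_measurable_sum measurable_compose[OF steps_component]) auto
  have "emeasure (walk_law c) B \<le> (\<integral>\<^sup>+\<omega>. (\<Sum>j<N. indicator (thickening a B \<inter> {x. norm x > L}) (\<omega> j)) +
     indicator {x. a \<le> norm x} (trunc_walk c L \<omega>) + two_big L \<omega> \<partial>steps)"
    unfolding emeasure_walk_law[OF B] by (intro nn_integral_mono one_big_jump_upper Ba)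
  also have "\<dots> = (\<integral>\<^sup>+\<omega>. (\<Sum>j<N. indicator (thickening a B \<inter> {x. norm x > L}) (\<omega> j)) \<partial>steps) +
     (\<integral>\<^sup>+\<omega>. indicator {x. a \<le> norm x} (trunc_walk c L \<omega>) \<partial>steps) + (\<integral>\<^sup>+\<omega>. two_big L \<omega> \<partial>steps)"
    by (simp add: nn_integral_add)
  also have "\<dots> \<le> emeasure K (thickening a B \<inter> {x. norm x > L}) +
     ennreal (chernoff TYPE('a) \<Theta> s a) + (emeasure K {x. norm x > L})\<^sup>2"
    using L by (intro add_mono trunc_walk_tail[OF L s m] two_big_expectation order_eq_refl[OF sum_component_prob]) auto
  finally show ?thesis .
qed

text \<open>
  The error from the truncated walk is proportional to \<open>K(B)\<close> here. This is essential when only the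
  walk is known to have a small tail, since the error can then be absorbed into the left-hand side.
\<close>

lemma walk_law_lower:
  assumes L: "L \<ge> 0" and s: "s \<ge> 0" and m: "mgf_bound c L s \<Theta>"
    and B[measurable]: "B \<in> sets borel" and BL: "\<And>x. x \<in> B \<Longrightarrow> norm x > L"
  shows "emeasure K B \<le> emeasure (walk_law c) (thickening a B) +
     ennreal (2 * chernoff TYPE('a) \<Theta> s a) * emeasure K B + (emeasure K {x. norm x > L})\<^sup>2"
proof -
  have B0: "0 \<notin> B" using BL[of 0] L by auto
  have m1: "(\<lambda>\<omega>. indicator B (\<omega> j) * indicator {x. a \<le> norm x} (trunc_walk c L \<omega>) :: ennreal) \<in> borel_measurable steps" if "j < N" for j
    using that by (intro borel_measurable_times_ennreal measurable_compose[OF steps_component]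
        measurable_compose[OF trunc_walk_measurable]) auto
  then have ms: "(\<lambda>\<omega>. \<Sum>j<N. indicator B (\<omega> j) * indicator {x. a \<le> norm x} (trunc_walk c L \<omega>) :: ennreal) \<in> borel_measurable steps"
    by (intro borel_measurable_sum) auto
  have mw: "(\<lambda>\<omega>. indicator (thickening a B) (walk c \<omega>) :: ennreal) \<in> borel_measurable steps"
    by (rule measurable_compose[OF walk_measurable]) auto
  have "emeasure K B \<le> (\<integral>\<^sup>+\<omega>. indicator (thickening a B) (walk c \<omega>) +
     (\<Sum>j<N. indicator B (\<omega> j) * indicator {x. a \<le> norm x} (trunc_walk c L \<omega>)) + two_big L \<omega> \<partial>steps)"
    unfolding sum_component_prob[OF B B0, symmetric] by (intro nn_integral_mono one_big_jump_lower BL)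
  also have "\<dots> = (\<integral>\<^sup>+\<omega>. indicator (thickening a B) (walk c \<omega>) \<partial>steps) +
     (\<integral>\<^sup>+\<omega>. (\<Sum>j<N. indicator B (\<omega> j) * indicator {x. a \<le> norm x} (trunc_walk c L \<omega>)) \<partial>steps) + (\<integral>\<^sup>+\<omega>. two_big L \<omega> \<partial>steps)"
    by (simp only: nn_integral_add[OF borel_measurable_add[OF mw ms] two_big_measurable] nn_integral_add[OF mw ms])
  also have "(\<integral>\<^sup>+\<omega>. (\<Sum>j<N. indicator B (\<omega> j) * indicator {x. a \<le> norm x} (trunc_walk c L \<omega>)) \<partial>steps) =
      (\<Sum>j<N. \<integral>\<^sup>+\<omega>. indicator B (\<omega> j) * indicator {x. a \<le> norm x} (trunc_walk c L \<omega>) \<partial>steps)"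
    using m1 by (intro nn_integral_sum) auto
  also have "(\<integral>\<^sup>+\<omega>. indicator (thickening a B) (walk c \<omega>) \<partial>steps) + \<dots> + (\<integral>\<^sup>+\<omega>. two_big L \<omega> \<partial>steps) \<le>
     emeasure (walk_law c) (thickening a B) + (\<Sum>j<N. ennreal (2 * chernoff TYPE('a) \<Theta> s a) * (emeasure K B / ennreal (real N))) + (emeasure K {x. norm x > L})\<^sup>2"
    using L by (intro add_mono sum_mono trunc_walk_tail_on_jump[OF L s m] two_big_expectation BL order_eq_refl[OF emeasure_walk_law[symmetric]]) auto
  also have "(\<Sum>j<N. ennreal (2 * chernoff TYPE('a) \<Theta> s a) * (emeasure K B / ennreal (real N))) = ennreal (2 * chernoff TYPE('a) \<Theta> s a) * (emeasure K B / ennreal (real N) * ennreal (real N))"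
    by (simp add: mult_ac ennreal_of_nat_eq_real_of_nat)
  also have "emeasure K B / ennreal (real N) * ennreal (real N) = emeasure K B"
    by (rule divide_N_times_N)
  finally show ?thesis .
qed

end

section \<open>One big jump for infinitely divisible laws\<close>

text \<open>
  The integrability criterion for Levy measures that is used throughout.
\<close>

lemma levy_integrable:
  fixes f :: "'a::euclidean_space \<Rightarrow> 'b::{banach, second_countable_topology}"
  assumes M: "levy_measure M" and f: "f \<in> borel_measurable borel"
    and bd: "\<And>x. norm (f x) \<le> C * min ((norm x)\<^sup>2) 1" and C: "C \<ge> 0"
  shows "integrable M f"
proof (rule integrableI_bounded)
  have [measurable_cong]: "sets M = sets borel" using M by (simp add: levy_measure_def)
  show "f \<in> borel_measurable M" using f by measurable
  have "(\<integral>\<^sup>+x. ennreal (norm (f x)) \<partial>M) \<le> (\<integral>\<^sup>+x. ennreal C * ennreal (min ((norm x)\<^sup>2) 1) \<partial>M)"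
    using C bd by (intro nn_integral_mono) (simp add: ennreal_mult[symmetric] ennreal_leI)
  also have "\<dots> = ennreal C * (\<integral>\<^sup>+x. ennreal (min ((norm x)\<^sup>2) 1) \<partial>M)"
    by (rule nn_integral_cmult) measurable
  also have "\<dots> < \<infinity>" using M by (simp add: levy_measure_def ennreal_mult_less_top)
  finally show "(\<integral>\<^sup>+x. ennreal (norm (f x)) \<partial>M) < \<infinity>" .
qed

lemma min_sq_ge_on_tail:
  assumes "r > 0" "norm x > r"
  shows "min (r\<^sup>2) 1 \<le> min ((norm x)\<^sup>2) 1"
  using assms power_mono[of r "norm x" 2] by (auto simp: min_le_iff_disj)

lemma levy_tail_finite:
  assumes M: "levy_measure (M :: 'a::euclidean_space measure)" and r: "r > 0"
  shows "emeasure M {x. norm x > r} < \<infinity>"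
proof -
  have s: "sets M = sets borel" using M by (simp add: levy_measure_def)
  have "integrable M (indicator {x::'a. norm x > r} :: 'a \<Rightarrow> real)"
  proof (rule levy_integrable[OF M, where C="1 / min (r\<^sup>2) 1"])
    show "norm (indicator {x. norm x > r} x :: real) \<le> 1 / min (r\<^sup>2) 1 * min ((norm x)\<^sup>2) 1" for x :: 'a
      using min_sq_ge_on_tail[OF r, of x] r by (auto simp: field_simps split: split_indicator)
  qed (use r in auto)
  moreover have "{x::'a. norm x > r} \<in> sets M" unfolding s by measurable
  ultimately show ?thesis by (subst (asm) integrable_indicator_iff) (auto simp: Int_absorb2 sets.sets_into_space)
qed

lemma exp_remainder_real: "exp u - 1 - u \<le> exp \<bar>u\<bar> * u\<^sup>2" for u :: real
proof -
  have "norm (exp (complex_of_real u) - (\<Sum>k\<le>1. (complex_of_real u) ^ k / fact k)) \<le>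
      exp \<bar>Re (complex_of_real u)\<bar> * norm (complex_of_real u) ^ Suc 1 / fact 1"
    by (rule Taylor_exp)
  then have "norm (complex_of_real (exp u - 1 - u)) \<le> exp \<bar>u\<bar> * u\<^sup>2"
    by (simp add: exp_of_real power2_eq_square algebra_simps)
  then show ?thesis unfolding norm_of_real by linarith
qed

text \<open>
  A pointwise bound for the integrand of the logarithmic moment generating function of the truncated
  jumps, compensated by \<open>x / (1 + |x|\<^sup>2)\<close> as in the Levy--Khintchine formula. The summands are the second-order
  remainder of the exponential, the compensator error of the small jumps, and the compensator of the jumps
  that the truncation removes.
\<close>

definition jump_cost_density :: "real \<Rightarrow> real \<Rightarrow> 'a::euclidean_space \<Rightarrow> real" where
  "jump_cost_density s L x = (if norm x \<le> L
     then s\<^sup>2 * exp (s * L) * (norm x)\<^sup>2 + s * norm x * min ((norm x)\<^sup>2) 1 else s)"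

definition jump_cost :: "'a::euclidean_space measure \<Rightarrow> real \<Rightarrow> real \<Rightarrow> real" where
  "jump_cost M s L = (\<integral>x. jump_cost_density s L x \<partial>M)"

lemma jump_cost_density_measurable [measurable]:
  "jump_cost_density s L \<in> borel_measurable (borel :: 'a::euclidean_space measure)"
  unfolding jump_cost_density_def by measurable

lemma jump_cost_density_nonneg: "s \<ge> 0 \<Longrightarrow> 0 \<le> jump_cost_density s L x"
  by (simp add: jump_cost_density_def)

lemma sq_le_min_sq:
  assumes "r \<ge> 0" "r \<le> L" "L > 0"
  shows "r\<^sup>2 \<le> max 1 (L\<^sup>2) * min (r\<^sup>2) (1::real)"
proof (cases "r \<le> 1")
  case True
  then have "r\<^sup>2 \<le> 1" using assms by (simp add: power_le_one)
  then show ?thesis using mult_right_mono[of 1 "max 1 (L\<^sup>2)" "r\<^sup>2"] by simp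
next
  case False
  then have "1 \<le> r\<^sup>2" by simp
  moreover have "r\<^sup>2 \<le> L\<^sup>2" using assms by (intro power_mono) auto
  ultimately show ?thesis by simp
qed

lemma integrable_jump_cost_density:
  assumes M: "levy_measure (M :: 'a::euclidean_space measure)" and s: "s \<ge> 0" and L: "L > 0"
  shows "integrable M (jump_cost_density s L)"
proof (rule levy_integrable[OF M jump_cost_density_measurable,
      where C="s\<^sup>2 * exp (s * L) * max 1 (L\<^sup>2) + s * L + s / min (L\<^sup>2) 1"])
  let ?C1 = "s\<^sup>2 * exp (s * L) * max 1 (L\<^sup>2)"
  fix x :: 'a
  let ?m = "min ((norm x)\<^sup>2) 1"
  have pos: "0 \<le> s / min (L\<^sup>2) 1" "0 \<le> ?C1" "0 \<le> s * L" "0 \<le> ?m" using s L by auto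
  show "norm (jump_cost_density s L x) \<le> (?C1 + s * L + s / min (L\<^sup>2) 1) * ?m"
  proof (cases "norm x \<le> L")
    case True
    have "s\<^sup>2 * exp (s * L) * (norm x)\<^sup>2 \<le> s\<^sup>2 * exp (s * L) * (max 1 (L\<^sup>2) * ?m)"
      using True L by (intro mult_left_mono sq_le_min_sq) auto
    moreover have "s * norm x * ?m \<le> s * L * ?m"
      using True s by (intro mult_right_mono mult_left_mono) auto
    moreover have "0 \<le> s / min (L\<^sup>2) 1 * ?m" using pos(1,4) by (rule mult_nonneg_nonneg)
    moreover have "norm (jump_cost_density s L x) = s\<^sup>2 * exp (s * L) * (norm x)\<^sup>2 + s * norm x * ?m"
      using True jump_cost_density_nonneg[OF s, of L x] by (simp add: jump_cost_density_def)
    ultimately show ?thesis unfolding distrib_right mult.assoc by linarith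
  next
    case False
    then have "s \<le> s / min (L\<^sup>2) 1 * ?m"
      using min_sq_ge_on_tail[OF L, of x] s L by (simp add: field_simps mult_left_mono)
    moreover have "0 \<le> ?C1 * ?m" "0 \<le> s * L * ?m" using pos by (auto intro: mult_nonneg_nonneg)
    moreover have "norm (jump_cost_density s L x) = s"
      using False s by (simp add: jump_cost_density_def)
    ultimately show ?thesis unfolding distrib_right by linarith
  qed
next
  show "0 \<le> s\<^sup>2 * exp (s * L) * max 1 (L\<^sup>2) + s * L + s / min (L\<^sup>2) 1"
    using s L by (intro add_nonneg_nonneg mult_nonneg_nonneg divide_nonneg_nonneg) auto
qed

lemma norm_le_one_plus_norm_sq: "norm x \<le> 1 + (norm x)\<^sup>2"
proof -
  have "0 \<le> (norm x - 1)\<^sup>2" by simp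
  then have "2 * norm x \<le> 1 + (norm x)\<^sup>2" by (simp add: power2_diff)
  then show ?thesis using norm_ge_zero[of x] by linarith
qed

lemma jump_cost_bound:
  assumes e: "norm e \<le> s" and L: "L > 0"
  shows "exp (e \<bullet> trunc L x) - 1 - (e \<bullet> x) / (1 + (norm x)\<^sup>2) \<le> jump_cost_density s L x"
proof -
  have s: "s \<ge> 0" using e norm_ge_zero[of e] by linarith
  let ?u = "e \<bullet> x"
  have u: "\<bar>?u\<bar> \<le> s * norm x"
    using Cauchy_Schwarz_ineq2[of e x] mult_right_mono[OF e, of "norm x"] by simp
  have p: "1 + (norm x)\<^sup>2 > 0" by (simp add: add_pos_nonneg)
  show ?thesis
  proof (cases "norm x \<le> L")
    case True
    have "exp ?u - 1 - ?u \<le> exp \<bar>?u\<bar> * ?u\<^sup>2" by (rule exp_remainder_real)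
    also have "\<dots> \<le> exp (s * L) * (s * norm x)\<^sup>2"
    proof (intro mult_mono)
      have "\<bar>?u\<bar> \<le> s * L" using u True s mult_left_mono[of "norm x" L s] by linarith
      then show "exp \<bar>?u\<bar> \<le> exp (s * L)" by simp
      show "?u\<^sup>2 \<le> (s * norm x)\<^sup>2" using u by (metis abs_ge_zero power2_abs power_mono)
    qed auto
    finally have 1: "exp ?u - 1 - ?u \<le> s\<^sup>2 * exp (s * L) * (norm x)\<^sup>2"
      by (simp add: power_mult_distrib mult_ac)
    have "?u - ?u / (1 + (norm x)\<^sup>2) = ?u * ((norm x)\<^sup>2 / (1 + (norm x)\<^sup>2))"
      using p by (simp add: field_simps)
    also have "\<dots> \<le> (s * norm x) * min ((norm x)\<^sup>2) 1"
    proof (intro mult_mono)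
      show "(norm x)\<^sup>2 / (1 + (norm x)\<^sup>2) \<le> min ((norm x)\<^sup>2) 1"
        using p by (simp add: divide_le_eq mult_le_cancel_left1)
    qed (use u s in auto)
    finally show ?thesis using 1 True by (simp add: jump_cost_density_def trunc_def)
  next
    case False
    have "norm x \<le> 1 + (norm x)\<^sup>2" by (rule norm_le_one_plus_norm_sq)
    then have "s * norm x \<le> s * (1 + (norm x)\<^sup>2)" using s by (rule mult_left_mono)
    then have "- ?u \<le> s * (1 + (norm x)\<^sup>2)" using u by linarith
    then have "- ?u / (1 + (norm x)\<^sup>2) \<le> s" using p by (subst pos_divide_le_eq)
    then show ?thesis using False by (simp add: jump_cost_density_def trunc_def)
  qed
qed

definition lk_integrand :: "'a::euclidean_space \<Rightarrow> 'a \<Rightarrow> complex" where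
  "lk_integrand z x = iexp (z \<bullet> x) - 1 - \<i> * of_real ((z \<bullet> x) / (1 + (norm x)\<^sup>2))"

lemma lk_integrand_measurable [measurable]: "lk_integrand z \<in> borel_measurable borel"
  unfolding lk_integrand_def by measurable

text \<open>
  Near the origin the compensator cancels the first-order term of the exponential up to a cubic error;
  far from the origin every term is bounded.
\<close>

lemma norm_lk_integrand_le:
  "norm (lk_integrand z x) \<le> (2 + norm z + (norm z)\<^sup>2) * min ((norm x)\<^sup>2) 1"
proof -
  let ?t = "z \<bullet> x" and ?r = "(norm x)\<^sup>2"
  have t: "\<bar>?t\<bar> \<le> norm z * norm x" by (rule Cauchy_Schwarz_ineq2)
  have p: "1 + ?r > 0" by (simp add: add_pos_nonneg)
  show ?thesis
  proof (cases "norm x \<le> 1")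
    case True
    then have m: "min ?r 1 = ?r" by (simp add: power_le_one min_absorb1)
    have "lk_integrand z x = (iexp ?t - 1 - \<i> * ?t) + \<i> * of_real (?t * (?r / (1 + ?r)))"
    proof -
      have "?t - ?t / (1 + ?r) = ?t * (?r / (1 + ?r))" using p by (simp add: field_simps)
      then have "\<i> * of_real (?t * (?r / (1 + ?r))) = \<i> * ?t - \<i> * of_real (?t / (1 + ?r))"
        by (metis of_real_diff right_diff_distrib)
      then show ?thesis by (simp add: lk_integrand_def)
    qed
    then have "norm (lk_integrand z x) \<le> norm (iexp ?t - 1 - \<i> * ?t) + \<bar>?t * (?r / (1 + ?r))\<bar>"
      using norm_triangle_ineq[of "iexp ?t - 1 - \<i> * ?t" "\<i> * of_real (?t * (?r / (1 + ?r)))"]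
      by (simp add: norm_mult del: of_real_mult of_real_divide)
    also have "norm (iexp ?t - 1 - \<i> * ?t) \<le> (norm z)\<^sup>2 * ?r"
    proof -
      have "norm (iexp ?t - (\<Sum>k \<le> 1. (\<i> * ?t)^k / fact k)) \<le> \<bar>?t\<bar>^(Suc 1) / fact (Suc 1)"
        by (rule iexp_approx1)
      then have "norm (iexp ?t - 1 - \<i> * ?t) \<le> ?t\<^sup>2 / 2"
        by (simp add: power2_eq_square algebra_simps)
      also have "\<dots> \<le> ?t\<^sup>2" by simp
      also have "\<dots> \<le> (norm z * norm x)\<^sup>2" using t by (metis abs_ge_zero power2_abs power_mono)
      finally show ?thesis by (simp add: power_mult_distrib)
    qed
    also have "\<bar>?t * (?r / (1 + ?r))\<bar> \<le> norm z * ?r"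
    proof -
      have "\<bar>?t * (?r / (1 + ?r))\<bar> = \<bar>?t\<bar> * (?r / (1 + ?r))" using p by (simp add: abs_mult)
      also have "\<dots> \<le> norm z * ?r"
      proof (intro mult_mono)
        show "\<bar>?t\<bar> \<le> norm z" using t True mult_left_mono[of "norm x" 1 "norm z"] by simp
        show "?r / (1 + ?r) \<le> ?r" using p by (simp add: divide_le_eq mult_le_cancel_left1)
      qed auto
      finally show ?thesis .
    qed
    finally have "norm (lk_integrand z x) \<le> (norm z)\<^sup>2 * ?r + norm z * ?r" by simp
    also have "\<dots> \<le> (2 + norm z + (norm z)\<^sup>2) * ?r" by (simp add: distrib_right)
    finally show ?thesis unfolding m .
  next
    case False
    then have m: "min ?r 1 = 1" by (simp add: min_absorb2)
    have "norm (lk_integrand z x) \<le> norm (iexp ?t) + norm (1::complex) + \<bar>?t / (1 + ?r)\<bar>"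
      unfolding lk_integrand_def
      using norm_triangle_ineq4[of "iexp ?t - 1" "\<i> * of_real (?t / (1 + ?r))"] norm_triangle_ineq4[of "iexp ?t" 1]
      by (simp add: norm_mult del: of_real_divide)
    also have "\<bar>?t / (1 + ?r)\<bar> \<le> norm z"
    proof -
      have "norm x \<le> 1 + ?r" by (rule norm_le_one_plus_norm_sq)
      then have "norm z * norm x \<le> norm z * (1 + ?r)" by (intro mult_left_mono) auto
      then have "\<bar>?t\<bar> \<le> norm z * (1 + ?r)" using t by linarith
      then show ?thesis using p by (simp add: abs_divide divide_le_eq)
    qed
    finally show ?thesis unfolding m by (simp add: add_increasing2)
  qed
qed

lemma integrable_lk_integrand:
  "levy_measure M \<Longrightarrow> integrable M (lk_integrand z)"
  by (rule levy_integrable[OF _ lk_integrand_measurable norm_lk_integrand_le]) auto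

definition cut_measure :: "'a::euclidean_space measure \<Rightarrow> nat \<Rightarrow> 'a measure" where
  "cut_measure M n = density M (\<lambda>x. ennreal (indicator {x. norm x > 1 / real (Suc n)} x))"

text \<open>
  Enough steps for the two requirements: at least twice the total mass of the cut measure, and so many
  that the error of \<open>char_fun_walk_law_approx\<close> is of order \<open>1/n\<close>.
\<close>

definition cut_steps :: "'a::euclidean_space measure \<Rightarrow> nat \<Rightarrow> nat" where
  "cut_steps M n = nat \<lceil>2 * measure (cut_measure M n) UNIV + real (Suc n) * (measure (cut_measure M n) UNIV)\<^sup>2\<rceil> + 1"

definition cut_drift :: "'a::euclidean_space measure \<Rightarrow> 'a \<Rightarrow> nat \<Rightarrow> 'a" where
  "cut_drift M b n = b - (\<integral>x. (1 / (1 + (norm x)\<^sup>2)) *\<^sub>R x \<partial>cut_measure M n)"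

context
  fixes M :: "'a::euclidean_space measure"
  assumes M: "levy_measure M"
begin

lemma sets_levy [measurable_cong]: "sets M = sets borel"
  using M by (simp add: levy_measure_def)

lemma space_levy: "space M = UNIV"
  using sets_eq_imp_space_eq[OF sets_levy] by simp

lemma sets_cut [measurable_cong]: "sets (cut_measure M n) = sets borel"
  by (simp add: cut_measure_def sets_levy)

lemma emeasure_cut: "A \<in> sets borel \<Longrightarrow> emeasure (cut_measure M n) A = emeasure M ({x. norm x > 1 / real (Suc n)} \<inter> A)"
  unfolding cut_measure_def
  by (subst emeasure_density) (auto simp: ennreal_indicator sets_levy nn_integral_indicator[symmetric] indicator_inter_arith simp del: nn_integral_indicator intro!: nn_integral_cong)

lemma emeasure_cut_le: "A \<in> sets borel \<Longrightarrow> emeasure (cut_measure M n) A \<le> emeasure M A"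
  by (subst emeasure_cut) (auto intro!: emeasure_mono simp: sets_levy)

lemma finite_measure_cut: "finite_measure (cut_measure M n)"
proof
  have "emeasure (cut_measure M n) UNIV < \<infinity>"
    using levy_tail_finite[OF M, of "1 / real (Suc n)"] by (simp add: emeasure_cut)
  then show "emeasure (cut_measure M n) (space (cut_measure M n)) \<noteq> \<infinity>"
    by (simp add: cut_measure_def space_levy)
qed

lemma jump_intensity_cut: "jump_intensity (cut_measure M n) (cut_steps M n)"
proof -
  interpret finite_measure "cut_measure M n" by (rule finite_measure_cut)
  have "2 * measure (cut_measure M n) UNIV \<le> real (cut_steps M n)"
  proof -
    have "0 \<le> real (Suc n) * (measure (cut_measure M n) UNIV)\<^sup>2" by simp
    then show ?thesis unfolding cut_steps_def by linarith
  qed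
  then show ?thesis by unfold_locales (auto simp: sets_cut cut_steps_def)
qed

lemma cut_steps_error: "12 * (measure (cut_measure M n) UNIV)\<^sup>2 / real (cut_steps M n) \<le> 12 / real (Suc n)"
proof -
  let ?q = "(measure (cut_measure M n) UNIV)\<^sup>2"
  have "real (Suc n) * ?q \<le> real (cut_steps M n)"
  proof -
    have "0 \<le> 2 * measure (cut_measure M n) UNIV" by simp
    then show ?thesis unfolding cut_steps_def by linarith
  qed
  moreover have "real (cut_steps M n) > 0"
    using jump_intensity.N_pos[OF jump_intensity_cut] by simp
  ultimately show ?thesis by (simp add: divide_le_eq le_divide_eq mult.commute)
qed

lemma integrable_cut:
  fixes f :: "'a \<Rightarrow> 'b::{banach, second_countable_topology}"
  assumes "f \<in> borel_measurable borel" "\<And>x. norm (f x) \<le> C"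
  shows "integrable (cut_measure M n) f"
proof -
  interpret finite_measure "cut_measure M n" by (rule finite_measure_cut)
  show ?thesis using assms by (intro integrable_const_bound[where B=C]) (auto simp: measurable_cong_sets[OF sets_cut refl])
qed

lemma norm_drift_integrand_le: "norm ((1 / (1 + (norm x)\<^sup>2)) *\<^sub>R x) \<le> 1" for x :: 'a
  using norm_le_one_plus_norm_sq[of x] by (simp add: divide_le_eq add_pos_nonneg)

lemma inner_drift_integral:
  "(\<integral>x. (e \<bullet> x) / (1 + (norm x)\<^sup>2) \<partial>cut_measure M n) = e \<bullet> (b - cut_drift M b n)"
proof -
  have "integrable (cut_measure M n) (\<lambda>x. (1 / (1 + (norm x)\<^sup>2)) *\<^sub>R x)"
    by (rule integrable_cut[OF _ norm_drift_integrand_le]) measurable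
  then have "(\<integral>x. e \<bullet> ((1 / (1 + (norm x)\<^sup>2)) *\<^sub>R x) \<partial>cut_measure M n) = e \<bullet> (b - cut_drift M b n)"
    unfolding cut_drift_def by (simp del: inner_scaleR_right)
  then show ?thesis by simp
qed

lemma integrable_inner_drift:
  "integrable (cut_measure M n) (\<lambda>x. (e \<bullet> x) / (1 + (norm x)\<^sup>2))"
proof -
  have "integrable (cut_measure M n) (\<lambda>x. e \<bullet> ((1 / (1 + (norm x)\<^sup>2)) *\<^sub>R x))"
    by (intro integrable_inner_right integrable_cut[OF _ norm_drift_integrand_le]) measurable
  then show ?thesis by simp
qed

text \<open>
  The drift of the approximating walk contains the compensator of the jumps, so the logarithmic moment
  generating function plus the drift is an integral of a compensated exponential, and the bound is
  uniform in \<open>n\<close> although the drifts themselves may diverge.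
\<close>

lemma mgf_bound_cut:
  assumes s: "s \<ge> 0" and L: "L > 0"
  shows "jump_intensity.mgf_bound (cut_measure M n) (cut_drift M b n) L s (s * norm b + jump_cost M s L)"
proof -
  interpret J: jump_intensity "cut_measure M n" "cut_steps M n" by (rule jump_intensity_cut)
  show ?thesis unfolding J.mgf_bound_def
  proof (intro allI impI)
    fix e :: 'a assume e: "norm e \<le> s"
    have 1: "integrable (cut_measure M n) (\<lambda>x. exp (e \<bullet> trunc L x) - 1)"
      using L by (intro Bochner_Integration.integrable_diff J.integrable_exp_trunc) auto
    have 2: "integrable (cut_measure M n) (jump_cost_density s L)"
      unfolding cut_measure_def
      using integrable_jump_cost_density[OF M s L]
      by (subst integrable_density) (auto intro!: integrable_real_mult_indicator simp: mult.commute[of "indicator _ _"] sets_levy)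
    have "J.log_mgf L e - e \<bullet> (b - cut_drift M b n) =
       (\<integral>x. exp (e \<bullet> trunc L x) - 1 - (e \<bullet> x) / (1 + (norm x)\<^sup>2) \<partial>cut_measure M n)"
      unfolding J.log_mgf_def inner_drift_integral[where e=e and n=n and b=b, symmetric]
      by (rule Bochner_Integration.integral_diff[symmetric]) (fact 1, fact integrable_inner_drift)
    also have "\<dots> \<le> (\<integral>x. jump_cost_density s L x \<partial>cut_measure M n)"
      by (intro integral_mono Bochner_Integration.integrable_diff[OF 1] integrable_inner_drift 2 jump_cost_bound[OF e L])
    also have "\<dots> = (\<integral>x. indicator {x. norm x > 1 / real (Suc n)} x *\<^sub>R jump_cost_density s L x \<partial>M)"
      unfolding cut_measure_def by (subst integral_density) (auto simp: sets_levy)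
    also have "\<dots> \<le> jump_cost M s L"
      unfolding jump_cost_def using jump_cost_density_nonneg[OF s]
      by (intro integral_mono' integrable_jump_cost_density[OF M s L]) (auto split: split_indicator)
    finally have "e \<bullet> cut_drift M b n + J.log_mgf L e \<le> e \<bullet> b + jump_cost M s L"
      by (simp add: inner_diff_right)
    moreover have "e \<bullet> b \<le> s * norm b"
      using norm_cauchy_schwarz[of e b] mult_right_mono[OF e, of "norm b"] by simp
    ultimately show "e \<bullet> cut_drift M b n + J.log_mgf L e \<le> s * norm b + jump_cost M s L" by linarith
  qed
qed

definition approx_law :: "'a \<Rightarrow> nat \<Rightarrow> 'a measure" where
  "approx_law b n = jump_intensity.walk_law (cut_measure M n) (cut_steps M n) (cut_drift M b n)"

lemma prob_space_approx_law: "prob_space (approx_law b n)"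
  unfolding approx_law_def by (rule jump_intensity.prob_space_walk_law[OF jump_intensity_cut])

lemma sets_approx_law: "sets (approx_law b n) = sets borel"
  unfolding approx_law_def by (rule jump_intensity.sets_walk_law[OF jump_intensity_cut])

text \<open>
  Up to the error of \<open>char_fun_walk_law_approx\<close>, the characteristic function of the walk is given by the
  Levy--Khintchine formula for the cut measure; remove the cut by dominated convergence.
\<close>

lemma char_fun_approx_law_tendsto:
  "(\<lambda>n. char_fun (approx_law b n) z) \<longlonglongrightarrow>
     exp (\<i> * of_real (b \<bullet> z) + (CLINT x|M. lk_integrand z x))"
proof -
  let ?I = "\<lambda>n. indicator {x. norm x > 1 / real (Suc n)} :: 'a \<Rightarrow> real"
  define w where "w n = (CLINT x|cut_measure M n. iexp (z \<bullet> x) - 1)" for n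
  have eq: "\<i> * of_real (z \<bullet> cut_drift M b n) + w n =
      \<i> * of_real (b \<bullet> z) + (CLINT x|M. ?I n x *\<^sub>R lk_integrand z x)" for n
  proof -
    have bd: "norm (iexp t - 1) \<le> 2" for t :: real
      using norm_triangle_ineq4[of "iexp t" 1] by simp
    have i1: "complex_integrable (cut_measure M n) (\<lambda>x. iexp (z \<bullet> x) - 1)"
      by (rule integrable_cut[OF _ bd]) measurable
    have i2: "complex_integrable (cut_measure M n) (\<lambda>x. \<i> * of_real ((z \<bullet> x) / (1 + (norm x)\<^sup>2)))"
      by (intro integrable_mult_right integrable_of_real integrable_inner_drift)
    have "(CLINT x|M. ?I n x *\<^sub>R lk_integrand z x) = (CLINT x|cut_measure M n. lk_integrand z x)"
      unfolding cut_measure_def by (subst integral_density) (auto simp: sets_levy)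
    also have "\<dots> = w n - (CLINT x|cut_measure M n. \<i> * of_real ((z \<bullet> x) / (1 + (norm x)\<^sup>2)))"
      unfolding lk_integrand_def w_def by (rule Bochner_Integration.integral_diff[OF i1 i2])
    also have "(CLINT x|cut_measure M n. \<i> * of_real ((z \<bullet> x) / (1 + (norm x)\<^sup>2))) = \<i> * of_real (z \<bullet> (b - cut_drift M b n))"
      unfolding inner_drift_integral[symmetric] by (simp del: of_real_divide)
    finally show ?thesis by (simp add: inner_diff_right inner_commute[of z b] algebra_simps)
  qed
  have "(\<lambda>n. CLINT x|M. ?I n x *\<^sub>R lk_integrand z x) \<longlonglongrightarrow> (CLINT x|M. lk_integrand z x)"
  proof (rule integral_dominated_convergence[where w="\<lambda>x. norm (lk_integrand z x)"])
    show "AE x in M. (\<lambda>n. ?I n x *\<^sub>R lk_integrand z x) \<longlonglongrightarrow> lk_integrand z x"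
    proof (rule AE_I2)
      fix x :: 'a
      show "(\<lambda>n. ?I n x *\<^sub>R lk_integrand z x) \<longlonglongrightarrow> lk_integrand z x"
      proof (cases "x = 0")
        case True
        then show ?thesis by (simp add: lk_integrand_def)
      next
        case False
        have "\<forall>\<^sub>F n in sequentially. inverse (real (Suc n)) < norm x"
          using LIMSEQ_inverse_real_of_nat False by (intro order_tendstoD) auto
        then have "\<forall>\<^sub>F n in sequentially. ?I n x *\<^sub>R lk_integrand z x = lk_integrand z x"
          by eventually_elim (simp add: inverse_eq_divide)
        then show ?thesis by (rule tendsto_eventually)
      qed
    qed
    show "integrable M (\<lambda>x. norm (lk_integrand z x))"
      using integrable_lk_integrand[OF M] by simp
    show "AE x in M. norm (?I n x *\<^sub>R lk_integrand z x) \<le> norm (lk_integrand z x)" for n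
      by (rule AE_I2) (auto split: split_indicator)
  qed measurable
  then have lim1: "(\<lambda>n. exp (\<i> * of_real (z \<bullet> cut_drift M b n) + w n)) \<longlonglongrightarrow>
      exp (\<i> * of_real (b \<bullet> z) + (CLINT x|M. lk_integrand z x))"
    unfolding eq by (intro tendsto_intros)
  have err: "norm (char_fun (approx_law b n) z - exp (\<i> * of_real (z \<bullet> cut_drift M b n) + w n)) \<le> 12 / real (Suc n)" for n
    using order_trans[OF jump_intensity.char_fun_walk_law_approx[OF jump_intensity_cut, of n "cut_drift M b n" z] cut_steps_error[of n]]
    by (simp add: approx_law_def w_def exp_add)
  have "(\<lambda>n. char_fun (approx_law b n) z - exp (\<i> * of_real (z \<bullet> cut_drift M b n) + w n)) \<longlonglongrightarrow> 0"
  proof (rule Lim_null_comparison)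
    show "\<forall>\<^sub>F n in sequentially. norm (char_fun (approx_law b n) z - exp (\<i> * of_real (z \<bullet> cut_drift M b n) + w n)) \<le> 12 / real (Suc n)"
      using err by (intro always_eventually allI)
    show "(\<lambda>n. 12 / real (Suc n)) \<longlonglongrightarrow> 0"
      using tendsto_mult_right_zero[OF LIMSEQ_inverse_real_of_nat, of 12] by (simp add: divide_inverse)
  qed
  from tendsto_add[OF this lim1] show ?thesis by simp
qed

end

declare sets_levy [measurable_cong del] sets_cut [measurable_cong del]

definition ID_error :: "'a::euclidean_space measure \<Rightarrow> 'a \<Rightarrow> real \<Rightarrow> real \<Rightarrow> real \<Rightarrow> real" where
  "ID_error M b s L a = chernoff TYPE('a) (s * norm b + jump_cost M s L) s a"

text \<open>
  Thickening by \<open>a\<close> twice: once for the passage from the law to the walk, once for the passage from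
  the walk to its big jump.
\<close>

lemma ID_tail_upper:
  fixes M \<mu> :: "'a::euclidean_space measure"
  assumes ID: "is_ID M b \<mu>" and L: "L > 0" and s: "s \<ge> 0" and a: "a > 0"
    and B: "B \<in> sets borel" and Ba: "\<And>x. x \<in> B \<Longrightarrow> norm x \<ge> 2 * a"
  shows "measure \<mu> B \<le> measure M (thickening (2 * a) B \<inter> {x. norm x > L}) + ID_error M b s L a
    + (measure M {x. norm x > L})\<^sup>2"
proof -
  have M: "levy_measure M" and mu: "prob_space \<mu>" "sets \<mu> = sets borel"
    and cf: "\<And>z. char_fun \<mu> z = exp (\<i> * of_real (b \<bullet> z) + (CLINT x|M. lk_integrand z x))"
    using ID by (auto simp: is_ID_def lk_integrand_def)
  have sM: "sets M = sets borel" by (rule sets_levy[OF M])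
  let ?G = "{x::'a. norm x > L}" and ?T = "thickening (2 * a) B \<inter> {x::'a. norm x > L}"
  have G[measurable]: "?G \<in> sets borel" by measurable
  have fG: "emeasure M ?G < \<infinity>" by (rule levy_tail_finite[OF M L])
  have fT: "emeasure M ?T < \<infinity>"
    using emeasure_mono[of ?T ?G M] fG G by (auto simp: sM intro: le_less_trans)
  have mT: "measure M (thickening a (thickening a B) \<inter> ?G) \<le> measure M ?T"
    using fT thickening_thickening_subset[of a a B]
    by (intro measure_mono_fmeasurable) (auto simp: sM fmeasurable_def)
  have step: "measure (approx_law M b n) (thickening a B) \<le> measure M ?T + ID_error M b s L a + (measure M ?G)\<^sup>2" for n
  proof -
    interpret J: jump_intensity "cut_measure M n" "cut_steps M n" by (rule jump_intensity_cut[OF M])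
    interpret A: prob_space "approx_law M b n" by (rule prob_space_approx_law[OF M])
    have "emeasure (approx_law M b n) (thickening a B) \<le>
        emeasure (cut_measure M n) (thickening a (thickening a B) \<inter> ?G) +
        ennreal (ID_error M b s L a) + (emeasure (cut_measure M n) ?G)\<^sup>2"
      unfolding approx_law_def[OF M] ID_error_def
    proof (rule J.walk_law_upper[OF less_imp_le[OF L] s mgf_bound_cut[OF M s L]])
      fix x assume "x \<in> thickening a B"
      then obtain y where y: "y \<in> B" "dist x y < a" by (auto simp: thickening_def)
      have "norm y \<le> norm x + dist x y" using norm_triangle_ineq2[of y x] by (simp add: dist_norm norm_minus_commute)
      then show "a \<le> norm x" using Ba[OF y(1)] y(2) by linarith
    qed simp
    also have "\<dots> \<le> emeasure M ?T + ennreal (ID_error M b s L a) + (emeasure M ?G)\<^sup>2"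
    proof (intro add_mono power_mono order_refl emeasure_cut_le[OF M] G)
      have "emeasure (cut_measure M n) (thickening a (thickening a B) \<inter> ?G) \<le> emeasure (cut_measure M n) ?T"
        using thickening_thickening_subset[of a a B] by (intro emeasure_mono) (auto simp: sets_cut[OF M])
      also have "\<dots> \<le> emeasure M ?T" by (rule emeasure_cut_le[OF M]) auto
      finally show "emeasure (cut_measure M n) (thickening a (thickening a B) \<inter> ?G) \<le> emeasure M ?T" .
    qed auto
    also have "\<dots> = ennreal (measure M ?T + ID_error M b s L a + (measure M ?G)\<^sup>2)"
    proof -
      have "0 \<le> ID_error M b s L a" by (simp add: ID_error_def chernoff_def)
      then show ?thesis using fG fT
        by (simp add: emeasure_eq_ennreal_measure less_top ennreal_power[symmetric])
    qed
    finally show ?thesis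
      by (subst (asm) A.emeasure_eq_measure, subst (asm) ennreal_le_iff) (auto simp: ID_error_def chernoff_def)
  qed
  show ?thesis
  proof (rule field_le_epsilon)
    fix \<eta> :: real assume eta: "\<eta> > 0"
    have "\<forall>\<^sub>F n in sequentially. measure \<mu> B \<le> measure (approx_law M b n) (thickening a B) + \<eta>"
      by (rule char_fun_tendsto_imp_lower[OF prob_space_approx_law[OF M] sets_approx_law[OF M] mu _ B a eta])
        (simp add: cf char_fun_approx_law_tendsto[OF M])
    then obtain n where "measure \<mu> B \<le> measure (approx_law M b n) (thickening a B) + \<eta>"
      using eventually_happens by force
    with step[of n] show "measure \<mu> B \<le> measure M ?T + ID_error M b s L a + (measure M ?G)\<^sup>2 + \<eta>"
      by linarith
  qed
qed

text \<open>
  For \<open>1/(n+1) \<le> L\<close> the cut measure agrees with \<open>M\<close> on \<open>B\<close>, so the left-hand side is exact.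
\<close>

lemma ID_tail_lower:
  fixes M \<mu> :: "'a::euclidean_space measure"
  assumes ID: "is_ID M b \<mu>" and L: "L > 0" and s: "s \<ge> 0" and a: "a > 0"
    and B: "B \<in> sets borel" and BL: "\<And>x. x \<in> B \<Longrightarrow> norm x > L"
  shows "measure M B \<le> measure \<mu> (thickening (2 * a) B) + 2 * ID_error M b s L a * measure M B
    + (measure M {x. norm x > L})\<^sup>2"
proof -
  have M: "levy_measure M" and mu: "prob_space \<mu>" "sets \<mu> = sets borel"
    and cf: "\<And>z. char_fun \<mu> z = exp (\<i> * of_real (b \<bullet> z) + (CLINT x|M. lk_integrand z x))"
    using ID by (auto simp: is_ID_def lk_integrand_def)
  interpret mu: prob_space \<mu> by (rule mu)
  have sM: "sets M = sets borel" by (rule sets_levy[OF M])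
  let ?G = "{x::'a. norm x > L}"
  have G[measurable]: "?G \<in> sets borel" by measurable
  have fG: "emeasure M ?G < \<infinity>" by (rule levy_tail_finite[OF M L])
  have BG: "B \<subseteq> ?G" using BL by auto
  have fB: "emeasure M B < \<infinity>"
    using emeasure_mono[of B ?G M] fG G BG by (auto simp: sM intro: le_less_trans)
  have step: "measure M B \<le> measure (approx_law M b n) (thickening a B) + 2 * ID_error M b s L a * measure M B + (measure M ?G)\<^sup>2"
    if n: "1 / real (Suc n) \<le> L" for n
  proof -
    interpret J: jump_intensity "cut_measure M n" "cut_steps M n" by (rule jump_intensity_cut[OF M])
    interpret A: prob_space "approx_law M b n" by (rule prob_space_approx_law[OF M])
    have cut: "emeasure (cut_measure M n) B = emeasure M B"
    proof -
      have "{x. norm x > 1 / real (Suc n)} \<inter> B = B" using BL n by force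
      then show ?thesis using emeasure_cut[OF M B] by simp
    qed
    have "emeasure M B \<le> emeasure (approx_law M b n) (thickening a B) +
        ennreal (2 * ID_error M b s L a) * emeasure M B + (emeasure (cut_measure M n) ?G)\<^sup>2"
      using J.walk_law_lower[OF less_imp_le[OF L] s mgf_bound_cut[OF M s L, of n b] B BL, of a]
      unfolding approx_law_def[OF M] cut ID_error_def by simp
    also have "\<dots> \<le> emeasure (approx_law M b n) (thickening a B) +
        ennreal (2 * ID_error M b s L a) * emeasure M B + (emeasure M ?G)\<^sup>2"
      by (intro add_mono power_mono order_refl emeasure_cut_le[OF M] G) auto
    also have "\<dots> = ennreal (measure (approx_law M b n) (thickening a B) + 2 * ID_error M b s L a * measure M B + (measure M ?G)\<^sup>2)"
    proof -
      have "0 \<le> ID_error M b s L a" by (simp add: ID_error_def chernoff_def)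
      then show ?thesis using fG fB
        by (simp add: emeasure_eq_ennreal_measure less_top ennreal_power[symmetric] A.emeasure_eq_measure ennreal_mult)
    qed
    finally show ?thesis using fB
      by (subst (asm) emeasure_eq_ennreal_measure, simp, subst (asm) ennreal_le_iff) (auto simp: ID_error_def chernoff_def)
  qed
  show ?thesis
  proof (rule field_le_epsilon)
    fix \<eta> :: real assume eta: "\<eta> > 0"
    have 1: "\<forall>\<^sub>F n in sequentially. measure (approx_law M b n) (thickening a B) \<le> measure \<mu> (thickening a (thickening a B)) + \<eta>"
      by (rule char_fun_tendsto_imp_upper[OF prob_space_approx_law[OF M] sets_approx_law[OF M] mu _ _ a eta])
        (simp_all add: cf char_fun_approx_law_tendsto[OF M])
    have 2: "\<forall>\<^sub>F n in sequentially. inverse (real (Suc n)) < L"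
      using LIMSEQ_inverse_real_of_nat L by (intro order_tendstoD) auto
    obtain n where n: "measure (approx_law M b n) (thickening a B) \<le> measure \<mu> (thickening a (thickening a B)) + \<eta>"
      "inverse (real (Suc n)) < L"
      using eventually_happens[OF eventually_conj[OF 1 2]] by auto
    have "measure \<mu> (thickening a (thickening a B)) \<le> measure \<mu> (thickening (2 * a) B)"
      using thickening_thickening_subset[of a a B] mu(2) by (intro mu.finite_measure_mono) auto
    then show "measure M B \<le> measure \<mu> (thickening (2 * a) B) + 2 * ID_error M b s L a * measure M B + (measure M ?G)\<^sup>2 + \<eta>"
      using step[of n] n by (simp add: inverse_eq_divide)
  qed
qed

section \<open>Regularly varying functions\<close>

text \<open>
  Regular variation with index \<open>-\<rho>\<close> of a positive nonincreasing function, the case of tails.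
\<close>

definition rv_function :: "(real \<Rightarrow> real) \<Rightarrow> real \<Rightarrow> bool" where
  "rv_function b \<rho> \<longleftrightarrow> (\<forall>r>0. b r > 0) \<and> (\<forall>x y. 0 < x \<longrightarrow> x \<le> y \<longrightarrow> b y \<le> b x) \<and>
     (\<forall>t>0. ((\<lambda>r. b (r * t) / b r) \<longlongrightarrow> t powr (- \<rho>)) at_top)"

lemma ex_dyadic:
  assumes "1 \<le> (q::real)"
  shows "\<exists>k::nat. 2 ^ k \<le> q \<and> q < 2 ^ Suc k"
proof -
  define k where "k = nat \<lfloor>log 2 q\<rfloor>"
  have l: "0 \<le> log 2 q" using assms by simp
  then have k: "real k \<le> log 2 q" "log 2 q < real k + 1" unfolding k_def by linarith+
  have "2 powr real k \<le> q" using k(1) assms by (simp add: le_log_iff)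
  moreover have "q < 2 powr (real k + 1)" using k(2) assms by (simp add: log_less_iff)
  ultimately show ?thesis by (intro exI[of _ k]) (simp add: powr_realpow powr_add mult.commute)
qed

text \<open>
  Potter bounds by iterated doubling: beyond some point, doubling the argument multiplies \<open>b\<close> by a
  factor between \<open>2\<^bsup>-\<rho>-\<eta>\<^esup>\<close> and \<open>2\<^bsup>-\<rho>+\<eta>\<^esup>\<close>, and monotonicity fills the gaps between powers of two.
\<close>

lemma potter_bounds:
  assumes b: "rv_function b \<rho>" and eta: "0 < \<eta>" "\<eta> \<le> \<rho>"
  obtains r0 C where "r0 \<ge> 1" "C \<ge> 1"
    "\<And>x y. r0 \<le> x \<Longrightarrow> x \<le> y \<Longrightarrow> b y \<le> C * (x / y) powr (\<rho> - \<eta>) * b x"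
    "\<And>x y. r0 \<le> x \<Longrightarrow> x \<le> y \<Longrightarrow> b x \<le> C * (y / x) powr (\<rho> + \<eta>) * b y"
proof -
  have pos: "b r > 0" if "r > 0" for r using b that by (simp add: rv_function_def)
  have mono: "b y \<le> b x" if "0 < x" "x \<le> y" for x y using b that by (simp add: rv_function_def)
  have lim: "((\<lambda>r. b (r * 2) / b r) \<longlongrightarrow> 2 powr (- \<rho>)) at_top"
    using b by (simp add: rv_function_def)
  have "\<forall>\<^sub>F r in at_top. b (r * 2) / b r < 2 powr (- (\<rho> - \<eta>))"
    using lim eta by (intro order_tendstoD) auto
  moreover have "\<forall>\<^sub>F r in at_top. 2 powr (- (\<rho> + \<eta>)) < b (r * 2) / b r"
    using lim eta by (intro order_tendstoD) auto
  ultimately have "\<forall>\<^sub>F r in at_top. b (r * 2) / b r < 2 powr (- (\<rho> - \<eta>)) \<and> 2 powr (- (\<rho> + \<eta>)) < b (r * 2) / b r \<and> r \<ge> 1"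
    using eventually_ge_at_top[of 1] by eventually_elim auto
  then obtain r0 where r0: "\<And>r. r \<ge> r0 \<Longrightarrow> b (r * 2) / b r < 2 powr (- (\<rho> - \<eta>)) \<and> 2 powr (- (\<rho> + \<eta>)) < b (r * 2) / b r \<and> r \<ge> 1"
    by (auto simp: eventually_at_top_linorder)
  have r1: "r0 \<ge> 1" using r0 by blast
  have st: "b (r * 2) \<le> 2 powr (- (\<rho> - \<eta>)) * b r" "b r \<le> 2 powr (\<rho> + \<eta>) * b (r * 2)" if "r \<ge> r0" for r
  proof -
    have p: "b r > 0" using that r1 by (intro pos) linarith
    show "b (r * 2) \<le> 2 powr (- (\<rho> - \<eta>)) * b r" using r0[OF that] p by (simp add: divide_less_eq)
    have "2 powr (- (\<rho> + \<eta>)) * b r \<le> b (r * 2)" using r0[OF that] p by (simp add: less_divide_eq)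
    then have "2 powr (\<rho> + \<eta>) * (2 powr (- (\<rho> + \<eta>)) * b r) \<le> 2 powr (\<rho> + \<eta>) * b (r * 2)"
      by (intro mult_left_mono) auto
    moreover have "2 powr (\<rho> + \<eta>) * (2 powr (- (\<rho> + \<eta>)) * b r) = b r"
      unfolding mult.assoc[symmetric] powr_add[symmetric] by simp
    ultimately show "b r \<le> 2 powr (\<rho> + \<eta>) * b (r * 2)" by linarith
  qed
  have it: "b (x * 2 ^ k) \<le> (2 ^ k) powr (- (\<rho> - \<eta>)) * b x \<and> b x \<le> (2 ^ k) powr (\<rho> + \<eta>) * b (x * 2 ^ k)" if x: "x \<ge> r0" for x k
  proof (induction k)
    case (Suc k)
    have ge: "x * 2 ^ k \<ge> r0"
    proof -
      have "x * 1 \<le> x * 2 ^ k" using x r1 by (intro mult_left_mono) auto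
      then show ?thesis using x by linarith
    qed
    have e: "x * 2 ^ k * 2 = x * 2 ^ Suc k" by simp
    have "b (x * 2 ^ Suc k) \<le> 2 powr (- (\<rho> - \<eta>)) * b (x * 2 ^ k)" using st(1)[OF ge] unfolding e .
    also have "\<dots> \<le> 2 powr (- (\<rho> - \<eta>)) * ((2 ^ k) powr (- (\<rho> - \<eta>)) * b x)"
      using Suc by (intro mult_left_mono) auto
    also have "\<dots> = (2 ^ Suc k) powr (- (\<rho> - \<eta>)) * b x" by (simp add: powr_mult)
    finally have 1: "b (x * 2 ^ Suc k) \<le> (2 ^ Suc k) powr (- (\<rho> - \<eta>)) * b x" .
    have "b x \<le> (2 ^ k) powr (\<rho> + \<eta>) * b (x * 2 ^ k)" using Suc by simp
    also have "\<dots> \<le> (2 ^ k) powr (\<rho> + \<eta>) * (2 powr (\<rho> + \<eta>) * b (x * 2 ^ Suc k))"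
      using st(2)[OF ge] unfolding e by (intro mult_left_mono) auto
    also have "\<dots> = (2 ^ Suc k) powr (\<rho> + \<eta>) * b (x * 2 ^ Suc k)" by (simp add: powr_mult)
    finally show ?case using 1 by simp
  qed simp
  show ?thesis
  proof (rule that[of r0 "2 powr (\<rho> + \<eta>)"])
    show "r0 \<ge> 1" by (rule r1)
    show "2 powr (\<rho> + \<eta>) \<ge> 1" using eta by (intro ge_one_powr_ge_zero) auto
    fix x y assume x: "r0 \<le> x" and xy: "x \<le> y"
    have x0: "0 < x" using x r1 by linarith
    have "1 \<le> y / x" using x0 xy by (simp add: le_divide_eq)
    then obtain k where k: "2 ^ k \<le> y / x" "y / x < 2 ^ Suc k" using ex_dyadic by blast
    have ky: "x * 2 ^ k \<le> y" "y \<le> x * 2 ^ Suc k" using k x0 by (auto simp: field_simps)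
    have y0: "0 < y" using x0 xy by linarith
    have bx: "0 < b x" "0 < b y" using pos x0 y0 by auto
    have "b y \<le> b (x * 2 ^ k)" using ky x0 by (intro mono) auto
    also have "\<dots> \<le> (2 ^ k) powr (- (\<rho> - \<eta>)) * b x" using it[OF x] by blast
    also have "\<dots> \<le> (2 powr (\<rho> + \<eta>) * (x / y) powr (\<rho> - \<eta>)) * b x"
    proof (rule mult_right_mono)
      have "(2 ^ k) powr (- (\<rho> - \<eta>)) = (1 / 2 ^ k) powr (\<rho> - \<eta>)"
        by (subst powr_minus_divide) (simp add: powr_divide)
      also have "\<dots> \<le> (2 * (x / y)) powr (\<rho> - \<eta>)"
        using ky x0 y0 eta by (intro powr_mono2) (auto simp: field_simps)
      also have "\<dots> = 2 powr (\<rho> - \<eta>) * (x / y) powr (\<rho> - \<eta>)" using x0 y0 by (intro powr_mult)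
      also have "\<dots> \<le> 2 powr (\<rho> + \<eta>) * (x / y) powr (\<rho> - \<eta>)"
        using eta by (intro mult_right_mono powr_mono) auto
      finally show "(2 ^ k) powr (- (\<rho> - \<eta>)) \<le> 2 powr (\<rho> + \<eta>) * (x / y) powr (\<rho> - \<eta>)" .
    qed (use bx in auto)
    finally show "b y \<le> 2 powr (\<rho> + \<eta>) * (x / y) powr (\<rho> - \<eta>) * b x" .
    have "b x \<le> (2 ^ Suc k) powr (\<rho> + \<eta>) * b (x * 2 ^ Suc k)" using it[OF x] by blast
    also have "\<dots> \<le> (2 ^ Suc k) powr (\<rho> + \<eta>) * b y"
      using ky y0 by (intro mult_left_mono mono) auto
    also have "\<dots> \<le> (2 * (y / x)) powr (\<rho> + \<eta>) * b y"
      using k bx eta by (intro mult_right_mono powr_mono2) auto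
    also have "(2 * (y / x)) powr (\<rho> + \<eta>) = 2 powr (\<rho> + \<eta>) * (y / x) powr (\<rho> + \<eta>)"
      using x0 y0 by (intro powr_mult)
    finally show "b x \<le> 2 powr (\<rho> + \<eta>) * (y / x) powr (\<rho> + \<eta>) * b y" .
  qed
qed

lemma rv_function_upper_power:
  assumes b: "rv_function b \<rho>" and k: "0 < \<kappa>" "\<kappa> < \<rho>"
  shows "\<exists>C>0. \<forall>\<^sub>F r in at_top. b r \<le> C * r powr (- \<kappa>)"
proof -
  have pos: "b r > 0" if "r > 0" for r using b that by (simp add: rv_function_def)
  obtain r0 C where p: "r0 \<ge> 1" "C \<ge> 1"
    "\<And>x y. r0 \<le> x \<Longrightarrow> x \<le> y \<Longrightarrow> b y \<le> C * (x / y) powr (\<rho> - (\<rho> - \<kappa>)) * b x"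
  proof -
    have "0 < \<rho> - \<kappa>" "\<rho> - \<kappa> \<le> \<rho>" using k by auto
    then show thesis by (rule potter_bounds[OF b]) (rule that)
  qed
  have "b y \<le> (C * r0 powr \<kappa> * b r0) * y powr (- \<kappa>)" if "y \<ge> r0" for y
    using p(3)[of r0 y] that p(1) by (simp add: powr_divide powr_minus_divide mult_ac)
  moreover have "C * r0 powr \<kappa> * b r0 > 0" using p pos[of r0] by simp
  ultimately show ?thesis
    by (intro exI[of _ "C * r0 powr \<kappa> * b r0"] conjI eventually_mono[OF eventually_ge_at_top[of r0]])
qed

lemma rv_function_lower_power:
  assumes b: "rv_function b \<rho>" and k: "0 < \<rho>" "\<rho> < \<kappa>"
  shows "((\<lambda>r. r powr (- \<kappa>) / b r) \<longlongrightarrow> 0) at_top"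
proof -
  have pos: "b r > 0" if "r > 0" for r using b that by (simp add: rv_function_def)
  define \<eta> where "\<eta> = min \<rho> ((\<kappa> - \<rho>) / 2)"
  have "\<eta> \<le> (\<kappa> - \<rho>) / 2" unfolding \<eta>_def by (rule min.cobounded2)
  then have "\<rho> + \<eta> < \<kappa>" using k by simp
  then have eta: "0 < \<eta>" "\<eta> \<le> \<rho>" "\<rho> + \<eta> < \<kappa>" using k by (auto simp: \<eta>_def)
  obtain r0 C where p: "r0 \<ge> 1" "C \<ge> 1"
    "\<And>x y. r0 \<le> x \<Longrightarrow> x \<le> y \<Longrightarrow> b x \<le> C * (y / x) powr (\<rho> + \<eta>) * b y"
    by (rule potter_bounds[OF b eta(1,2)]) (rule that)
  define D where "D = C / r0 powr (\<rho> + \<eta>) / b r0"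
  have D: "D \<ge> 0" using p pos[of r0] by (simp add: D_def)
  have bd: "y powr (- \<kappa>) / b y \<le> D * y powr (\<rho> + \<eta> - \<kappa>)" if "y \<ge> r0" for y
  proof -
    have y: "y > 0" "b y > 0" "b r0 > 0" using that p(1) pos by auto
    have "b r0 \<le> C * (y / r0) powr (\<rho> + \<eta>) * b y" using p(3) that by auto
    then have "1 / b y \<le> D * y powr (\<rho> + \<eta>)"
      using y p(1) by (simp add: D_def powr_divide field_simps)
    then have "y powr (- \<kappa>) * (1 / b y) \<le> y powr (- \<kappa>) * (D * y powr (\<rho> + \<eta>))"
      by (intro mult_left_mono) auto
    also have "\<dots> = D * y powr (\<rho> + \<eta> - \<kappa>)" by (simp add: powr_add[symmetric] algebra_simps)
    finally show ?thesis by simp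
  qed
  have lim: "((\<lambda>y. D * y powr (\<rho> + \<eta> - \<kappa>)) \<longlongrightarrow> 0) at_top"
    using eta by (intro tendsto_mult_right_zero tendsto_neg_powr) (auto simp: filterlim_ident)
  show ?thesis
  proof (rule tendsto_sandwich[OF _ _ tendsto_const lim])
    show "\<forall>\<^sub>F r in at_top. 0 \<le> r powr (- \<kappa>) / b r"
      by (rule eventually_mono[OF eventually_gt_at_top[of 0]]) (simp add: pos less_imp_le)
    show "\<forall>\<^sub>F r in at_top. r powr (- \<kappa>) / b r \<le> D * r powr (\<rho> + \<eta> - \<kappa>)"
      by (rule eventually_mono[OF eventually_ge_at_top[of r0] bd])
  qed
qed

lemma rv_function_tendsto_0:
  assumes b: "rv_function b \<rho>" and "\<rho> > 0"
  shows "(b \<longlongrightarrow> 0) at_top"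
proof -
  obtain C where C: "C > 0" "\<forall>\<^sub>F r in at_top. b r \<le> C * r powr (- (\<rho> / 2))"
    using rv_function_upper_power[OF b, of "\<rho> / 2"] assms(2) by auto
  have lim: "((\<lambda>y. C * y powr (- (\<rho> / 2))) \<longlongrightarrow> 0) at_top"
    using assms by (intro tendsto_mult_right_zero tendsto_neg_powr) (auto simp: filterlim_ident)
  show ?thesis
  proof (rule tendsto_sandwich[OF _ C(2) tendsto_const lim])
    show "\<forall>\<^sub>F r in at_top. 0 \<le> b r"
      by (rule eventually_mono[OF eventually_gt_at_top[of 0]]) (use b in \<open>simp add: rv_function_def less_imp_le\<close>)
  qed
qed

lemma rv_function_dilation:
  assumes b: "rv_function b \<rho>" and e: "\<epsilon> > 0"
  shows "\<exists>C>0. \<forall>\<^sub>F r in at_top. b (r * \<epsilon>) \<le> C * b r"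
proof (intro exI conjI)
  have "((\<lambda>r. b (r * \<epsilon>) / b r) \<longlongrightarrow> \<epsilon> powr (- \<rho>)) at_top" using b e by (simp add: rv_function_def)
  then have "\<forall>\<^sub>F r in at_top. b (r * \<epsilon>) / b r < \<epsilon> powr (- \<rho>) + 1"
    by (intro order_tendstoD) auto
  then show "\<forall>\<^sub>F r in at_top. b (r * \<epsilon>) \<le> (\<epsilon> powr (- \<rho>) + 1) * b r"
    using eventually_gt_at_top[of 0]
  proof eventually_elim
    case (elim r)
    moreover have "b r > 0" using b elim by (simp add: rv_function_def)
    ultimately show ?case by (simp add: divide_less_eq)
  qed
qed (simp add: add_nonneg_pos)

text \<open>
  Moments of order below the decay rate of the tail exist, by summation over dyadic shells.
\<close>

lemma levy_moment:
  fixes M :: "'a::euclidean_space measure"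
  assumes M: "levy_measure M" and eta: "0 < \<eta>" "\<eta> < \<kappa>" and C: "C \<ge> 0"
    and tail: "\<forall>\<^sub>F r in at_top. measure M {x. norm x > r} \<le> C * r powr (- \<kappa>)"
  shows "integrable M (\<lambda>x. min ((norm x)\<^sup>2) (norm x powr \<eta>))"
proof (rule integrableI_bounded)
  have sM[measurable_cong]: "sets M = sets borel" by (rule sets_levy[OF M])
  show "(\<lambda>x. min ((norm x)\<^sup>2) (norm x powr \<eta>)) \<in> borel_measurable M" by measurable
  let ?q = "2 powr (\<eta> - \<kappa>)"
  have fin: "emeasure M {x::'a. norm x > 2 ^ k} = ennreal (measure M {x. norm x > 2 ^ k})" for k :: nat
    using levy_tail_finite[OF M, of "2 ^ k"] by (intro emeasure_eq_ennreal_measure) auto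
  have two: "filterlim (\<lambda>k::nat. (2::real) ^ k) at_top sequentially"
    by real_asymp
  have ev: "\<forall>\<^sub>F k::nat in sequentially. measure M {x. norm x > 2 ^ k} \<le> C * (2 ^ k) powr (- \<kappa>)"
    by (rule eventually_compose_filterlim[OF tail two])
  have sum: "summable (\<lambda>k::nat. 2 powr (real (Suc k) * \<eta>) * measure M {x. norm x > 2 ^ k})"
  proof (rule summable_comparison_test_ev)
    show "\<forall>\<^sub>F k in sequentially. norm (2 powr (real (Suc k) * \<eta>) * measure M {x. norm x > 2 ^ k}) \<le> C * 2 powr \<eta> * ?q ^ k"
      using ev
    proof eventually_elim
      case (elim k)
      have "2 powr (real (Suc k) * \<eta>) * measure M {x. norm x > 2 ^ k} \<le> 2 powr (real (Suc k) * \<eta>) * (C * (2 ^ k) powr (- \<kappa>))"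
        using elim by (intro mult_left_mono) auto
      also have "\<dots> = C * 2 powr \<eta> * ?q ^ k"
      proof -
        have a1: "?q ^ k = 2 powr ((\<eta> - \<kappa>) * real k)" by (simp add: powr_power mult.commute)
        have a2: "(2 ^ k) powr (- \<kappa>) = 2 powr (real k * (- \<kappa>))"
          unfolding powr_realpow[OF zero_less_numeral, symmetric] powr_powr ..
        have "2 powr (real (Suc k) * \<eta>) * 2 powr (real k * (- \<kappa>)) = 2 powr \<eta> * 2 powr ((\<eta> - \<kappa>) * real k)"
          unfolding powr_add[symmetric] by (simp add: algebra_simps)
        then show ?thesis unfolding a1 a2 by (simp add: mult_ac)
      qed
      finally show ?case by simp
    qed
    show "summable (\<lambda>k. C * 2 powr \<eta> * ?q ^ k)"
      using eta by (intro summable_mult summable_geometric) (auto simp: powr_less_one)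
  qed
  have "(\<integral>\<^sup>+x. ennreal (norm (min ((norm x)\<^sup>2) (norm x powr \<eta>))) \<partial>M) \<le>
     (\<integral>\<^sup>+x. ennreal (min ((norm x)\<^sup>2) 1) + (\<Sum>k::nat. ennreal (2 powr (real (Suc k) * \<eta>)) * indicator {x. norm x > 2 ^ k} x) \<partial>M)"
  proof (intro nn_integral_mono)
    fix x :: 'a
    show "ennreal (norm (min ((norm x)\<^sup>2) (norm x powr \<eta>))) \<le> ennreal (min ((norm x)\<^sup>2) 1) + (\<Sum>k::nat. ennreal (2 powr (real (Suc k) * \<eta>)) * indicator {x. norm x > 2 ^ k} x)"
    proof (cases "norm x \<le> 1")
      case True
      then have "min ((norm x)\<^sup>2) (norm x powr \<eta>) \<le> min ((norm x)\<^sup>2) 1"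
        by (simp add: power_le_one min_le_iff_disj)
      then show ?thesis by (intro add_increasing2) (auto intro!: ennreal_leI)
    next
      case False
      then have n1: "1 < norm x" by simp
      \<comment> \<open>The dyadic shell \<open>2^k < |x| \<le> 2^(k+1)\<close> containing \<open>x\<close>.\<close>
      define k where "k = (LEAST k::nat. norm x \<le> 2 ^ Suc k)"
      have ex: "\<exists>k::nat. norm x \<le> 2 ^ Suc k"
        using ex_dyadic[of "norm x"] n1 by (auto intro: less_imp_le)
      have k1: "norm x \<le> 2 ^ Suc k" unfolding k_def by (rule LeastI_ex[OF ex])
      have k2: "2 ^ k < norm x"
      proof (cases k)
        case (Suc j)
        then have "\<not> norm x \<le> 2 ^ Suc j" using not_less_Least[of j "\<lambda>k. norm x \<le> 2 ^ Suc k"] unfolding k_def by simp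
        then show ?thesis using Suc by simp
      qed (use n1 in simp)
      have "norm (min ((norm x)\<^sup>2) (norm x powr \<eta>)) \<le> norm x powr \<eta>" by simp
      also have "\<dots> \<le> (2 ^ Suc k) powr \<eta>" using k1 eta by (intro powr_mono2) auto
      also have "\<dots> = 2 powr (real (Suc k) * \<eta>)" by (simp add: powr_realpow[symmetric] powr_powr del: power_Suc of_nat_Suc)
      finally have "ennreal (norm (min ((norm x)\<^sup>2) (norm x powr \<eta>))) \<le> ennreal (2 powr (real (Suc k) * \<eta>)) * indicator {x. norm x > 2 ^ k} x"
        using k2 by (simp add: ennreal_leI)
      also have "\<dots> \<le> (\<Sum>k::nat. ennreal (2 powr (real (Suc k) * \<eta>)) * indicator {x. norm x > 2 ^ k} x)"
      proof -
        have "sum f {k} \<le> suminf f" for f :: "nat \<Rightarrow> ennreal" by (rule sum_le_suminf) auto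
        then have "f k \<le> suminf f" for f :: "nat \<Rightarrow> ennreal" by simp
        then show ?thesis .
      qed
      finally show ?thesis by (simp add: add_increasing)
    qed
  qed
  also have "\<dots> = (\<integral>\<^sup>+x. ennreal (min ((norm x)\<^sup>2) 1) \<partial>M) +
      (\<integral>\<^sup>+x. (\<Sum>k::nat. ennreal (2 powr (real (Suc k) * \<eta>)) * indicator {x. norm x > 2 ^ k} x) \<partial>M)"
    by (rule nn_integral_add) measurable
  also have "(\<integral>\<^sup>+x. (\<Sum>k::nat. ennreal (2 powr (real (Suc k) * \<eta>)) * indicator {x. norm x > 2 ^ k} x) \<partial>M) =
     (\<Sum>k::nat. \<integral>\<^sup>+x. ennreal (2 powr (real (Suc k) * \<eta>)) * indicator {x. norm x > 2 ^ k} x \<partial>M)"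
    by (rule nn_integral_suminf) measurable
  also have "\<dots> = (\<Sum>k::nat. ennreal (2 powr (real (Suc k) * \<eta>) * measure M {x. norm x > 2 ^ k}))"
  proof (intro suminf_cong)
    fix k :: nat
    have "{x::'a. norm x > 2 ^ k} \<in> sets M" by measurable
    then show "(\<integral>\<^sup>+x. ennreal (2 powr (real (Suc k) * \<eta>)) * indicator {x. norm x > 2 ^ k} x \<partial>M) =
       ennreal (2 powr (real (Suc k) * \<eta>) * measure M {x. norm x > 2 ^ k})"
      by (subst nn_integral_cmult) (auto simp: fin ennreal_mult simp del: of_nat_Suc)
  qed
  also have "\<dots> = ennreal (\<Sum>k::nat. 2 powr (real (Suc k) * \<eta>) * measure M {x. norm x > 2 ^ k})"
    by (rule suminf_ennreal2[OF _ sum]) auto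
  also have "(\<integral>\<^sup>+x. ennreal (min ((norm x)\<^sup>2) 1) \<partial>M) + \<dots> < \<infinity>"
    using M by (simp add: levy_measure_def)
  finally show "(\<integral>\<^sup>+x. ennreal (norm (min ((norm x)\<^sup>2) (norm x powr \<eta>))) \<partial>M) < \<infinity>" .
qed

section \<open>Asymptotics of the one-big-jump errors\<close>

text \<open>
  On the truncated region, powers of \<open>|x|\<close> exceeding \<open>\<eta>\<close> are traded for powers of \<open>L\<close>.
\<close>

lemma jump_cost_density_moment_bound:
  fixes x :: "'a::euclidean_space"
  assumes s: "s \<ge> 0" and L: "L \<ge> 1" and eta: "0 < \<eta>" "\<eta> \<le> 1"
  shows "jump_cost_density s L x \<le>
     (s\<^sup>2 * exp (s * L) * L powr (2 - \<eta>) + s * L powr (1 - \<eta>)) * min ((norm x)\<^sup>2) (norm x powr \<eta>)"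
proof -
  let ?n = "norm x" and ?m = "min ((norm x)\<^sup>2) (norm x powr \<eta>)"
  have Lp: "1 \<le> L powr (2 - \<eta>)" "1 \<le> L powr (1 - \<eta>)" using L eta by (auto intro: ge_one_powr_ge_zero)
  have m0: "0 \<le> ?m" by simp
  have big: "?m = ?n powr \<eta>" if "1 \<le> ?n"
  proof -
    have "?n powr \<eta> \<le> ?n powr 2" using that eta by (intro powr_mono) auto
    also have "\<dots> = ?n\<^sup>2" using that by (simp add: powr_numeral)
    finally show ?thesis by simp
  qed
  have small: "?m = ?n\<^sup>2" if "?n \<le> 1"
  proof (cases "?n = 0")
    case False
    have "?n powr 2 \<le> ?n powr \<eta>" using that False eta by (intro powr_mono') auto
    then show ?thesis using False by (simp add: powr_numeral)
  qed (use eta in simp)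
  show ?thesis
  proof (cases "?n \<le> L")
    case True
    have 1: "?n\<^sup>2 \<le> L powr (2 - \<eta>) * ?m"
    proof (cases "?n \<le> 1")
      case True
      then show ?thesis unfolding small[OF True] using Lp(1) mult_right_mono[of 1 "L powr (2 - \<eta>)" "?n\<^sup>2"] by simp
    next
      case False
      then have "?n\<^sup>2 = ?n powr (2 - \<eta>) * ?n powr \<eta>" by (simp add: powr_add[symmetric] powr_numeral)
      also have "\<dots> \<le> L powr (2 - \<eta>) * ?n powr \<eta>"
        using False \<open>?n \<le> L\<close> eta by (intro mult_right_mono powr_mono2) auto
      finally show ?thesis using False big by simp
    qed
    have 2: "?n * min (?n\<^sup>2) 1 \<le> L powr (1 - \<eta>) * ?m"
    proof (cases "?n \<le> 1")
      case True
      have "?n * min (?n\<^sup>2) 1 \<le> 1 * ?n\<^sup>2" using True by (intro mult_mono) auto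
      then show ?thesis unfolding small[OF True] using mult_right_mono[OF Lp(2), of "?n\<^sup>2"] by simp
    next
      case False
      have "?n * min (?n\<^sup>2) 1 \<le> ?n * 1" by (intro mult_left_mono) auto
      also have "?n * 1 = ?n powr (1 - \<eta>) * ?n powr \<eta>" using False by (simp add: powr_add[symmetric])
      also have "\<dots> \<le> L powr (1 - \<eta>) * ?n powr \<eta>"
        using False \<open>?n \<le> L\<close> eta by (intro mult_right_mono powr_mono2) auto
      finally show ?thesis using False big by simp
    qed
    have "s\<^sup>2 * exp (s * L) * ?n\<^sup>2 \<le> s\<^sup>2 * exp (s * L) * (L powr (2 - \<eta>) * ?m)"
      using 1 by (intro mult_left_mono) auto
    moreover have "s * (?n * min (?n\<^sup>2) 1) \<le> s * (L powr (1 - \<eta>) * ?m)"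
      using 2 s by (intro mult_left_mono) auto
    ultimately show ?thesis using True by (simp add: jump_cost_density_def distrib_right mult.assoc)
  next
    case False
    then have n1: "1 \<le> ?n" using L by linarith
    then have "1 \<le> ?n powr \<eta>" using eta by (intro ge_one_powr_ge_zero) auto
    then have "1 * 1 \<le> L powr (1 - \<eta>) * ?m" unfolding big[OF n1] using Lp by (intro mult_mono) auto
    then have "s * 1 \<le> s * (L powr (1 - \<eta>) * ?m)" using s by (intro mult_left_mono) auto
    moreover have "0 \<le> s\<^sup>2 * exp (s * L) * L powr (2 - \<eta>) * ?m" by (intro mult_nonneg_nonneg) auto
    moreover have "jump_cost_density s L x = s" using False by (simp add: jump_cost_density_def)
    ultimately show ?thesis unfolding distrib_right mult.assoc by linarith
  qed
qed

text \<open>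
  With \<open>s = \<kappa> log r / r\<close> the Chernoff factor \<open>e\<^bsup>-s \<delta> r / d\<^esup>\<close> is the power \<open>r\<^bsup>-\<kappa> \<delta> / d\<^esup>\<close>, while \<open>e\<^bsup>s \<epsilon> r\<^esup>\<close> is only
  \<open>r\<^bsup>\<kappa> \<epsilon>\<^esup>\<close>. As long as \<open>\<kappa> \<epsilon>\<close> is below the order \<open>\<eta>\<close> of a finite moment, the jump cost tends to \<open>0\<close>. So any
  power of decay is available if the truncation level is a small enough multiple of \<open>r\<close>.
\<close>

lemma ID_error_small:
  fixes M :: "'a::euclidean_space measure"
  assumes M: "levy_measure M" and eta: "0 < \<eta>" "\<eta> \<le> 1"
    and mom: "integrable M (\<lambda>x. min ((norm x)\<^sup>2) (norm x powr \<eta>))"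
    and \<epsilon>: "0 < \<epsilon>" and \<kappa>: "0 < \<kappa>" "\<epsilon> * \<kappa> < \<eta>"
  shows "\<forall>\<^sub>F r in at_top. ID_error M b (\<kappa> * ln r / r) (r * \<epsilon>) (r * \<delta>) \<le>
      2 * real DIM('a) * exp 1 * r powr (- (\<kappa> * \<delta> / real DIM('a)))"
proof -
  define H where "H = (\<integral>x. min ((norm x)\<^sup>2) (norm x powr \<eta>) \<partial>M)"
  let ?s = "\<lambda>r. \<kappa> * ln r / r"
  let ?c = "\<lambda>r. (?s r)\<^sup>2 * exp (?s r * (r * \<epsilon>)) * (r * \<epsilon>) powr (2 - \<eta>) + ?s r * (r * \<epsilon>) powr (1 - \<eta>)"
  have "((\<lambda>r. ?s r * norm b + ?c r * H) \<longlongrightarrow> 0 * norm b + 0 * H) at_top"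
  proof (intro tendsto_intros)
    show "(?s \<longlongrightarrow> 0) at_top" by real_asymp
    have "((\<lambda>r. (\<kappa> * ln r / r)\<^sup>2 * r powr (\<epsilon> * \<kappa>) * (r powr (2 - \<eta>) * \<epsilon> powr (2 - \<eta>)) + \<kappa> * ln r / r * (r powr (1 - \<eta>) * \<epsilon> powr (1 - \<eta>))) \<longlongrightarrow> 0) at_top"
      using eta \<epsilon> \<kappa> by real_asymp
    moreover have "\<forall>\<^sub>F r in at_top. (\<kappa> * ln r / r)\<^sup>2 * r powr (\<epsilon> * \<kappa>) * (r powr (2 - \<eta>) * \<epsilon> powr (2 - \<eta>)) + \<kappa> * ln r / r * (r powr (1 - \<eta>) * \<epsilon> powr (1 - \<eta>)) = ?c r"
      using eventually_gt_at_top[of 0]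
    proof eventually_elim
      case (elim r)
      have "exp (?s r * (r * \<epsilon>)) = r powr (\<epsilon> * \<kappa>)" using elim by (simp add: powr_def mult_ac)
      then show ?case using elim \<epsilon> by (simp add: powr_mult)
    qed
    ultimately show "(?c \<longlongrightarrow> 0) at_top" by (rule Lim_transform_eventually)
  qed
  then have "\<forall>\<^sub>F r in at_top. ?s r * norm b + ?c r * H < 1" by (intro order_tendstoD) auto
  moreover have "\<forall>\<^sub>F r in at_top. r * \<epsilon> \<ge> 1"
    using \<epsilon> by real_asymp
  ultimately show ?thesis using eventually_ge_at_top[of 1]
  proof eventually_elim
    case (elim r)
    have s: "?s r \<ge> 0" using elim \<kappa> by simp
    have L: "r * \<epsilon> > 0" using elim by linarith
    have "jump_cost M (?s r) (r * \<epsilon>) \<le> (\<integral>x. ?c r * min ((norm x)\<^sup>2) (norm x powr \<eta>) \<partial>M)"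
      unfolding jump_cost_def
      by (intro integral_mono integrable_jump_cost_density[OF M s L] integrable_mult_right mom
          jump_cost_density_moment_bound s eta elim)
    also have "\<dots> = ?c r * H" unfolding H_def by (rule integral_mult_right_zero)
    finally have "?s r * norm b + jump_cost M (?s r) (r * \<epsilon>) \<le> 1" using elim by linarith
    then have "ID_error M b (?s r) (r * \<epsilon>) (r * \<delta>) \<le> 2 * real DIM('a) * exp (1 - ?s r * (r * \<delta>) / real DIM('a))"
      unfolding ID_error_def chernoff_def by (intro mult_left_mono) auto
    also have "exp (1 - ?s r * (r * \<delta>) / real DIM('a)) = exp 1 * r powr (- (\<kappa> * \<delta> / real DIM('a)))"
      using elim by (simp add: powr_def exp_diff exp_minus divide_inverse mult_ac)
    finally show ?case by simp
  qed
qed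

text \<open>
  Choose \<open>\<kappa>\<close> so large that the error decays like \<open>r\<^bsup>-\<rho>-1\<^esup>\<close>, hence faster than \<open>f\<close>, and then the
  truncation level small.
\<close>

lemma ID_error_little_o:
  fixes M :: "'a::euclidean_space measure"
  assumes M: "levy_measure M" and b: "rv_function f \<rho>" and rho: "\<rho> > 0" and \<delta>: "\<delta> > 0" and C: "C \<ge> 0"
    and tail: "\<forall>\<^sub>F r in at_top. measure M {x. norm x > r} \<le> C * f r"
  obtains \<kappa> \<epsilon>0 where "\<kappa> > 0" "\<epsilon>0 > 0"
    "\<And>\<epsilon> \<eta>. 0 < \<epsilon> \<Longrightarrow> \<epsilon> < \<epsilon>0 \<Longrightarrow> 0 < \<eta> \<Longrightarrow> \<forall>\<^sub>F r in at_top. ID_error M b (\<kappa> * ln r / r) (r * \<epsilon>) (r * \<delta>) \<le> \<eta> * f r"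
proof -
  define d where "d = real DIM('a)"
  have d: "d > 0" by (simp add: d_def)
  define \<kappa>' where "\<kappa>' = min 1 (\<rho> / 2)"
  have k': "0 < \<kappa>'" "\<kappa>' < \<rho>" "\<kappa>' \<le> 1" using rho by (auto simp: \<kappa>'_def min_def)
  define \<theta> where "\<theta> = \<kappa>' / 2"
  have th: "0 < \<theta>" "\<theta> < \<kappa>'" "\<theta> \<le> 1" using k' by (auto simp: \<theta>_def)
  obtain C1 where C1: "C1 > 0" "\<forall>\<^sub>F r in at_top. f r \<le> C1 * r powr (- \<kappa>')"
    using rv_function_upper_power[OF b k'(1,2)] by blast
  have "\<forall>\<^sub>F r in at_top. measure M {x. norm x > r} \<le> (C * C1) * r powr (- \<kappa>')"
    using tail C1(2)
  proof eventually_elim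
    case (elim r)
    then show ?case using mult_left_mono[of "f r" "C1 * r powr (- \<kappa>')" C] C by (simp add: mult.assoc)
  qed
  then have mom: "integrable M (\<lambda>x. min ((norm x)\<^sup>2) (norm x powr \<theta>))"
    using C C1 by (intro levy_moment[OF M th(1,2), of "C * C1"]) auto
  define \<kappa> where "\<kappa> = d * (\<rho> + 1) / \<delta>"
  have k: "\<kappa> > 0" "\<kappa> * \<delta> / d = \<rho> + 1" using d rho \<delta> by (auto simp: \<kappa>_def)
  show thesis
  proof (rule that[of \<kappa> "\<theta> / \<kappa>"])
    fix \<epsilon> \<eta> :: real assume e: "0 < \<epsilon>" "\<epsilon> < \<theta> / \<kappa>" and eta: "0 < \<eta>"
    have ek: "\<epsilon> * \<kappa> < \<theta>" using e k by (simp add: less_divide_eq)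
    let ?K = "2 * d * exp 1"
    have 1: "\<forall>\<^sub>F r in at_top. ID_error M b (\<kappa> * ln r / r) (r * \<epsilon>) (r * \<delta>) \<le> ?K * r powr (- (\<rho> + 1))"
      using ID_error_small[OF M th(1,3) mom e(1) k(1) ek, of b \<delta>] k(2) by (simp add: d_def)
    have "((\<lambda>r. r powr (- (\<rho> + 1)) / f r) \<longlongrightarrow> 0) at_top"
      by (rule rv_function_lower_power[OF b rho]) simp
    then have "\<forall>\<^sub>F r in at_top. r powr (- (\<rho> + 1)) / f r < \<eta> / ?K"
      using eta d by (intro order_tendstoD) auto
    with 1 show "\<forall>\<^sub>F r in at_top. ID_error M b (\<kappa> * ln r / r) (r * \<epsilon>) (r * \<delta>) \<le> \<eta> * f r"
      using eventually_gt_at_top[of 0]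
    proof eventually_elim
      case (elim r)
      have fr: "f r > 0" using b elim by (simp add: rv_function_def)
      then have "r powr (- (\<rho> + 1)) < \<eta> / ?K * f r" using elim by (simp add: divide_less_eq)
      then have "?K * r powr (- (\<rho> + 1)) \<le> ?K * (\<eta> / ?K * f r)" using d by (intro mult_left_mono) auto
      also have "\<dots> = \<eta> * f r" using d by simp
      finally show ?case using elim by linarith
    qed
  qed (use k th in auto)
qed

lemma levy_tail_tendsto_0:
  fixes M :: "'a::euclidean_space measure"
  assumes M: "levy_measure M"
  shows "((\<lambda>r. measure M {x. norm x > r}) \<longlongrightarrow> 0) at_top"
proof (rule decreasing_tendsto)
  have sM: "sets M = sets borel" by (rule sets_levy[OF M])
  have m: "{x::'a. norm x > r} \<in> sets M" for r unfolding sM by measurable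
  fix e :: real assume e: "0 < e"
  have "(\<lambda>n. measure M {x. norm x > real (Suc n)}) \<longlonglongrightarrow> measure M (\<Inter>n. {x::'a. norm x > real (Suc n)})"
  proof (rule Lim_measure_decseq)
    show "emeasure M {x. norm x > real (Suc n)} \<noteq> \<infinity>" for n
      using levy_tail_finite[OF M, of "real (Suc n)"] by auto
  qed (auto simp: decseq_def m)
  moreover have "(\<Inter>n. {x::'a. norm x > real (Suc n)}) = {}"
  proof -
    have "\<exists>n. \<not> norm x > real (Suc n)" for x :: 'a
      using reals_Archimedean2[of "norm x"] by (metis less_SucI less_not_sym less_trans of_nat_less_iff lessI)
    then show ?thesis by auto
  qed
  ultimately have "\<forall>\<^sub>F n in sequentially. measure M {x. norm x > real (Suc n)} < e"
    using e by (intro order_tendstoD) auto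
  then obtain n where n: "measure M {x. norm x > real (Suc n)} < e" using eventually_happens by force
  show "\<forall>\<^sub>F r in at_top. measure M {x. norm x > r} < e"
    using eventually_ge_at_top[of "real (Suc n)"]
  proof eventually_elim
    case (elim r)
    have "measure M {x. norm x > r} \<le> measure M {x. norm x > real (Suc n)}"
      using elim levy_tail_finite[OF M, of "real (Suc n)"]
      by (intro measure_mono_fmeasurable) (auto simp: fmeasurable_def m)
    then show ?case using n by linarith
  qed
qed simp

text \<open>
  With an exponential rate inversely proportional to the truncation level, a multiple of
  \<open>min (|x|\<^sup>2) 1\<close> dominates the cost density.
\<close>

lemma jump_cost_tendsto_0:
  fixes M :: "'a::euclidean_space measure"
  assumes M: "levy_measure M" and K: "K \<ge> 0" and X: "filterlim X at_top sequentially"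
  shows "(\<lambda>n. jump_cost M (K / X n) (X n)) \<longlonglongrightarrow> 0"
proof -
  have sM[measurable_cong]: "sets M = sets borel" by (rule sets_levy[OF M])
  let ?C = "K\<^sup>2 * exp K + 2 * K"
  let ?Y = "\<lambda>n. max 1 (X n)"
  have bd: "jump_cost_density (K / y) y x \<le> ?C * min ((norm x)\<^sup>2) 1" if y: "y \<ge> 1" for y :: real and x :: 'a
  proof -
    let ?m = "min ((norm x)\<^sup>2) 1"
    have m0: "0 \<le> ?m" by simp
    have p: "0 \<le> K\<^sup>2 * exp K * ?m" "0 \<le> K * ?m" using K m0 by (auto intro!: mult_nonneg_nonneg)
    show ?thesis
    proof (cases "norm x \<le> y")
      case True
      have "(norm x / y)\<^sup>2 \<le> ?m"
      proof -
        have "norm x / y \<le> 1" "norm x / y \<le> norm x" using True y by (auto simp: divide_le_eq mult_le_cancel_left1)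
        then have "(norm x / y)\<^sup>2 \<le> 1\<^sup>2" "(norm x / y)\<^sup>2 \<le> (norm x)\<^sup>2" using y by (intro power_mono; simp)+
        then show ?thesis by simp
      qed
      then have "K\<^sup>2 * exp K * (norm x / y)\<^sup>2 \<le> K\<^sup>2 * exp K * ?m" by (intro mult_left_mono) auto
      moreover have "K / y * norm x * ?m \<le> K * ?m"
        using True y K by (intro mult_right_mono) (auto simp: divide_le_eq mult_left_mono)
      ultimately show ?thesis using True y p
        by (simp add: jump_cost_density_def power_divide distrib_right)
    next
      case False
      then have "1 \<le> norm x" using y by linarith
      then have "?m = 1" by simp
      moreover have "K / y \<le> K" using y K by (simp add: divide_le_eq mult_le_cancel_left1)
      moreover have "K \<le> ?C * 1" using K mult_nonneg_nonneg[of "K\<^sup>2" "exp K"] by simp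
      moreover have "jump_cost_density (K / y) y x = K / y"
        using False by (simp add: jump_cost_density_def)
      ultimately show ?thesis by (simp only:)
    qed
  qed
  have "(\<lambda>n. \<integral>x. jump_cost_density (K / ?Y n) (?Y n) x \<partial>M) \<longlonglongrightarrow> (\<integral>x. 0 \<partial>M)"
  proof (rule integral_dominated_convergence[where w="\<lambda>x. ?C * min ((norm x)\<^sup>2) 1"])
    show "integrable M (\<lambda>x. ?C * min ((norm x)\<^sup>2) 1)"
      using K by (intro levy_integrable[OF M, where C="?C"]) (auto simp: abs_mult)
    show "AE x in M. norm (jump_cost_density (K / ?Y n) (?Y n) x) \<le> ?C * min ((norm x)\<^sup>2) 1" for n
    proof (rule AE_I2)
      fix x :: 'a
      have "0 \<le> jump_cost_density (K / ?Y n) (?Y n) x" by (rule jump_cost_density_nonneg) (use K in auto)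
      then show "norm (jump_cost_density (K / ?Y n) (?Y n) x) \<le> ?C * min ((norm x)\<^sup>2) 1"
        using bd[of "?Y n" x] by simp
    qed
    show "AE x in M. (\<lambda>n. jump_cost_density (K / ?Y n) (?Y n) x) \<longlonglongrightarrow> 0"
    proof (rule AE_I2)
      fix x :: 'a
      let ?g = "\<lambda>y::real. K\<^sup>2 * exp K * (norm x)\<^sup>2 / y\<^sup>2 + K * norm x * min ((norm x)\<^sup>2) 1 / y"
      have "(?g \<longlongrightarrow> 0) at_top" by real_asymp
      then have "(\<lambda>n. ?g (X n)) \<longlonglongrightarrow> 0" using X by (rule filterlim_compose)
      moreover have "\<forall>\<^sub>F n in sequentially. ?g (X n) = jump_cost_density (K / ?Y n) (?Y n) x"
        using filterlim_at_top[THEN iffD1, OF X, rule_format, of "max 1 (norm x)"]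
        by eventually_elim (auto simp: jump_cost_density_def power_divide)
      ultimately show "(\<lambda>n. jump_cost_density (K / ?Y n) (?Y n) x) \<longlonglongrightarrow> 0"
        by (rule Lim_transform_eventually)
    qed
  qed measurable
  then have 1: "(\<lambda>n. jump_cost M (K / ?Y n) (?Y n)) \<longlonglongrightarrow> 0" by (simp add: jump_cost_def)
  have "\<forall>\<^sub>F n in sequentially. jump_cost M (K / ?Y n) (?Y n) = jump_cost M (K / X n) (X n)"
    using filterlim_at_top[THEN iffD1, OF X, rule_format, of 1]
    by eventually_elim (simp add: max_absorb2)
  with 1 show ?thesis by (rule Lim_transform_eventually)
qed

text \<open>
  The bound \<open>M(|x| > r) \<le> \<mu>(|x| > r/2) + 2E M(|x| > r) + M(|x| > r)\<^sup>2\<close> with \<open>E \<le> 1/4\<close> and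
  \<open>M(|x| > r) \<le> 1/4\<close> can be solved for \<open>M(|x| > r)\<close>. This a priori estimate allows \<open>\<mu>\<close> to serve as the
  normaliser when \<open>\<mu>\<close> is the measure assumed regularly varying.
\<close>

lemma levy_tail_le_law_tail:
  fixes M \<mu> :: "'a::euclidean_space measure"
  assumes ID: "is_ID M b \<mu>"
  shows "\<forall>\<^sub>F r in at_top. measure M {x. norm x > r} \<le> 4 * measure \<mu> {x. norm x > r / 2}"
proof -
  have M: "levy_measure M" and mu: "prob_space \<mu>" "sets \<mu> = sets borel"
    using ID by (auto simp: is_ID_def)
  interpret mu: prob_space \<mu> by fact
  define d where "d = real DIM('a)"
  have d: "d > 0" by (simp add: d_def)
  \<comment> \<open>The rate is \<open>K / r\<close> and the thickening radius \<open>r / 4\<close>; the summand \<open>1\<close> leaves room for the drift and the jump cost.\<close>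
  have "((\<lambda>K. 2 * d * exp (1 - K / (4 * d))) \<longlongrightarrow> 0) at_top" using d by real_asymp
  then have "\<forall>\<^sub>F K in at_top. 2 * d * exp (1 - K / (4 * d)) < 1 / 4" by (intro order_tendstoD) auto
  then obtain K where K: "K \<ge> 0" "2 * d * exp (1 - K / (4 * d)) < 1 / 4"
    using eventually_happens[OF eventually_conj[OF _ eventually_ge_at_top[of 0]]] by force
  have "((\<lambda>r. jump_cost M (K / r) r) \<longlongrightarrow> 0) at_top"
    by (rule tendsto_at_topI_sequentially) (rule jump_cost_tendsto_0[OF M K(1)])
  moreover have "((\<lambda>r. K / r * norm b) \<longlongrightarrow> 0) at_top" by real_asymp
  ultimately have "((\<lambda>r. K / r * norm b + jump_cost M (K / r) r) \<longlongrightarrow> 0 + 0) at_top" by (intro tendsto_add)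
  then have "\<forall>\<^sub>F r in at_top. K / r * norm b + jump_cost M (K / r) r < 1" by (intro order_tendstoD) auto
  moreover have "\<forall>\<^sub>F r in at_top. measure M {x. norm x > r} < 1 / 4"
    using levy_tail_tendsto_0[OF M] by (intro order_tendstoD) auto
  ultimately show ?thesis using eventually_gt_at_top[of 0]
  proof eventually_elim
    case (elim r)
    let ?G = "{x::'a. norm x > r}"
    have r: "r > 0" by fact
    have err: "ID_error M b (K / r) r (r / 4) \<le> 1 / 4"
    proof -
      have "ID_error M b (K / r) r (r / 4) \<le> 2 * d * exp (1 - K / (4 * d))"
        unfolding ID_error_def chernoff_def d_def[symmetric] using elim d
        by (intro mult_left_mono) auto
      then show ?thesis using K(2) by linarith
    qed
    have "measure M ?G \<le> measure \<mu> (thickening (2 * (r / 4)) ?G) + 2 * ID_error M b (K / r) r (r / 4) * measure M ?G + (measure M ?G)\<^sup>2"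
      using r K by (intro ID_tail_lower[OF ID]) auto
    also have "measure \<mu> (thickening (2 * (r / 4)) ?G) \<le> measure \<mu> {x. norm x > r / 2}"
    proof (rule mu.finite_measure_mono)
      show "thickening (2 * (r / 4)) ?G \<subseteq> {x. norm x > r / 2}"
      proof
        fix x assume "x \<in> thickening (2 * (r / 4)) ?G"
        then obtain y where y: "norm y > r" "dist x y < r / 2" by (auto simp: thickening_def)
        have "norm y \<le> norm x + dist x y" using norm_triangle_ineq2[of y x] by (simp add: dist_norm norm_minus_commute)
        then show "x \<in> {x. norm x > r / 2}" using y by simp
      qed
      show "{x. norm x > r / 2} \<in> sets \<mu>" unfolding mu(2) by measurable
    qed
    also have "2 * ID_error M b (K / r) r (r / 4) * measure M ?G \<le> 1 / 2 * measure M ?G"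
      using err by (intro mult_right_mono) auto
    also have "(measure M ?G)\<^sup>2 \<le> 1 / 4 * measure M ?G"
      unfolding power2_eq_square using elim by (intro mult_right_mono) auto
    finally show ?case by simp
  qed
qed

section \<open>The one-big-jump principle in sets of directions\<close>

lemma directional_tail_borel:
  assumes [measurable]: "D \<in> sets borel"
  shows "directional_tail r (D :: 'a::euclidean_space set) \<in> sets borel"
  unfolding directional_tail_def by measurable

lemma directional_tail_sphere:
  assumes "r \<ge> 0"
  shows "directional_tail r (sphere 0 1) = {x::'a::euclidean_space. norm x > r}"
proof -
  have "x /\<^sub>R norm x \<in> sphere 0 1" if "norm x > r" for x :: 'a
  proof -
    have "norm x \<noteq> 0" using that assms by linarith
    then show ?thesis by simp
  qed
  then show ?thesis unfolding directional_tail_def by blast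
qed

lemma directional_tail_subset: "directional_tail r D \<subseteq> {x. norm x > r}"
  by (auto simp: directional_tail_def)

text \<open>
  Moving a point of norm at least \<open>u\<close> by less than \<open>u \<delta> / 4\<close> moves its direction by less than
  \<open>\<delta> / 2\<close>.
\<close>

lemma thickening_directional_tail:
  fixes D :: "'a::euclidean_space set"
  assumes u: "u > 0" and \<delta>: "0 < \<delta>" "\<delta> < 1" and D: "D \<subseteq> sphere 0 1"
  shows "thickening (u * \<delta> / 4) (directional_tail u D) \<subseteq>
     directional_tail (u * (1 - \<delta>)) (thickening \<delta> D \<inter> sphere 0 1)"
proof
  fix x assume "x \<in> thickening (u * \<delta> / 4) (directional_tail u D)"
  then obtain y where y: "norm y > u" "y /\<^sub>R norm y \<in> D" "norm (x - y) < u * \<delta> / 4"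
    by (auto simp: thickening_def directional_tail_def dist_norm)
  have "norm y \<le> norm x + norm (x - y)" using norm_triangle_ineq2[of y x] by (simp add: norm_minus_commute)
  moreover have "u * \<delta> / 4 < u * \<delta>" using u \<delta> by simp
  ultimately have x: "norm x > u * (1 - \<delta>)" using y(1,3) unfolding right_diff_distrib by linarith
  have "0 < u * (1 - \<delta>)" using u \<delta> by simp
  then have x0: "norm x > 0" using x by linarith
  have y0: "norm y > 0" using y(1) u by linarith
  have "norm (x /\<^sub>R norm x - y /\<^sub>R norm y) \<le> norm (x /\<^sub>R norm x - x /\<^sub>R norm y) + norm (x /\<^sub>R norm y - y /\<^sub>R norm y)"
    using norm_triangle_ineq[of "x /\<^sub>R norm x - x /\<^sub>R norm y" "x /\<^sub>R norm y - y /\<^sub>R norm y"] by simp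
  also have "norm (x /\<^sub>R norm x - x /\<^sub>R norm y) = \<bar>norm y - norm x\<bar> / norm y"
  proof -
    have "x /\<^sub>R norm x - x /\<^sub>R norm y = ((norm y - norm x) / (norm x * norm y)) *\<^sub>R x"
      using x0 y0 by (simp add: scaleR_diff_left[symmetric] field_simps)
    then show ?thesis using x0 y0 by (simp add: abs_mult)
  qed
  also have "norm (x /\<^sub>R norm y - y /\<^sub>R norm y) = norm (x - y) / norm y"
  proof -
    have "x /\<^sub>R norm y - y /\<^sub>R norm y = (x - y) /\<^sub>R norm y" by (simp add: scaleR_diff_right)
    then show ?thesis using y0 by (simp add: divide_inverse mult.commute)
  qed
  also have "\<bar>norm y - norm x\<bar> / norm y + norm (x - y) / norm y \<le> 2 * norm (x - y) / norm y"
    using norm_triangle_ineq3[of y x] y0 by (simp add: norm_minus_commute add_divide_distrib[symmetric] divide_right_mono)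
  also have "\<dots> < \<delta>"
  proof -
    have "0 < u * \<delta>" using u \<delta> by simp
    then have "2 * norm (x - y) < u * \<delta>" using y(3) by linarith
    also have "\<dots> < norm y * \<delta>" using y(1) \<delta> by simp
    finally show ?thesis using y0 by (simp add: divide_less_eq mult.commute)
  qed
  finally have "x /\<^sub>R norm x \<in> thickening \<delta> D"
    using y(2) by (auto simp: thickening_def dist_norm)
  moreover have "x /\<^sub>R norm x \<in> sphere 0 1" using x0 by simp
  ultimately show "x \<in> directional_tail (u * (1 - \<delta>)) (thickening \<delta> D \<inter> sphere 0 1)"
    using x by (simp add: directional_tail_def)
qed

text \<open>
  Both error terms of the one-big-jump bounds are \<open>o(f(r))\<close>: the tail at \<open>\<epsilon> r\<close> is of order \<open>f(r)\<close>, so its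
  square is of order \<open>f(r)\<^sup>2\<close>, and the Chernoff term is handled by \<open>ID_error_little_o\<close>.
\<close>

lemma one_big_jump_asymptotics:
  fixes M \<mu> :: "'a::euclidean_space measure"
  assumes ID: "is_ID M b \<mu>" and f: "rv_function f \<rho>" and rho: "\<rho> > 0"
    and C: "C \<ge> 0" and tail: "\<forall>\<^sub>F r in at_top. measure M {x. norm x > r} \<le> C * f r"
    and t: "t > 0" and \<delta>: "0 < \<delta>" "\<delta> < 1" and D: "D \<in> sets borel" "D \<subseteq> sphere 0 1" and eta: "\<eta> > 0"
  shows "\<forall>\<^sub>F r in at_top. measure \<mu> (directional_tail (r * t) D) \<le>
      measure M (directional_tail (r * t * (1 - \<delta>)) (thickening \<delta> D \<inter> sphere 0 1)) + \<eta> * f r"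
    and "\<forall>\<^sub>F r in at_top. measure M (directional_tail (r * t) D) \<le>
      measure \<mu> (directional_tail (r * t * (1 - \<delta>)) (thickening \<delta> D \<inter> sphere 0 1)) + \<eta> * f r"
proof -
  have M: "levy_measure M" and mu: "prob_space \<mu>" "sets \<mu> = sets borel"
    using ID by (auto simp: is_ID_def)
  interpret mu: prob_space \<mu> by fact
  have sM: "sets M = sets borel" by (rule sets_levy[OF M])
  have S: "sphere 0 1 \<in> sets (borel :: 'a measure)" by simp
  define D' where "D' = thickening \<delta> D \<inter> sphere 0 1"
  have D': "D' \<in> sets borel" unfolding D'_def by measurable
  obtain \<kappa> \<epsilon>0 where k: "\<kappa> > 0" "\<epsilon>0 > 0"
    "\<And>\<epsilon> \<eta>. 0 < \<epsilon> \<Longrightarrow> \<epsilon> < \<epsilon>0 \<Longrightarrow> 0 < \<eta> \<Longrightarrow>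
       \<forall>\<^sub>F r in at_top. ID_error M b (\<kappa> * ln r / r) (r * \<epsilon>) (r * (t * \<delta> / 8)) \<le> \<eta> * f r"
    by (rule ID_error_little_o[OF M f rho _ C tail, of "t * \<delta> / 8" b]) (use t \<delta> in auto)
  \<comment> \<open>\<open>\<epsilon> \<le> t\<close> makes every point of the tail at level \<open>r t\<close> a big jump for the truncation level \<open>r \<epsilon>\<close>.\<close>
  define \<epsilon> where "\<epsilon> = min t (\<epsilon>0 / 2)"
  have e: "0 < \<epsilon>" "\<epsilon> < \<epsilon>0" "\<epsilon> \<le> t" using k t by (auto simp: \<epsilon>_def min_def)
  obtain C2 where C2: "C2 > 0" "\<forall>\<^sub>F r in at_top. f (r * \<epsilon>) \<le> C2 * f r"
    using rv_function_dilation[OF f e(1)] by blast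
  have f0: "(f \<longlongrightarrow> 0) at_top" by (rule rv_function_tendsto_0[OF f rho])
  define K where "K = C * C2"
  have K0: "K \<ge> 0" using C C2 by (simp add: K_def)
  have te: "\<forall>\<^sub>F r in at_top. measure M {x. norm x > r * \<epsilon>} \<le> C * f (r * \<epsilon>)"
  proof (rule eventually_compose_filterlim[OF tail])
    show "filterlim (\<lambda>r. r * \<epsilon>) at_top at_top" using e by real_asymp
  qed
  have tailK: "\<forall>\<^sub>F r in at_top. measure M {x. norm x > r * \<epsilon>} \<le> K * f r"
    using te C2(2)
  proof eventually_elim
    case (elim r)
    have "C * f (r * \<epsilon>) \<le> C * (C2 * f r)" using elim C by (intro mult_left_mono) auto
    then show ?case using elim by (simp add: K_def mult.assoc)
  qed
  have "((\<lambda>r. K * K * f r) \<longlongrightarrow> K * K * 0) at_top" by (intro tendsto_intros f0)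
  then have "\<forall>\<^sub>F r in at_top. K * K * f r < \<eta> / 2" using eta by (intro order_tendstoD) auto
  with tailK have sq: "\<forall>\<^sub>F r in at_top. (measure M {x. norm x > r * \<epsilon>})\<^sup>2 \<le> \<eta> / 2 * f r"
    using eventually_gt_at_top[of 0]
  proof eventually_elim
    case (elim r)
    have fr: "f r > 0" using f elim by (simp add: rv_function_def)
    have "(measure M {x. norm x > r * \<epsilon>})\<^sup>2 \<le> (K * f r)\<^sup>2" using elim by (intro power_mono) auto
    also have "\<dots> = (K * K * f r) * f r" by (simp add: power2_eq_square)
    also have "\<dots> \<le> \<eta> / 2 * f r" using elim fr by (intro mult_right_mono) auto
    finally show ?case .
  qed
  \<comment> \<open>One \<open>\<eta>'\<close> for both directions; in the lower bound the error is multiplied by \<open>2 M(B)\<close>, at most \<open>2 K f(r)\<close>.\<close>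
  define \<eta>' where "\<eta>' = \<eta> / (2 + 4 * K)"
  have eta': "\<eta>' > 0" "\<eta>' \<le> \<eta> / 2" "2 * \<eta>' * K \<le> \<eta> / 2"
    using eta K0 by (auto simp: \<eta>'_def field_simps)
  have err: "\<forall>\<^sub>F r in at_top. ID_error M b (\<kappa> * ln r / r) (r * \<epsilon>) (r * (t * \<delta> / 8)) \<le> \<eta>' * f r"
    by (rule k(3)[OF e(1,2) eta'(1)])
  have f1: "\<forall>\<^sub>F r in at_top. f r < 1" using f0 by (intro order_tendstoD) auto
  have th: "thickening (2 * (r * (t * \<delta> / 8))) (directional_tail (r * t) D) \<subseteq> directional_tail (r * t * (1 - \<delta>)) D'" if "r > 0" for r
    using thickening_directional_tail[of "r * t" \<delta> D] that t \<delta> D(2) by (simp add: D'_def mult_ac)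
  show "\<forall>\<^sub>F r in at_top. measure \<mu> (directional_tail (r * t) D) \<le>
      measure M (directional_tail (r * t * (1 - \<delta>)) (thickening \<delta> D \<inter> sphere 0 1)) + \<eta> * f r"
    using err sq eventually_ge_at_top[of 1]
  proof eventually_elim
    case (elim r)
    have r: "r > 0" "\<kappa> * ln r / r \<ge> 0" using elim k by auto
    have fr: "f r > 0" using f r by (simp add: rv_function_def)
    have "measure \<mu> (directional_tail (r * t) D) \<le>
        measure M (thickening (2 * (r * (t * \<delta> / 8))) (directional_tail (r * t) D) \<inter> {x. norm x > r * \<epsilon>}) +
        ID_error M b (\<kappa> * ln r / r) (r * \<epsilon>) (r * (t * \<delta> / 8)) + (measure M {x. norm x > r * \<epsilon>})\<^sup>2"
    proof (rule ID_tail_upper[OF ID _ r(2)])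
      show "directional_tail (r * t) D \<in> sets borel" by (rule directional_tail_borel[OF D(1)])
      fix x assume "x \<in> directional_tail (r * t) D"
      then have "norm x > r * t" by (simp add: directional_tail_def)
      moreover have "r * t * (\<delta> / 4) \<le> r * t * 1" using r t \<delta> by (intro mult_left_mono) auto
      moreover have "r * t * (\<delta> / 4) = 2 * (r * (t * \<delta> / 8))" by simp
      ultimately show "norm x \<ge> 2 * (r * (t * \<delta> / 8))" by linarith
    qed (use r e t \<delta> in auto)
    also have "measure M (thickening (2 * (r * (t * \<delta> / 8))) (directional_tail (r * t) D) \<inter> {x. norm x > r * \<epsilon>})
        \<le> measure M (directional_tail (r * t * (1 - \<delta>)) D')"
    proof (rule measure_mono_fmeasurable)
      have pos: "r * t * (1 - \<delta>) > 0" using r t \<delta> by simp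
      have "emeasure M (directional_tail (r * t * (1 - \<delta>)) D') \<le> emeasure M {x. norm x > r * t * (1 - \<delta>)}"
        by (intro emeasure_mono directional_tail_subset) (simp add: sM)
      also have "\<dots> < \<infinity>" by (rule levy_tail_finite[OF M pos])
      finally show "directional_tail (r * t * (1 - \<delta>)) D' \<in> fmeasurable M"
        using directional_tail_borel[OF D'] by (simp add: fmeasurable_def sM)
    qed (use th[OF r(1)] in \<open>auto simp: sM\<close>)
    also have "ID_error M b (\<kappa> * ln r / r) (r * \<epsilon>) (r * (t * \<delta> / 8)) \<le> \<eta> / 2 * f r"
      using elim(1) mult_right_mono[OF eta'(2), of "f r"] fr by linarith
    also note elim(2)
    finally show ?case by (simp add: D'_def)
  qed
  show "\<forall>\<^sub>F r in at_top. measure M (directional_tail (r * t) D) \<le>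
      measure \<mu> (directional_tail (r * t * (1 - \<delta>)) (thickening \<delta> D \<inter> sphere 0 1)) + \<eta> * f r"
    using err sq tailK f1 eventually_ge_at_top[of 1]
  proof eventually_elim
    case (elim r)
    have r: "r > 0" "\<kappa> * ln r / r \<ge> 0" using elim k by auto
    have fr: "f r > 0" using f r by (simp add: rv_function_def)
    let ?B = "directional_tail (r * t) D"
    let ?err = "ID_error M b (\<kappa> * ln r / r) (r * \<epsilon>) (r * (t * \<delta> / 8))"
    have B: "?B \<in> sets borel" by (rule directional_tail_borel[OF D(1)])
    have BL: "norm x > r * \<epsilon>" if "x \<in> ?B" for x
    proof -
      have "r * \<epsilon> \<le> r * t" using r e by (intro mult_left_mono) auto
      then show ?thesis using that by (simp add: directional_tail_def)
    qed
    have "measure M ?B \<le> measure \<mu> (thickening (2 * (r * (t * \<delta> / 8))) ?B) + 2 * ?err * measure M ?B + (measure M {x. norm x > r * \<epsilon>})\<^sup>2"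
      by (rule ID_tail_lower[OF ID _ r(2) _ B BL]) (use r e t \<delta> in auto)
    also have "measure \<mu> (thickening (2 * (r * (t * \<delta> / 8))) ?B) \<le> measure \<mu> (directional_tail (r * t * (1 - \<delta>)) D')"
      using th[OF r(1)] directional_tail_borel[OF D'] mu(2) by (intro mu.finite_measure_mono) auto
    also have "2 * ?err * measure M ?B \<le> \<eta> / 2 * f r"
    proof -
      have "measure M ?B \<le> measure M {x. norm x > r * \<epsilon>}"
        using BL B levy_tail_finite[OF M, of "r * \<epsilon>"] r e
        by (intro measure_mono_fmeasurable) (auto simp: sM fmeasurable_def)
      then have mB: "measure M ?B \<le> K * f r" using elim by linarith
      have "?err \<le> \<eta>' * 1" using elim(1) eta'(1) elim(4) mult_left_mono[of "f r" 1 \<eta>'] by linarith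
      then have "2 * ?err * measure M ?B \<le> 2 * \<eta>' * (K * f r)"
        using mB eta'(1) by (intro mult_mono) (auto simp: ID_error_def chernoff_def)
      also have "\<dots> \<le> \<eta> / 2 * f r" using mult_right_mono[OF eta'(3), of "f r"] fr by (simp add: mult_ac)
      finally show ?thesis .
    qed
    also note elim(2)
    finally show ?case by (simp add: D'_def)
  qed
qed

section \<open>Transfer of regular variation\<close>

lemma thickening_mono: "c \<le> d \<Longrightarrow> thickening c A \<subseteq> thickening d A"
  by (force simp: thickening_def)

lemma subset_thickening: "0 < d \<Longrightarrow> A \<subseteq> thickening d A"
  by (auto simp: thickening_def intro!: bexI)

context
  fixes \<sigma> :: "'a::euclidean_space measure"
  assumes fin: "finite_measure \<sigma>" and sets: "sets \<sigma> = sets borel_sphere"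
begin

interpretation finite_measure \<sigma> by (rule fin)

lemma space_sphere: "space \<sigma> = sphere 0 1"
  using sets_eq_imp_space_eq[OF sets] by (simp add: space_restrict_space)

lemma sphere_setI: "A \<in> sets borel \<Longrightarrow> A \<subseteq> sphere 0 1 \<Longrightarrow> A \<in> sets \<sigma>"
  unfolding sets by (auto simp: sets_restrict_space image_iff intro!: bexI[of _ A])

lemma continuity_set_borel:
  assumes "continuity_set \<sigma> D"
  shows "D \<in> sets borel" "D \<subseteq> sphere 0 1" "D \<in> sets \<sigma>"
proof -
  have "D \<in> sets borel_sphere" using assms by (simp add: continuity_set_def)
  then obtain B where "B \<in> sets borel" "D = sphere 0 1 \<inter> B" by (auto simp: sets_restrict_space)
  then show "D \<in> sets borel" "D \<subseteq> sphere 0 1" by auto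
  show "D \<in> sets \<sigma>" using \<open>D \<in> sets borel_sphere\<close> sets by simp
qed

lemma continuity_set_sphere: "continuity_set \<sigma> (sphere 0 1)"
proof -
  have "sphere 0 1 \<in> sets borel_sphere" by (simp add: sets_restrict_space_iff)
  then show ?thesis
    using frontier_of_topspace[of "top_of_set (sphere (0::'a) 1)"] by (simp add: continuity_set_def)
qed

lemma continuity_set_Compl:
  assumes "continuity_set \<sigma> D"
  shows "continuity_set \<sigma> (sphere 0 1 - D)"
proof -
  have D: "D \<in> sets borel_sphere" using assms by (simp add: continuity_set_def)
  then have "space borel_sphere - D \<in> sets borel_sphere" by (rule sets.compl_sets)
  then have "sphere 0 1 - D \<in> sets borel_sphere" by (simp add: space_restrict_space)
  moreover have "top_of_set (sphere 0 1) frontier_of (sphere 0 1 - D) = top_of_set (sphere 0 1) frontier_of D"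
    using frontier_of_complement[of "top_of_set (sphere 0 1)" D] by simp
  ultimately show ?thesis using assms by (simp add: continuity_set_def)
qed

lemma measure_Compl_sphere:
  assumes "D \<in> sets \<sigma>"
  shows "measure \<sigma> (sphere 0 1 - D) = measure \<sigma> (sphere 0 1) - measure \<sigma> D"
  using finite_measure_compl[OF assms] by (simp add: space_sphere)

lemma thickening_eq_infdist:
  fixes D :: "'a set"
  assumes "D \<noteq> {}"
  shows "thickening \<delta> D = {y. infdist y D < \<delta>}"
proof -
  have "infdist y D < \<delta> \<longleftrightarrow> (\<exists>z\<in>D. dist y z < \<delta>)" for y
    using assms unfolding infdist_def by (simp add: cINF_less_iff)
  then show ?thesis by (simp add: thickening_def)
qed

lemma frontier_sphere_thickening:
  fixes D :: "'a set"
  assumes "D \<noteq> {}"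
  shows "top_of_set (sphere 0 1) frontier_of (thickening \<delta> D \<inter> sphere 0 1) \<subseteq> {y \<in> sphere 0 1. infdist y D = \<delta>}"
proof -
  let ?X = "top_of_set (sphere (0::'a) 1)" and ?T = "thickening \<delta> D \<inter> sphere 0 1"
  have op: "openin ?X ?T" by (auto simp: openin_open Int_commute intro!: exI[of _ "thickening \<delta> D"] open_thickening)
  have cl: "closedin ?X (sphere 0 1 \<inter> {y. infdist y D \<le> \<delta>})"
    by (intro closedin_closed_Int closed_Collect_le continuous_intros)
  have "?T \<subseteq> sphere 0 1 \<inter> {y. infdist y D \<le> \<delta>}" by (auto simp: thickening_eq_infdist[OF assms])
  then have "?X closure_of ?T \<subseteq> sphere 0 1 \<inter> {y. infdist y D \<le> \<delta>}" using cl by (rule closure_of_minimal)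
  moreover have "?X frontier_of ?T = ?X closure_of ?T - ?T"
    using op by (simp add: frontier_of_def interior_of_openin)
  ultimately show ?thesis by (auto simp: thickening_eq_infdist[OF assms])
qed

text \<open>
  The relative boundary of a thickening lies in a level set of the distance function.
\<close>

lemma continuity_set_thickening:
  fixes D :: "'a set"
  assumes D: "D \<noteq> {}" and null: "measure \<sigma> {y \<in> sphere 0 1. infdist y D = \<delta>} = 0"
  shows "continuity_set \<sigma> (thickening \<delta> D \<inter> sphere 0 1)"
proof -
  let ?F = "top_of_set (sphere 0 1) frontier_of (thickening \<delta> D \<inter> sphere 0 1)"
  have "{y \<in> sphere 0 1. infdist y D = \<delta>} = sphere 0 1 \<inter> {y. infdist y D = \<delta>}" by auto
  then have m: "{y \<in> sphere 0 1. infdist y D = \<delta>} \<in> sets borel"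
    by (auto intro!: borel_closed closed_Int closed_Collect_eq continuous_intros)
  have "{y \<in> sphere 0 1. infdist y D = \<delta>} \<in> sets \<sigma>" using m by (intro sphere_setI) auto
  then have "emeasure \<sigma> ?F \<le> emeasure \<sigma> {y \<in> sphere 0 1. infdist y D = \<delta>}"
    by (intro emeasure_mono frontier_sphere_thickening D)
  also have "\<dots> = 0" using null by (simp add: emeasure_eq_measure)
  finally have "emeasure \<sigma> ?F = 0" by simp
  moreover have "thickening \<delta> D \<inter> sphere 0 1 \<in> sets \<sigma>" by (intro sphere_setI) auto
  ultimately show ?thesis by (simp add: continuity_set_def sets)
qed

text \<open>
  The level sets of the distance function are disjoint, so only countably many of them have positive
  measure.
\<close>

lemma ex_continuity_radius:
  fixes D :: "'a set"
  assumes "u > 0"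
  shows "\<exists>\<delta>. 0 < \<delta> \<and> \<delta> < u \<and> measure \<sigma> {y \<in> sphere 0 1. infdist y D = \<delta>} = 0"
proof -
  have mi: "(\<lambda>y. infdist y D) \<in> borel_measurable \<sigma>"
    by (subst measurable_cong_sets[OF sets refl]) (intro measurable_restrict_space1 borel_measurable_continuous_onI continuous_intros)
  let ?N = "distr \<sigma> borel (\<lambda>y. infdist y D)"
  interpret N: finite_measure ?N by (rule finite_measure_distr[OF mi])
  have "uncountable ({0<..<u} :: real set)" using assms by (simp add: uncountable_open_interval)
  moreover have "countable {x. measure ?N {x} \<noteq> 0}" by (rule N.countable_support)
  ultimately have "\<not> {0<..<u} \<subseteq> {x. measure ?N {x} \<noteq> 0}" using countable_subset by blast
  then obtain \<delta> where "0 < \<delta>" "\<delta> < u" "measure ?N {\<delta>} = 0" by auto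
  moreover have "measure ?N {\<delta>} = measure \<sigma> {y \<in> sphere 0 1. infdist y D = \<delta>}"
    by (subst measure_distr[OF mi]) (auto simp: space_sphere intro!: arg_cong[where f="measure \<sigma>"])
  ultimately show ?thesis by auto
qed

text \<open>
  A continuity set can be approximated from outside by thickenings that are continuity sets; their
  measures converge to that of the closure, which is that of the set itself.
\<close>

lemma continuity_thickenings:
  fixes D :: "'a set"
  assumes D: "continuity_set \<sigma> D" "D \<noteq> {}"
  obtains \<delta> where "\<And>n::nat. 0 < \<delta> n" "\<And>n. \<delta> n < 1" "\<delta> \<longlonglongrightarrow> 0"
    "\<And>n. continuity_set \<sigma> (thickening (\<delta> n) D \<inter> sphere 0 1)"
    "(\<lambda>n. measure \<sigma> (thickening (\<delta> n) D \<inter> sphere 0 1)) \<longlonglongrightarrow> measure \<sigma> D"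
proof -
  have "\<forall>n. \<exists>\<delta>. 0 < \<delta> \<and> \<delta> < 1 / real (Suc n) \<and> measure \<sigma> {y \<in> sphere 0 1. infdist y D = \<delta>} = 0"
    by (intro allI ex_continuity_radius) simp
  then obtain \<delta> where \<delta>: "\<And>n. 0 < \<delta> n" "\<And>n. \<delta> n < 1 / real (Suc n)"
    "\<And>n. measure \<sigma> {y \<in> sphere 0 1. infdist y D = \<delta> n} = 0" by metis
  let ?U = "\<lambda>n. thickening (1 / real (Suc n)) D \<inter> sphere 0 1"
  have U: "?U n \<in> sets \<sigma>" for n by (intro sphere_setI) auto
  have "decseq ?U"
    unfolding decseq_def by (intro allI impI Int_mono thickening_mono divide_left_mono order_refl) auto
  then have "(\<lambda>n. measure \<sigma> (?U n)) \<longlonglongrightarrow> measure \<sigma> (\<Inter>n. ?U n)"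
    using U by (intro finite_Lim_measure_decseq) auto
  moreover have "measure \<sigma> (\<Inter>n. ?U n) = measure \<sigma> D"
  proof (rule antisym)
    let ?F = "top_of_set (sphere 0 1) frontier_of D"
    have F: "?F \<in> sets \<sigma>"
    proof -
      have "closedin (top_of_set (sphere 0 1)) ?F" by (rule closedin_frontier_of)
      then have "closed ?F" "?F \<subseteq> sphere 0 1" unfolding closedin_closed by (metis closed_Int closed_sphere, blast)
      then show ?thesis by (intro sphere_setI) auto
    qed
    have "(\<Inter>n. ?U n) \<subseteq> D \<union> ?F"
    proof
      fix y assume y: "y \<in> (\<Inter>n. ?U n)"
      then have yS: "y \<in> sphere 0 1" by auto
      have "infdist y D \<le> 0"
      proof (rule field_le_epsilon)
        fix e :: real assume "0 < e"
        then obtain n where "inverse (real (Suc n)) < e" using reals_Archimedean by blast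
        moreover have "infdist y D < 1 / real (Suc n)" using y by (auto simp: thickening_eq_infdist[OF D(2)])
        ultimately show "infdist y D \<le> 0 + e" by (simp add: inverse_eq_divide)
      qed
      then have "y \<in> closure D" using D(2) by (simp add: in_closure_iff_infdist_zero order_antisym infdist_nonneg)
      then have "y \<in> top_of_set (sphere 0 1) closure_of D"
        using yS continuity_set_borel(2)[OF D(1)] by (simp add: closure_of_subtopology Int_absorb1)
      then show "y \<in> D \<union> ?F" using interior_of_subset[of "top_of_set (sphere 0 1)" D] by (auto simp: frontier_of_def)
    qed
    then have "measure \<sigma> (\<Inter>n. ?U n) \<le> measure \<sigma> (D \<union> ?F)"
      using F continuity_set_borel(3)[OF D(1)] by (intro finite_measure_mono) auto
    also have "\<dots> \<le> measure \<sigma> D + measure \<sigma> ?F"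
      using F continuity_set_borel(3)[OF D(1)] by (intro measure_Un_le)
    also have "measure \<sigma> ?F = 0" using D(1) by (simp add: continuity_set_def measure_def)
    finally show "measure \<sigma> (\<Inter>n. ?U n) \<le> measure \<sigma> D" by simp
    have "D \<subseteq> (\<Inter>n. ?U n)" 
    proof (rule INT_greatest)
      fix n :: nat
      have "D \<subseteq> thickening (1 / real (Suc n)) D" by (rule subset_thickening) simp
      then show "D \<subseteq> ?U n" using continuity_set_borel(2)[OF D(1)] by blast
    qed
    moreover have "(\<Inter>n. ?U n) \<in> sets \<sigma>" using U by (intro sets.countable_INT) blast+
    ultimately show "measure \<sigma> D \<le> measure \<sigma> (\<Inter>n. ?U n)" by (intro finite_measure_mono)
  qed
  ultimately have lim: "(\<lambda>n. measure \<sigma> (?U n)) \<longlonglongrightarrow> measure \<sigma> D" by simp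
  show thesis
  proof (rule that[of \<delta>])
    show "0 < \<delta> n" for n by (rule \<delta>)
    show "\<delta> n < 1" for n using \<delta>(2)[of n] less_le_trans[of "\<delta> n" "1 / real (Suc n)" 1] by simp
    have i0: "(\<lambda>n. 1 / real (Suc n)) \<longlonglongrightarrow> 0"
      using LIMSEQ_inverse_real_of_nat by (simp add: inverse_eq_divide)
    show "\<delta> \<longlonglongrightarrow> 0"
      by (rule tendsto_sandwich[OF _ _ tendsto_const i0]) (auto intro!: always_eventually less_imp_le \<delta> simp del: of_nat_Suc)
    show "continuity_set \<sigma> (thickening (\<delta> n) D \<inter> sphere 0 1)" for n
      by (rule continuity_set_thickening[OF D(2) \<delta>(3)])
    show "(\<lambda>n. measure \<sigma> (thickening (\<delta> n) D \<inter> sphere 0 1)) \<longlonglongrightarrow> measure \<sigma> D"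
    proof (rule tendsto_sandwich[OF _ _ tendsto_const lim])
      have T: "thickening (\<delta> n) D \<inter> sphere 0 1 \<in> sets \<sigma>" for n by (intro sphere_setI) auto
      have "D \<subseteq> thickening (\<delta> n) D \<inter> sphere 0 1" for n
        using continuity_set_borel(2)[OF D(1)] subset_thickening[OF \<delta>(1), of D] by blast
      then show "\<forall>\<^sub>F n in sequentially. measure \<sigma> D \<le> measure \<sigma> (thickening (\<delta> n) D \<inter> sphere 0 1)"
        using T by (intro always_eventually allI finite_measure_mono)
      have "thickening (\<delta> n) D \<subseteq> thickening (1 / real (Suc n)) D" for n
        by (intro thickening_mono less_imp_le \<delta>)
      then show "\<forall>\<^sub>F n in sequentially. measure \<sigma> (thickening (\<delta> n) D \<inter> sphere 0 1) \<le> measure \<sigma> (?U n)"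
        using U by (intro always_eventually allI finite_measure_mono) auto
    qed
  qed
qed

lemma regularly_varying_rv_function:
  fixes \<nu> :: "'a measure"
  assumes rv: "regularly_varying \<nu> \<rho> \<sigma>" and sig: "measure \<sigma> (sphere 0 1) \<noteq> 0"
    and finite: "\<And>r. r > 0 \<Longrightarrow> emeasure \<nu> {x. norm x > r} < \<infinity>"
  shows "rv_function (\<lambda>r. measure \<nu> {x. norm x > r}) \<rho>"
  unfolding rv_function_def
proof (intro conjI allI impI)
  have s: "sets \<nu> = sets borel" using rv by (simp add: regularly_varying_def)
  fix r :: real assume "r > 0"
  then show "measure \<nu> {x. norm x > r} > 0"
    using rv finite[of r] by (simp add: regularly_varying_def measure_def enn2real_positive_iff)
next
  have s: "sets \<nu> = sets borel" using rv by (simp add: regularly_varying_def)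
  fix x y :: real assume "0 < x" "x \<le> y"
  then show "measure \<nu> {z. norm z > y} \<le> measure \<nu> {z. norm z > x}"
    using finite[of x] by (intro measure_mono_fmeasurable) (auto simp: fmeasurable_def s)
next
  fix t :: real assume t: "t > 0"
  have "((\<lambda>r. measure \<nu> (directional_tail (r * t) (sphere 0 1)) / measure \<nu> {x. norm x > r})
      \<longlongrightarrow> t powr (- \<rho>) * (measure \<sigma> (sphere 0 1) / measure \<sigma> (sphere 0 1))) at_top"
    using rv[unfolded regularly_varying_def] t continuity_set_sphere by blast
  then have "((\<lambda>r. measure \<nu> (directional_tail (r * t) (sphere 0 1)) / measure \<nu> {x. norm x > r})
      \<longlongrightarrow> t powr (- \<rho>)) at_top" using sig by simp
  then show "((\<lambda>r. measure \<nu> {x. norm x > r * t} / measure \<nu> {x. norm x > r}) \<longlongrightarrow> t powr (- \<rho>)) at_top"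
  proof (rule Lim_transform_eventually)
    show "\<forall>\<^sub>F r in at_top. measure \<nu> (directional_tail (r * t) (sphere 0 1)) / measure \<nu> {x. norm x > r} =
        measure \<nu> {x. norm x > r * t} / measure \<nu> {x. norm x > r}"
      by (rule eventually_mono[OF eventually_ge_at_top[of 0]]) (use t in \<open>simp add: directional_tail_sphere\<close>)
  qed
qed

text \<open>
  Regular variation can be tested with any normaliser whose ratio to the tail has a positive
  limit.
\<close>

lemma regularly_varying_if_normalised:
  fixes \<nu> :: "'a measure"
  assumes s: "sets \<nu> = sets borel" and sig: "measure \<sigma> (sphere 0 1) \<noteq> 0"
    and finite: "\<And>r. r > 0 \<Longrightarrow> emeasure \<nu> {x. norm x > r} < \<infinity>"
    and f: "\<And>r. r > 0 \<Longrightarrow> f r > 0" and c: "c > 0"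
    and lim: "\<And>t D. t > 0 \<Longrightarrow> continuity_set \<sigma> D \<Longrightarrow>
      ((\<lambda>r. measure \<nu> (directional_tail (r * t) D) / f r) \<longlongrightarrow> c * t powr (- \<rho>) * (measure \<sigma> D / measure \<sigma> (sphere 0 1))) at_top"
  shows "regularly_varying \<nu> \<rho> \<sigma>"
proof -
  have "((\<lambda>r. measure \<nu> (directional_tail (r * 1) (sphere 0 1)) / f r) \<longlongrightarrow> c * 1 powr (- \<rho>) * (measure \<sigma> (sphere 0 1) / measure \<sigma> (sphere 0 1))) at_top"
    by (rule lim) (auto intro: continuity_set_sphere)
  then have "((\<lambda>r. measure \<nu> (directional_tail (r * 1) (sphere 0 1)) / f r) \<longlongrightarrow> c) at_top" using sig by simp
  then have limS: "((\<lambda>r. measure \<nu> {x. norm x > r} / f r) \<longlongrightarrow> c) at_top"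
  proof (rule Lim_transform_eventually)
    show "\<forall>\<^sub>F r in at_top. measure \<nu> (directional_tail (r * 1) (sphere 0 1)) / f r = measure \<nu> {x. norm x > r} / f r"
      by (rule eventually_mono[OF eventually_ge_at_top[of 0]]) (simp add: directional_tail_sphere)
  qed
  show ?thesis
    unfolding regularly_varying_def
  proof (intro conjI allI impI)
    show "sets \<nu> = sets borel" by (rule s)
    show "\<exists>T>0. emeasure \<nu> {x. norm x > T} < \<infinity>" using finite[of 1] by (intro exI[of _ 1]) simp
    fix q :: real assume q: "q > 0"
    have "\<forall>\<^sub>F r in at_top. 0 < measure \<nu> {x. norm x > r} / f r" using limS c by (intro order_tendstoD)
    then obtain r where r: "0 < measure \<nu> {x. norm x > r} / f r" "r \<ge> max 1 q"
      using eventually_happens[OF eventually_conj[OF _ eventually_ge_at_top[of "max 1 q"]]] by force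
    have "measure \<nu> {x. norm x > r} > 0" using r f[of r] by (auto simp: zero_less_divide_iff)
    then have "0 < emeasure \<nu> {x. norm x > r}" by (auto simp: measure_def enn2real_positive_iff)
    also have "\<dots> \<le> emeasure \<nu> {x. norm x > q}"
      using r by (intro emeasure_mono) (auto simp: s)
    finally show "emeasure \<nu> {x. norm x > q} > 0" .
  next
    fix t D assume t: "(t::real) > 0" and D: "continuity_set \<sigma> D"
    have "((\<lambda>r. (measure \<nu> (directional_tail (r * t) D) / f r) / (measure \<nu> {x. norm x > r} / f r)) \<longlongrightarrow>
        (c * t powr (- \<rho>) * (measure \<sigma> D / measure \<sigma> (sphere 0 1))) / c) at_top"
      using c by (intro tendsto_divide lim[OF t D] limS) auto
    then have *: "((\<lambda>r. (measure \<nu> (directional_tail (r * t) D) / f r) / (measure \<nu> {x. norm x > r} / f r)) \<longlongrightarrow>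
        t powr (- \<rho>) * (measure \<sigma> D / measure \<sigma> (sphere 0 1))) at_top"
      using c by simp
    show "((\<lambda>r. measure \<nu> (directional_tail (r * t) D) / measure \<nu> {x. norm x > r})
        \<longlongrightarrow> t powr (- \<rho>) * (measure \<sigma> D / measure \<sigma> (sphere 0 1))) at_top"
    proof (rule Lim_transform_eventually[OF *])
      show "\<forall>\<^sub>F r in at_top. (measure \<nu> (directional_tail (r * t) D) / f r) / (measure \<nu> {x. norm x > r} / f r) =
         measure \<nu> (directional_tail (r * t) D) / measure \<nu> {x. norm x > r}"
      proof (rule eventually_mono[OF eventually_gt_at_top[of 0]])
        fix r :: real assume "r > 0"
        then have "f r \<noteq> 0" using f[of r] by simp
        then show "(measure \<nu> (directional_tail (r * t) D) / f r) / (measure \<nu> {x. norm x > r} / f r) =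
           measure \<nu> (directional_tail (r * t) D) / measure \<nu> {x. norm x > r}" by simp
      qed
    qed
  qed
qed

text \<open>
  Upper bounds come from \<open>PQ\<close> on thickenings that are continuity sets. Lower bounds for a set of
  directions \<open>D\<close> come from the lower bound for the full sphere, given by \<open>QP\<close>, and the upper bound for the
  complement of \<open>D\<close>, which takes the place of an approximation of \<open>D\<close> from inside.
\<close>

lemma regularly_varying_transfer:
  fixes P Q :: "'a measure"
  assumes Q: "regularly_varying Q \<rho> \<sigma>" and P: "sets P = sets borel"
    and sig: "measure \<sigma> (sphere 0 1) \<noteq> 0"
    and finP: "\<And>r. r > 0 \<Longrightarrow> emeasure P {x. norm x > r} < \<infinity>"
    and finQ: "\<And>r. r > 0 \<Longrightarrow> emeasure Q {x. norm x > r} < \<infinity>"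
    and PQ: "\<And>t \<delta> \<eta> D. 0 < t \<Longrightarrow> 0 < \<delta> \<Longrightarrow> \<delta> < 1 \<Longrightarrow> 0 < \<eta> \<Longrightarrow> D \<in> sets borel \<Longrightarrow> D \<subseteq> sphere 0 1 \<Longrightarrow>
      \<forall>\<^sub>F r in at_top. measure P (directional_tail (r * t) D) \<le>
        measure Q (directional_tail (r * t * (1 - \<delta>)) (thickening \<delta> D \<inter> sphere 0 1)) + \<eta> * measure Q {x. norm x > r}"
    and QP: "\<And>t \<delta> \<eta> D. 0 < t \<Longrightarrow> 0 < \<delta> \<Longrightarrow> \<delta> < 1 \<Longrightarrow> 0 < \<eta> \<Longrightarrow> D \<in> sets borel \<Longrightarrow> D \<subseteq> sphere 0 1 \<Longrightarrow>
      \<forall>\<^sub>F r in at_top. measure Q (directional_tail (r * t) D) \<le>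
        measure P (directional_tail (r * t * (1 - \<delta>)) (thickening \<delta> D \<inter> sphere 0 1)) + \<eta> * measure Q {x. norm x > r}"
  shows "regularly_varying P \<rho> \<sigma>"
proof -
  define f where "f r = measure Q {x. norm x > r}" for r
  have rvf: "rv_function f \<rho>" unfolding f_def by (rule regularly_varying_rv_function[OF Q sig finQ])
  then have fpos: "f r > 0" if "r > 0" for r using that by (simp add: rv_function_def)
  define c where "c D = measure \<sigma> D / measure \<sigma> (sphere 0 1)" for D
  have cS: "c (sphere 0 1) = 1" using sig by (simp add: c_def)
  have limQ: "((\<lambda>r. measure Q (directional_tail (r * t) D) / f r) \<longlongrightarrow> t powr (- \<rho>) * c D) at_top"
    if "t > 0" "continuity_set \<sigma> D" for t D
    using Q that by (simp add: regularly_varying_def f_def c_def)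
  have upper: "\<forall>\<^sub>F r in at_top. measure P (directional_tail (r * t) D) / f r < t powr (- \<rho>) * c D + e"
    if t: "t > 0" and D: "continuity_set \<sigma> D" and e: "e > 0" for t D e
  proof (cases "D = {}")
    case True
    then show ?thesis using e by (simp add: directional_tail_def c_def)
  next
    case False
    obtain \<delta> where \<delta>: "\<And>n::nat. 0 < \<delta> n" "\<And>n. \<delta> n < 1" "\<delta> \<longlonglongrightarrow> 0"
      "\<And>n. continuity_set \<sigma> (thickening (\<delta> n) D \<inter> sphere 0 1)"
      "(\<lambda>n. measure \<sigma> (thickening (\<delta> n) D \<inter> sphere 0 1)) \<longlonglongrightarrow> measure \<sigma> D"
      using continuity_thickenings[OF D False] by blast
    have "(\<lambda>n. (t * (1 - \<delta> n)) powr (- \<rho>) * c (thickening (\<delta> n) D \<inter> sphere 0 1)) \<longlonglongrightarrow> (t * (1 - 0)) powr (- \<rho>) * c D"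
      unfolding c_def using t sig by (intro tendsto_intros \<delta>) auto
    then have "\<forall>\<^sub>F n in sequentially. (t * (1 - \<delta> n)) powr (- \<rho>) * c (thickening (\<delta> n) D \<inter> sphere 0 1) < t powr (- \<rho>) * c D + e / 2"
      using e by (intro order_tendstoD) auto
    then obtain n where n: "(t * (1 - \<delta> n)) powr (- \<rho>) * c (thickening (\<delta> n) D \<inter> sphere 0 1) < t powr (- \<rho>) * c D + e / 2"
      using eventually_happens by force
    let ?D = "thickening (\<delta> n) D \<inter> sphere 0 1"
    have "0 < t * (1 - \<delta> n)" using t \<delta>(2)[of n] by simp
    then have "\<forall>\<^sub>F r in at_top. measure Q (directional_tail (r * (t * (1 - \<delta> n))) ?D) / f r < t powr (- \<rho>) * c D + e / 2"
      using n by (intro order_tendstoD(2)[OF limQ] \<delta>(4))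
    moreover have "\<forall>\<^sub>F r in at_top. measure P (directional_tail (r * t) D) \<le>
        measure Q (directional_tail (r * t * (1 - \<delta> n)) ?D) + e / 2 * f r"
      unfolding f_def using e by (intro PQ t \<delta> continuity_set_borel[OF D]) auto
    ultimately show ?thesis using eventually_gt_at_top[of 0]
    proof eventually_elim
      case (elim r)
      have fr: "f r > 0" using fpos elim by simp
      have "measure P (directional_tail (r * t) D) / f r \<le> (measure Q (directional_tail (r * t * (1 - \<delta> n)) ?D) + e / 2 * f r) / f r"
        using elim fr by (intro divide_right_mono) auto
      also have "\<dots> = measure Q (directional_tail (r * (t * (1 - \<delta> n))) ?D) / f r + e / 2"
        using fr by (simp add: add_divide_distrib mult.assoc)
      finally show ?case using elim by linarith
    qed
  qed
  have lowerS: "\<forall>\<^sub>F r in at_top. t powr (- \<rho>) - e < measure P (directional_tail (r * t) (sphere 0 1)) / f r"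
    if t: "t > 0" and e: "e > 0" for t e
  proof -
    \<comment> \<open>Start from the slightly higher level \<open>u = t / (1 - \<delta>)\<close>, which the thickening lowers to \<open>t\<close>.\<close>
    have "(\<lambda>n. (t / (1 - 1 / real (Suc (Suc n)))) powr (- \<rho>)) \<longlonglongrightarrow> (t / (1 - 0)) powr (- \<rho>)"
      using t LIMSEQ_Suc[OF LIMSEQ_inverse_real_of_nat] by (intro tendsto_intros) (auto simp: inverse_eq_divide)
    then have "\<forall>\<^sub>F n in sequentially. t powr (- \<rho>) - e / 2 < (t / (1 - 1 / real (Suc (Suc n)))) powr (- \<rho>)"
      using e by (intro order_tendstoD) auto
    then obtain n where n: "t powr (- \<rho>) - e / 2 < (t / (1 - 1 / real (Suc (Suc n)))) powr (- \<rho>)"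
      using eventually_happens by force
    define \<delta> where "\<delta> = 1 / real (Suc (Suc n))"
    have \<delta>: "0 < \<delta>" "\<delta> < 1" by (auto simp: \<delta>_def)
    define u where "u = t / (1 - \<delta>)"
    have u: "u > 0" "u * (1 - \<delta>) = t" "t powr (- \<rho>) - e / 2 < u powr (- \<rho>)" using t \<delta> n by (auto simp: u_def \<delta>_def)
    have "\<forall>\<^sub>F r in at_top. t powr (- \<rho>) - e / 2 < measure Q (directional_tail (r * u) (sphere 0 1)) / f r"
      using limQ[OF u(1) continuity_set_sphere] u(3) cS by (intro order_tendstoD) auto
    moreover have "\<forall>\<^sub>F r in at_top. measure Q (directional_tail (r * u) (sphere 0 1)) \<le>
        measure P (directional_tail (r * u * (1 - \<delta>)) (thickening \<delta> (sphere 0 1) \<inter> sphere 0 1)) + e / 2 * f r"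
      unfolding f_def using e by (intro QP u \<delta>) auto
    ultimately show ?thesis using eventually_gt_at_top[of 0]
    proof eventually_elim
      case (elim r)
      have fr: "f r > 0" using fpos elim by simp
      have S: "thickening \<delta> (sphere 0 1) \<inter> sphere 0 1 = (sphere 0 1 :: 'a set)"
        using subset_thickening[OF \<delta>(1), of "sphere 0 1"] by blast
      have "measure Q (directional_tail (r * u) (sphere 0 1)) / f r \<le> (measure P (directional_tail (r * u * (1 - \<delta>)) (sphere 0 1)) + e / 2 * f r) / f r"
        using elim fr unfolding S by (intro divide_right_mono) auto
      also have "\<dots> = measure P (directional_tail (r * t) (sphere 0 1)) / f r + e / 2"
        using fr u(2) by (simp add: add_divide_distrib mult.assoc)
      finally show ?case using elim by linarith
    qed
  qed
  have limP: "((\<lambda>r. measure P (directional_tail (r * t) D) / f r) \<longlongrightarrow> t powr (- \<rho>) * c D) at_top"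
    if t: "t > 0" and D: "continuity_set \<sigma> D" for t D
  proof (rule order_tendstoI)
    fix a assume a: "a < t powr (- \<rho>) * c D"
    define e where "e = (t powr (- \<rho>) * c D - a) / 2"
    have e: "e > 0" using a by (simp add: e_def)
    have cC: "c (sphere 0 1 - D) = 1 - c D"
      using sig measure_Compl_sphere[OF continuity_set_borel(3)[OF D]] by (simp add: c_def diff_divide_distrib)
    show "\<forall>\<^sub>F r in at_top. a < measure P (directional_tail (r * t) D) / f r"
      using lowerS[OF t e] upper[OF t continuity_set_Compl[OF D] e] eventually_gt_at_top[of 0]
    proof eventually_elim
      case (elim r)
      have fr: "f r > 0" using fpos elim by simp
      have rt: "r * t > 0" using elim t by simp
      have sub: "directional_tail (r * t) (sphere 0 1) \<subseteq> directional_tail (r * t) D \<union> directional_tail (r * t) (sphere 0 1 - D)"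
        by (auto simp: directional_tail_def)
      have fm: "directional_tail (r * t) E \<in> fmeasurable P" if "E \<in> sets borel" for E
      proof -
        have "emeasure P (directional_tail (r * t) E) \<le> emeasure P {x. norm x > r * t}"
          by (intro emeasure_mono directional_tail_subset) (simp add: P)
        then show ?thesis using finP[OF rt] directional_tail_borel[OF that] P by (auto simp: fmeasurable_def)
      qed
      have DB: "D \<in> sets borel" "sphere 0 1 - D \<in> sets borel"
        using continuity_set_borel[OF D] by auto
      have "measure P (directional_tail (r * t) (sphere 0 1)) \<le> measure P (directional_tail (r * t) D \<union> directional_tail (r * t) (sphere 0 1 - D))"
        using sub fm[OF DB(1)] fm[OF DB(2)] directional_tail_borel[of "sphere 0 1 :: 'a set"]
        by (intro measure_mono_fmeasurable fmeasurable.Un) (auto simp: P)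
      also have "\<dots> \<le> measure P (directional_tail (r * t) D) + measure P (directional_tail (r * t) (sphere 0 1 - D))"
        using fm[OF DB(1)] fm[OF DB(2)] by (intro measure_Un_le) auto
      finally have "measure P (directional_tail (r * t) (sphere 0 1)) / f r \<le>
          measure P (directional_tail (r * t) D) / f r + measure P (directional_tail (r * t) (sphere 0 1 - D)) / f r"
        using fr by (simp add: add_divide_distrib[symmetric] divide_right_mono)
      then have "measure P (directional_tail (r * t) D) / f r > t powr (- \<rho>) - e - (t powr (- \<rho>) * c (sphere 0 1 - D) + e)"
        using elim by linarith
      also have "t powr (- \<rho>) - e - (t powr (- \<rho>) * c (sphere 0 1 - D) + e) = a"
        by (simp add: cC e_def algebra_simps)
      finally show ?case .
    qed
  next
    fix a assume "t powr (- \<rho>) * c D < a"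
    then show "\<forall>\<^sub>F r in at_top. measure P (directional_tail (r * t) D) / f r < a"
      using upper[OF t D, of "a - t powr (- \<rho>) * c D"] by simp
  qed
  show ?thesis
    by (rule regularly_varying_if_normalised[where f=f and c=1, OF P sig finP fpos]) (use limP in \<open>auto simp: c_def\<close>)
qed

end


text \<open>
  In either direction the normaliser is the tail of the measure that is assumed regularly varying.
\<close>

theorem ID_regularly_varying_iff:
  fixes M \<mu> \<sigma> :: "'a::euclidean_space measure"
  assumes ID: "is_ID M b \<mu>" and fin: "finite_measure \<sigma>" and sets: "sets \<sigma> = sets borel_sphere"
    and sig: "measure \<sigma> (sphere 0 1) \<noteq> 0" and rho: "\<rho> > 0"
  shows "regularly_varying \<mu> \<rho> \<sigma> \<longleftrightarrow> regularly_varying M \<rho> \<sigma>"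
proof -
  have M: "levy_measure M" and mu: "prob_space \<mu>" "sets \<mu> = sets borel"
    using ID by (auto simp: is_ID_def)
  interpret mu: prob_space \<mu> by fact
  have sM: "sets M = sets borel" by (rule sets_levy[OF M])
  have fm: "emeasure \<mu> {x. norm x > r} < \<infinity>" for r using le_less_trans[OF mu.emeasure_le_1, of "\<infinity>"] by simp
  have fM: "emeasure M {x. norm x > r} < \<infinity>" if "r > 0" for r by (rule levy_tail_finite[OF M that])
  show ?thesis
  proof
    assume rv: "regularly_varying \<mu> \<rho> \<sigma>"
    have f: "rv_function (\<lambda>r. measure \<mu> {x. norm x > r}) \<rho>"
      by (rule regularly_varying_rv_function[OF fin sets rv sig fm])
    obtain C where C: "C > 0" "\<forall>\<^sub>F r in at_top. measure \<mu> {x. norm x > r * (1 / 2)} \<le> C * measure \<mu> {x. norm x > r}"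
      using rv_function_dilation[OF f, of "1 / 2"] by auto
    have tail: "\<forall>\<^sub>F r in at_top. measure M {x. norm x > r} \<le> (4 * C) * measure \<mu> {x. norm x > r}"
      using levy_tail_le_law_tail[OF ID] C(2) by eventually_elim simp
    note one = one_big_jump_asymptotics[OF ID f rho _ tail]
    show "regularly_varying M \<rho> \<sigma>"
      by (rule regularly_varying_transfer[OF fin sets rv sM sig fM fm]) (use one C in auto)
  next
    assume rv: "regularly_varying M \<rho> \<sigma>"
    have f: "rv_function (\<lambda>r. measure M {x. norm x > r}) \<rho>"
      by (rule regularly_varying_rv_function[OF fin sets rv sig fM])
    note one = one_big_jump_asymptotics[OF ID f rho, of 1]
    show "regularly_varying \<mu> \<rho> \<sigma>"
      by (rule regularly_varying_transfer[OF fin sets rv mu(2) sig fm fM]) (use one in auto)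
  qed
qed

section \<open>The tail of a tempered Levy measure as a convolution\<close>

lemma levy_measure_sigma_finite:
  fixes R :: "'a::euclidean_space measure"
  assumes R: "levy_measure R"
  shows "sigma_finite_measure R"
proof
  have sR: "sets R = sets borel" by (rule sets_levy[OF R])
  have sp: "space R = UNIV" using sets_eq_imp_space_eq[OF sR] by simp
  let ?A = "insert {0} (range (\<lambda>n::nat. {x::'a. norm x > 1 / real (Suc n)}))"
  have U: "x \<in> \<Union>?A" for x :: 'a
  proof (cases "x = 0")
    case False
    then obtain n where "inverse (real (Suc n)) < norm x" using reals_Archimedean[of "norm x"] by auto
    then show ?thesis by (auto simp: inverse_eq_divide)
  qed simp
  moreover have "emeasure R a \<noteq> \<infinity>" if aA: "a \<in> ?A" for a
  proof (cases "a = {0}")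
    case True
    then show ?thesis using R by (simp add: levy_measure_def)
  next
    case False
    then obtain n where "a = {x. norm x > 1 / real (Suc n)}" using aA by blast
    then show ?thesis using levy_tail_finite[OF R, of "1 / real (Suc n)"] by auto
  qed
  moreover have "?A \<subseteq> sets R" unfolding sR by auto
  ultimately show "\<exists>A. countable A \<and> A \<subseteq> sets R \<and> \<Union> A = space R \<and> (\<forall>a\<in>A. emeasure R a \<noteq> \<infinity>)"
  proof (intro exI[of _ ?A] conjI ballI)
    have "\<Union>?A = UNIV" using U by blast
    then show "\<Union>?A = space R" unfolding sp .
  qed (auto intro: countable_insert)
qed

text \<open>
  In all three ranges of \<open>\<alpha>\<close> the integrability condition on a Rosinski measure dominates that on a
  Levy measure, so the tail estimates for Levy measures apply to \<open>R\<close> as well.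
\<close>

lemma rosinski_imp_levy_measure:
  fixes R :: "'a::euclidean_space measure"
  assumes R: "rosinski_measure \<alpha> R" and \<alpha>: "\<alpha> < 2"
  shows "levy_measure R"
proof -
  have le: "(\<integral>\<^sup>+ x. ennreal (min ((norm x)\<^sup>2) 1) \<partial>R) < \<infinity>"
    if g: "\<And>x::'a. min ((norm x)\<^sup>2) 1 \<le> g x" and f: "(\<integral>\<^sup>+ x. ennreal (g x) \<partial>R) < \<infinity>" for g
  proof -
    have "(\<integral>\<^sup>+ x. ennreal (min ((norm x)\<^sup>2) 1) \<partial>R) \<le> (\<integral>\<^sup>+ x. ennreal (g x) \<partial>R)"
      using g by (intro nn_integral_mono ennreal_leI)
    then show ?thesis using f by (rule le_less_trans)
  qed
  have "(\<integral>\<^sup>+ x. ennreal (min ((norm x)\<^sup>2) 1) \<partial>R) < \<infinity>"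
  proof (cases "\<alpha> > 0")
    case True
    have "min ((norm x)\<^sup>2) 1 \<le> min ((norm x)\<^sup>2) (norm x powr \<alpha>)" for x :: 'a
    proof (cases "norm x \<le> 1")
      case le1: True
      have "(norm x)\<^sup>2 \<le> norm x powr \<alpha>"
      proof (cases "x = 0")
        case False
        have "norm x powr 2 \<le> norm x powr \<alpha>" using False le1 \<alpha> by (intro powr_mono') auto
        then show ?thesis using False by (simp add: powr_numeral)
      qed simp
      then show ?thesis by (simp add: min_le_iff_disj)
    next
      case False
      then have "1 \<le> norm x powr \<alpha>" using True by (intro ge_one_powr_ge_zero) auto
      then show ?thesis by (simp add: min_le_iff_disj)
    qed
    then show ?thesis using le[of "\<lambda>x. min ((norm x)\<^sup>2) (norm x powr \<alpha>)"] R True by (simp add: rosinski_measure_def)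
  next
    case False
    show ?thesis
    proof (cases "\<alpha> = 0")
      case True
      have "min ((norm x)\<^sup>2) 1 \<le> min ((norm x)\<^sup>2) (1 + max 0 (ln (norm x)))" for x :: 'a
        by (simp add: min_le_iff_disj)
      then show ?thesis using le[of "\<lambda>x. min ((norm x)\<^sup>2) (1 + max 0 (ln (norm x)))"] R True by (simp add: rosinski_measure_def)
    qed (use R False in \<open>auto simp: rosinski_measure_def\<close>)
  qed
  then show ?thesis using R by (simp add: levy_measure_def rosinski_measure_def)
qed

text \<open>
  The kernel \<open>t^(-1-\<alpha>) exp(-t^p) dt\<close> on \<open>(0, \<infinity>)\<close> as a measure; it is infinite near \<open>0\<close> when \<open>\<alpha> \<ge> 0\<close>.
\<close>

definition tempering :: "real \<Rightarrow> real \<Rightarrow> real measure" where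
  "tempering p \<alpha> = density lborel (\<lambda>t. ennreal (indicator {0<..} t * (t powr (- 1 - \<alpha>) * exp (- (t powr p)))))"

lemma sets_tempering [simp, measurable_cong]: "sets (tempering p \<alpha>) = sets borel"
  by (simp add: tempering_def)

lemma nn_integral_tempering:
  "f \<in> borel_measurable borel \<Longrightarrow> (\<integral>\<^sup>+t. f t \<partial>tempering p \<alpha>) =
     (\<integral>\<^sup>+t\<in>{0<..}. f t * ennreal (t powr (- 1 - \<alpha>) * exp (- (t powr p))) \<partial>lborel)"
  unfolding tempering_def
  by (subst nn_integral_density) (auto intro!: nn_integral_cong split: split_indicator simp: mult.commute)

lemma AE_tempering_pos: "AE t in tempering p \<alpha>. t > 0"
  unfolding tempering_def by (subst AE_density) (auto split: split_indicator)

lemma tempering_interval_pos: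
  assumes "0 < a" "a < b"
  shows "emeasure (tempering p \<alpha>) {a<..<b} \<noteq> 0"
proof
  assume "emeasure (tempering p \<alpha>) {a<..<b} = 0"
  then have "AE t in tempering p \<alpha>. t \<notin> {a<..<b}"
    by (intro AE_not_in) (simp add: null_sets_def)
  then have "AE t in lborel. t \<notin> {a<..<b}"
    unfolding tempering_def by (subst (asm) AE_density) (use assms in \<open>auto elim!: eventually_mono split: split_indicator_asm\<close>)
  then have "emeasure lborel {a<..<b} = 0"
    by (subst (asm) AE_iff_measurable[where N="{a<..<b}"]) auto
  then show False using assms by simp
qed

lemma emeasure_scaled_vimage:
  fixes R :: "'a::euclidean_space measure"
  assumes sR[measurable_cong]: "sets R = sets borel" and A[measurable]: "A \<in> sets borel"
  shows "emeasure R {x. t *\<^sub>R x \<in> A} = (\<integral>\<^sup>+x. indicator A (t *\<^sub>R x) \<partial>R)"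
proof -
  have sp: "space R = UNIV" using sets_eq_imp_space_eq[OF sR] by simp
  have "{x. t *\<^sub>R x \<in> A} \<in> sets R" by measurable
  then have "emeasure R {x. t *\<^sub>R x \<in> A} = (\<integral>\<^sup>+x. indicator {x. t *\<^sub>R x \<in> A} x \<partial>R)" by simp
  also have "\<dots> = (\<integral>\<^sup>+x. indicator A (t *\<^sub>R x) \<partial>R)"
    by (intro nn_integral_cong) (auto split: split_indicator)
  finally show ?thesis .
qed

lemma nn_integral_TS_levy_measure:
  fixes R :: "'a::euclidean_space measure"
  assumes R: "levy_measure R" and A[measurable]: "A \<in> sets borel"
  shows "emeasure (TS_levy_measure p \<alpha> R) A = (\<integral>\<^sup>+t. emeasure R {x. t *\<^sub>R x \<in> A} \<partial>tempering p \<alpha>)"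
proof -
  have sR[measurable_cong]: "sets R = sets borel" by (rule sets_levy[OF R])
  have sp: "space R = UNIV" using sets_eq_imp_space_eq[OF sR] by simp
  interpret R: sigma_finite_measure R by (rule levy_measure_sigma_finite[OF R])
  interpret P: pair_sigma_finite lborel R ..
  let ?k = "\<lambda>t. ennreal (t powr (- 1 - \<alpha>) * exp (- (t powr p))) * indicator {0<..} t"
  note em = emeasure_scaled_vimage[OF sR A]
  have m[measurable]: "(\<lambda>t. emeasure R {x. t *\<^sub>R x \<in> A}) \<in> borel_measurable borel"
    unfolding em by measurable
  have "emeasure (TS_levy_measure p \<alpha> R) A = (\<integral>\<^sup>+x. (\<integral>\<^sup>+t. indicator A (t *\<^sub>R x) * ?k t \<partial>lborel) \<partial>R)"
    by (subst emeasure_TS_levy_measure[OF sR A]) (simp add: mult.assoc)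
  also have "\<dots> = (\<integral>\<^sup>+t. (\<integral>\<^sup>+x. indicator A (t *\<^sub>R x) * ?k t \<partial>R) \<partial>lborel)"
    by (rule P.Fubini') measurable
  also have "\<dots> = (\<integral>\<^sup>+t. emeasure R {x. t *\<^sub>R x \<in> A} * ?k t \<partial>lborel)"
    unfolding em by (intro nn_integral_cong nn_integral_multc) measurable
  also have "\<dots> = (\<integral>\<^sup>+t. emeasure R {x. t *\<^sub>R x \<in> A} \<partial>tempering p \<alpha>)"
    by (subst nn_integral_tempering) (auto simp: mult.assoc)
  finally show ?thesis .
qed

text \<open>
  For \<open>t > 0\<close> this is \<open>R(|x| > r/t, x/|x| \<in> D)\<close>. The formulation through \<open>t *\<^sub>R x\<close> makes sense, and
  is measurable, for all real \<open>t\<close>.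
\<close>

definition scaled_tail :: "'a::euclidean_space measure \<Rightarrow> real \<Rightarrow> 'a set \<Rightarrow> real \<Rightarrow> real" where
  "scaled_tail R r D t = measure R {x. t *\<^sub>R x \<in> directional_tail r D}"

lemma scaled_tail_pos:
  assumes "t > 0"
  shows "scaled_tail R r D t = measure R (directional_tail (r / t) D)"
  using assms by (auto simp: scaled_tail_def directional_tail_def field_simps intro!: arg_cong[where f="measure R"])

lemma scaled_tail_nonneg: "0 \<le> scaled_tail R r D t"
  by (simp add: scaled_tail_def)

context
  fixes R :: "'a::euclidean_space measure"
  assumes R: "levy_measure R"
begin

lemma directional_tail_fmeasurable:
  assumes "r > 0" "D \<in> sets borel"
  shows "directional_tail r D \<in> fmeasurable R"
proof -
  have sR: "sets R = sets borel" by (rule sets_levy[OF R])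
  have "emeasure R (directional_tail r D) \<le> emeasure R {x. norm x > r}"
    by (intro emeasure_mono directional_tail_subset) (simp add: sR)
  then show ?thesis using levy_tail_finite[OF R assms(1)] directional_tail_borel[OF assms(2)] sR by (auto simp: fmeasurable_def)
qed

lemma scaled_tail_mono:
  assumes "r > 0" "D \<in> sets borel" "0 < s" "s \<le> t"
  shows "scaled_tail R r D s \<le> scaled_tail R r D t"
proof -
  have sR: "sets R = sets borel" by (rule sets_levy[OF R])
  have rt: "r / t \<le> r / s" "0 < r / t" using assms by (auto intro: divide_left_mono)
  have "measure R (directional_tail (r / s) D) \<le> measure R (directional_tail (r / t) D)"
    using rt directional_tail_borel[OF assms(2)]
    by (intro measure_mono_fmeasurable directional_tail_fmeasurable assms) (auto simp: directional_tail_def sR)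
  then show ?thesis using assms by (simp add: scaled_tail_pos)
qed

lemma emeasure_scaled_tail:
  assumes r: "r > 0" and D: "D \<in> sets borel"
  shows "emeasure R {x. t *\<^sub>R x \<in> directional_tail r D} = ennreal (scaled_tail R r D t)"
proof (cases "t = 0")
  case True
  then have "{x::'a. t *\<^sub>R x \<in> directional_tail r D} = {}" using r by (auto simp: directional_tail_def)
  then show ?thesis by (simp add: scaled_tail_def)
next
  case False
  have "{x. t *\<^sub>R x \<in> directional_tail r D} \<subseteq> {x. norm x > r / \<bar>t\<bar>}"
    using False by (auto simp: directional_tail_def field_simps)
  then have "emeasure R {x. t *\<^sub>R x \<in> directional_tail r D} \<le> emeasure R {x. norm x > r / \<bar>t\<bar>}"
    by (intro emeasure_mono) (simp_all add: sets_levy[OF R])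
  also have "\<dots> < \<infinity>" using False r by (intro levy_tail_finite[OF R]) simp
  finally show ?thesis unfolding scaled_tail_def by (intro emeasure_eq_ennreal_measure) auto
qed

lemma scaled_tail_measurable [measurable]:
  assumes r: "r > 0" and D: "D \<in> sets borel"
  shows "scaled_tail R r D \<in> borel_measurable borel"
proof -
  have sR[measurable_cong]: "sets R = sets borel" by (rule sets_levy[OF R])
  interpret R: sigma_finite_measure R by (rule levy_measure_sigma_finite[OF R])
  have A[measurable]: "directional_tail r D \<in> sets borel" by (rule directional_tail_borel[OF D])
  note em = emeasure_scaled_vimage[OF sR A]
  have "(\<lambda>t. enn2real (emeasure R {x. t *\<^sub>R x \<in> directional_tail r D})) \<in> borel_measurable borel"
    unfolding em by measurable
  then show ?thesis by (simp add: scaled_tail_def[abs_def] measure_def)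
qed

lemma nn_integral_scaled_tail:
  assumes r: "r > 0" and D: "D \<in> sets borel"
  shows "(\<integral>\<^sup>+t. ennreal (scaled_tail R r D t) \<partial>tempering p \<alpha>) = emeasure (TS_levy_measure p \<alpha> R) (directional_tail r D)"
  by (subst nn_integral_TS_levy_measure[OF R directional_tail_borel[OF D]]) (simp add: emeasure_scaled_tail[OF r D])

lemma scaled_tail_integral:
  assumes M: "levy_measure (TS_levy_measure p \<alpha> R)" and r: "r > 0" and D: "D \<in> sets borel"
  shows "integrable (tempering p \<alpha>) (scaled_tail R r D)"
    and "measure (TS_levy_measure p \<alpha> R) (directional_tail r D) = (\<integral>t. scaled_tail R r D t \<partial>tempering p \<alpha>)"
proof -
  note [measurable] = scaled_tail_measurable[OF r D]
  have "emeasure (TS_levy_measure p \<alpha> R) (directional_tail r D) \<le> emeasure (TS_levy_measure p \<alpha> R) {x. norm x > r}"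
    by (intro emeasure_mono directional_tail_subset) simp
  also have "\<dots> < \<infinity>" by (rule levy_tail_finite[OF M r])
  finally have fin: "emeasure (TS_levy_measure p \<alpha> R) (directional_tail r D) < \<infinity>" .
  show int: "integrable (tempering p \<alpha>) (scaled_tail R r D)"
    using fin by (intro integrableI_nonneg) (auto simp: nn_integral_scaled_tail[OF r D] scaled_tail_nonneg)
  have "ennreal (\<integral>t. scaled_tail R r D t \<partial>tempering p \<alpha>) = emeasure (TS_levy_measure p \<alpha> R) (directional_tail r D)"
    using nn_integral_eq_integral[OF int] by (simp add: nn_integral_scaled_tail[OF r D] scaled_tail_nonneg)
  then show "measure (TS_levy_measure p \<alpha> R) (directional_tail r D) = (\<integral>t. scaled_tail R r D t \<partial>tempering p \<alpha>)"
    by (simp add: measure_def[of "TS_levy_measure p \<alpha> R"] integral_nonneg scaled_tail_nonneg flip: \<open>ennreal _ = _\<close>)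
qed

end

text \<open>
  Substituting \<open>u = t^p\<close> gives Euler's integral.
\<close>

lemma nn_integral_tempering_power:
  assumes p: "p > 0" and b: "\<beta> > \<alpha>"
  shows "(\<integral>\<^sup>+t. ennreal (t powr \<beta>) \<partial>tempering p \<alpha>) = ennreal (Gamma ((\<beta> - \<alpha>) / p) / p)"
proof -
  define q where "q = (\<beta> - \<alpha>) / p"
  have q: "q > 0" using p b by (simp add: q_def)
  define f where "f u = u powr (q - 1) / exp u" for u :: real
  have G: "(f has_integral Gamma q) {0<..}"
  proof -
    have "(f has_integral Gamma q) {0..}" unfolding f_def by (rule Gamma_integral_real[OF q])
    then have "((\<lambda>t. if t \<in> {0<..} then f t else 0) has_integral Gamma q) {0..}"
      by (rule has_integral_spike[of "{0}", rotated 2]) auto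
    then show ?thesis by (subst (asm) has_integral_restrict) auto
  qed
  have fnn: "0 \<le> f u" for u by (simp add: f_def)
  have ai: "f absolutely_integrable_on {0<..}"
    using G fnn by (intro nonnegative_absolutely_integrable_1) (auto simp: has_integral_integrable)
  have im: "(\<lambda>t. t powr p) ` {0<..} = {0::real<..}"
  proof (rule antisym)
    show "{0::real<..} \<subseteq> (\<lambda>t. t powr p) ` {0<..}"
    proof
      fix u :: real assume "u \<in> {0<..}"
      then have "u = (u powr (1 / p)) powr p" "u powr (1 / p) \<in> {0<..}" using p by (auto simp: powr_powr)
      then show "u \<in> (\<lambda>t. t powr p) ` {0<..}" by blast
    qed
  qed auto
  have "(\<lambda>t. \<bar>p * t powr (p - 1)\<bar> * f (t powr p)) absolutely_integrable_on {0<..} \<and>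
      integral {0<..} (\<lambda>t. \<bar>p * t powr (p - 1)\<bar> * f (t powr p)) = Gamma q"
  proof (rule iffD2[OF has_absolute_integral_change_of_variables_1'[where S="{0<..}" and f=f and b="Gamma q"
        and g="\<lambda>t. t powr p" and g'="\<lambda>t. p * t powr (p - 1)"]])
    show "{0::real<..} \<in> sets lebesgue" by simp
    show "((\<lambda>t. t powr p) has_field_derivative p * x powr (p - 1)) (at x within {0<..})" if "x \<in> {0<..}" for x
      using that by (auto intro!: derivative_eq_intros simp: powr_diff)
    show "inj_on (\<lambda>t. t powr p) {0<..}"
    proof (rule inj_onI)
      fix x y :: real assume "x \<in> {0<..}" "y \<in> {0<..}" "x powr p = y powr p"
      then have "(x powr p) powr (1 / p) = (y powr p) powr (1 / p)" "x > 0" "y > 0" by auto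
      then show "x = y" using p by (simp add: powr_powr)
    qed
    show "f absolutely_integrable_on (\<lambda>t. t powr p) ` {0<..} \<and> integral ((\<lambda>t. t powr p) ` {0<..}) f = Gamma q"
      unfolding im using ai G by (simp add: integral_unique)
  qed
  then have hi: "((\<lambda>t. \<bar>p * t powr (p - 1)\<bar> * f (t powr p)) has_integral Gamma q) {0<..}"
    by (simp add: has_integral_iff absolutely_integrable_on_def)
  have eq: "\<bar>p * t powr (p - 1)\<bar> * f (t powr p) = p * (t powr \<beta> * (t powr (- 1 - \<alpha>) * exp (- (t powr p))))" if "t > 0" for t
  proof -
    have "t powr (p - 1) * (t powr p) powr (q - 1) = t powr \<beta> * t powr (- 1 - \<alpha>)"
    proof -
      have "p * q = \<beta> - \<alpha>" using p by (simp add: q_def)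
      then have "p - 1 + p * (q - 1) = \<beta> + (- 1 - \<alpha>)" by (simp add: right_diff_distrib)
      then show ?thesis unfolding powr_powr powr_add[symmetric] by (simp only:)
    qed
    then show ?thesis using p that by (simp add: f_def abs_mult exp_minus divide_inverse mult_ac)
  qed
  have "((\<lambda>t. p * (t powr \<beta> * (t powr (- 1 - \<alpha>) * exp (- (t powr p))))) has_integral Gamma q) {0<..}"
    by (rule has_integral_eq[OF _ hi]) (simp add: eq)
  then have "((\<lambda>t. t powr \<beta> * (t powr (- 1 - \<alpha>) * exp (- (t powr p)))) has_integral (Gamma q / p)) {0<..}"
    using has_integral_mult_right[of "\<lambda>t. p * (t powr \<beta> * (t powr (- 1 - \<alpha>) * exp (- (t powr p))))" "Gamma q" "{0<..}" "1 / p"] p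
    by simp
  then have "(\<integral>\<^sup>+t. ennreal (t powr \<beta> * (t powr (- 1 - \<alpha>) * exp (- (t powr p)))) * indicator {0<..} t \<partial>lborel) = ennreal (Gamma q / p)"
    by (intro nn_integral_has_integral_lebesgue') auto
  then show ?thesis
    by (subst nn_integral_tempering) (auto simp: ennreal_mult q_def)
qed

lemma tempering_power:
  assumes p: "p > 0" and b: "\<beta> > \<alpha>"
  shows "integrable (tempering p \<alpha>) (\<lambda>t. t powr \<beta>)"
    and "(\<integral>t. t powr \<beta> \<partial>tempering p \<alpha>) = Gamma ((\<beta> - \<alpha>) / p) / p"
proof -
  have G: "Gamma ((\<beta> - \<alpha>) / p) / p \<ge> 0" using p b by (intro divide_nonneg_nonneg Gamma_real_nonneg) auto
  show "integrable (tempering p \<alpha>) (\<lambda>t. t powr \<beta>)"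
    by (intro integrableI_nonneg) (auto simp: nn_integral_tempering_power[OF assms])
  show "(\<integral>t. t powr \<beta> \<partial>tempering p \<alpha>) = Gamma ((\<beta> - \<alpha>) / p) / p"
    by (rule integral_eq_nn_integral[THEN trans]) (auto simp: nn_integral_tempering_power[OF assms] G)
qed

text \<open>
  Substituting \<open>t \<mapsto> l t\<close> turns \<open>exp(-t^p)\<close> into \<open>exp(-l^p t^p)\<close>: a change of scale is an exponential tilt of the kernel
  in the variable \<open>t^p\<close>.
\<close>

lemma tempering_scaling:
  assumes p: "p > 0" and l: "l > 0" and g[measurable]: "g \<in> borel_measurable borel"
  shows "(\<integral>\<^sup>+t. g (t / l) \<partial>tempering p \<alpha>) =
     ennreal (l powr (- \<alpha>)) * (\<integral>\<^sup>+t. g t * ennreal (exp (- ((l powr p - 1) * t powr p))) \<partial>tempering p \<alpha>)"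
proof -
  let ?k = "\<lambda>t. ennreal (t powr (- 1 - \<alpha>) * exp (- (t powr p))) * indicator {0<..} t"
  have "(\<integral>\<^sup>+t. g (t / l) \<partial>tempering p \<alpha>) = (\<integral>\<^sup>+t. g (t / l) * ?k t \<partial>lborel)"
    by (subst nn_integral_tempering) (auto simp: mult.assoc)
  also have "\<dots> = ennreal \<bar>l\<bar> * (\<integral>\<^sup>+t. g ((0 + l * t) / l) * ?k (0 + l * t) \<partial>lborel)"
    using l by (intro nn_integral_real_affine) auto
  also have "\<dots> = (\<integral>\<^sup>+t. ennreal \<bar>l\<bar> * (g ((0 + l * t) / l) * ?k (0 + l * t)) \<partial>lborel)"
    by (rule nn_integral_cmult[symmetric]) measurable
  also have "\<dots> = (\<integral>\<^sup>+t. ennreal (l powr (- \<alpha>)) * ((g t * ennreal (exp (- ((l powr p - 1) * t powr p)))) * ?k t) \<partial>lborel)"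
  proof (intro nn_integral_cong)
    fix t :: real
    show "ennreal \<bar>l\<bar> * (g ((0 + l * t) / l) * ?k (0 + l * t)) =
        ennreal (l powr (- \<alpha>)) * ((g t * ennreal (exp (- ((l powr p - 1) * t powr p)))) * ?k t)"
    proof (cases "t > 0")
      case True
      have "l * ((l * t) powr (- 1 - \<alpha>) * exp (- ((l * t) powr p))) =
          l powr (- \<alpha>) * (exp (- ((l powr p - 1) * t powr p)) * (t powr (- 1 - \<alpha>) * exp (- (t powr p))))"
      proof -
        have "l * l powr (- 1 - \<alpha>) = l powr 1 * l powr (- 1 - \<alpha>)" using l by simp
        also have "\<dots> = l powr (- \<alpha>)" unfolding powr_add[symmetric] by simp
        finally have "l * l powr (- 1 - \<alpha>) = l powr (- \<alpha>)" .
        moreover have "exp (- ((l * t) powr p)) = exp (- ((l powr p - 1) * t powr p)) * exp (- (t powr p))"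
          using l True by (simp add: powr_mult exp_add[symmetric] algebra_simps)
        ultimately show ?thesis using l True by (simp add: powr_mult mult_ac)
      qed
      then have "ennreal l * ennreal ((l * t) powr (- 1 - \<alpha>) * exp (- ((l * t) powr p))) =
          ennreal (l powr (- \<alpha>)) * (ennreal (exp (- ((l powr p - 1) * t powr p))) * ennreal (t powr (- 1 - \<alpha>) * exp (- (t powr p))))"
        using l by (simp add: ennreal_mult[symmetric] del: ennreal_mult)
      from arg_cong[OF this, of "\<lambda>u. g t * u"] show ?thesis using True l by (simp add: mult_ac)
    next
      case False
      then have "\<not> l * t > 0" using l by (simp add: zero_less_mult_iff)
      then show ?thesis using False by simp
    qed
  qed
  also have "\<dots> = ennreal (l powr (- \<alpha>)) * (\<integral>\<^sup>+t. (g t * ennreal (exp (- ((l powr p - 1) * t powr p)))) * ?k t \<partial>lborel)"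
    by (rule nn_integral_cmult) measurable
  also have "(\<integral>\<^sup>+t. (g t * ennreal (exp (- ((l powr p - 1) * t powr p)))) * ?k t \<partial>lborel) =
     (\<integral>\<^sup>+t. g t * ennreal (exp (- ((l powr p - 1) * t powr p))) \<partial>tempering p \<alpha>)"
    by (subst nn_integral_tempering) (auto simp: mult.assoc)
  finally show ?thesis .
qed

section \<open>Abelian and Tauberian theorems for the tempering kernel\<close>

text \<open>
  Markov's inequality; it controls the tail near the origin, where Potter bounds say nothing.
\<close>

lemma levy_tail_markov:
  fixes R :: "'a::euclidean_space measure"
  assumes R: "levy_measure R"
  obtains H where "H \<ge> 0" "\<And>u. u > 0 \<Longrightarrow> measure R {x. norm x > u} \<le> H / min (u\<^sup>2) 1"
proof
  have sR[measurable_cong]: "sets R = sets borel" by (rule sets_levy[OF R])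
  have int: "integrable R (\<lambda>x. min ((norm x)\<^sup>2) 1)"
    by (rule levy_integrable[OF R, where C=1]) auto
  let ?H = "\<integral>x. min ((norm x)\<^sup>2) 1 \<partial>R"
  show "?H \<ge> 0" by simp
  fix u :: real assume u: "u > 0"
  have m: "{x::'a. norm x > u} \<in> sets R" by measurable
  have "min (u\<^sup>2) 1 * measure R {x. norm x > u} = (\<integral>x. min (u\<^sup>2) 1 * indicator {x. norm x > u} x \<partial>R)"
    using m by simp
  also have "\<dots> \<le> ?H"
  proof (rule integral_mono)
    show "integrable R (\<lambda>x. min (u\<^sup>2) 1 * indicator {x. norm x > u} x)"
      using levy_tail_finite[OF R u] m by (intro integrable_mult_right) simp
    show "min (u\<^sup>2) 1 * indicator {x. norm x > u} x \<le> min ((norm x)\<^sup>2) 1" for x :: 'a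
      using min_sq_ge_on_tail[OF u, of x] by (auto split: split_indicator)
  qed (rule int)
  finally show "measure R {x. norm x > u} \<le> ?H / min (u\<^sup>2) 1"
    using u by (simp add: le_divide_eq mult.commute)
qed

text \<open>
  The three powers cover three ranges of \<open>t\<close>: for \<open>t \<le> 1\<close> and for \<open>1 \<le> t \<le> r/r0\<close> these are the two Potter
  bounds. For \<open>t > r/r0\<close> the tail is evaluated below \<open>r0\<close>, where Markov's inequality gives a factor \<open>t\<^sup>2\<close>, and
  the normaliser is at least of order \<open>r\<^bsup>-\<rho>-\<eta>\<^esup>\<close>, hence of order \<open>t\<^bsup>-\<rho>-\<eta>\<^esup>\<close> since \<open>r < r0 t\<close>.
\<close>

lemma scaled_tail_domination:
  fixes R :: "'a::euclidean_space measure"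
  assumes R: "levy_measure R" and f: "rv_function (\<lambda>r. measure R {x. norm x > r}) \<rho>"
    and eta: "0 < \<eta>" "\<eta> \<le> \<rho>"
  obtains A where "A \<ge> 0"
    "\<forall>\<^sub>F r in at_top. \<forall>t>0. measure R {x. norm x > r / t} / measure R {x. norm x > r} \<le>
        A * (t powr (\<rho> - \<eta>) + t powr (\<rho> + \<eta>) + t powr (\<rho> + \<eta> + 2))"
proof -
  define f where "f r = measure R {x. norm x > r}" for r
  have rv: "rv_function f \<rho>" using f unfolding f_def .
  have pos: "f r > 0" if "r > 0" for r using rv that by (simp add: rv_function_def)
  obtain r0 C where p: "r0 \<ge> 1" "C \<ge> 1"
    "\<And>x y. r0 \<le> x \<Longrightarrow> x \<le> y \<Longrightarrow> f y \<le> C * (x / y) powr (\<rho> - \<eta>) * f x"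
    "\<And>x y. r0 \<le> x \<Longrightarrow> x \<le> y \<Longrightarrow> f x \<le> C * (y / x) powr (\<rho> + \<eta>) * f y"
    by (rule potter_bounds[OF rv eta]) (rule that)
  obtain H where H: "H \<ge> 0" "\<And>u. u > 0 \<Longrightarrow> f u \<le> H / min (u\<^sup>2) 1"
    using levy_tail_markov[OF R] unfolding f_def by blast
  have f0: "f r0 > 0" using pos p(1) by simp
  define A where "A = C + H * r0\<^sup>2 * C / f r0"
  have A: "A \<ge> 0" "C \<le> A" "H * r0\<^sup>2 * C / f r0 \<le> A" using p(1,2) H(1) f0 by (auto simp: A_def)
  have main: "f (r / t) / f r \<le> A * (t powr (\<rho> - \<eta>) + t powr (\<rho> + \<eta>) + t powr (\<rho> + \<eta> + 2))"
    if r: "r \<ge> r0" and t: "t > 0" for r t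
  proof -
    have r1: "r \<ge> 1" "r > 0" using r p(1) by auto
    have fr: "f r > 0" using pos r1 by simp
    have le1: "x \<le> A * (t powr (\<rho> - \<eta>) + t powr (\<rho> + \<eta>) + t powr (\<rho> + \<eta> + 2))"
      if "x \<le> A * t powr (\<rho> - \<eta>) \<or> x \<le> A * t powr (\<rho> + \<eta>) \<or> x \<le> A * t powr (\<rho> + \<eta> + 2)" for x
    proof -
      have "0 \<le> A * t powr (\<rho> - \<eta>)" "0 \<le> A * t powr (\<rho> + \<eta>)" "0 \<le> A * t powr (\<rho> + \<eta> + 2)" using A by auto
      then show ?thesis using that unfolding distrib_left by linarith
    qed
    show ?thesis
    proof (cases "t \<le> 1")
      case True
      then have "r \<le> r / t" using t r1 by (simp add: le_divide_eq mult_le_cancel_left1)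
      then have "f (r / t) \<le> C * (r / (r / t)) powr (\<rho> - \<eta>) * f r" by (rule p(3)[OF r])
      then have "f (r / t) / f r \<le> C * t powr (\<rho> - \<eta>)" using fr r1 t by (simp add: divide_le_eq)
      also have "\<dots> \<le> A * t powr (\<rho> - \<eta>)" using A by (intro mult_right_mono) auto
      finally show ?thesis by (intro le1) auto
    next
      case False
      show ?thesis
      proof (cases "r / t \<ge> r0")
        case True
        have "r / t \<le> r" using False r1 by (simp add: divide_le_eq mult_le_cancel_left1)
        then have "f (r / t) \<le> C * (r / (r / t)) powr (\<rho> + \<eta>) * f r" by (rule p(4)[OF True])
        then have "f (r / t) / f r \<le> C * t powr (\<rho> + \<eta>)" using fr r1 t by (simp add: divide_le_eq)
        also have "\<dots> \<le> A * t powr (\<rho> + \<eta>)" using A by (intro mult_right_mono) auto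
        finally show ?thesis by (intro le1) auto
      next
        case small: False
        then have rt: "r < r0 * t" using t by (simp add: divide_less_eq not_le)
        have u: "r / t > 0" using r1 t by simp
        have "f (r / t) \<le> H / min ((r / t)\<^sup>2) 1" by (rule H(2)[OF u])
        also have "\<dots> \<le> H * (r0\<^sup>2 * t\<^sup>2)"
        proof -
          have "1 \<le> min ((r / t)\<^sup>2) 1 * (r0\<^sup>2 * t\<^sup>2)"
          proof (cases "(r / t)\<^sup>2 \<le> 1")
            case True
            have "1 * 1 \<le> r\<^sup>2 * r0\<^sup>2" using r1 p(1) by (intro mult_mono) auto
            then show ?thesis using True t by (simp add: power_divide)
          next
            case False
            have "1 \<le> r0 * t" using p(1) \<open>\<not> t \<le> 1\<close> mult_mono[of 1 r0 1 t] by simp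
            then have "1 \<le> (r0 * t)\<^sup>2" by simp
            then show ?thesis using False by (simp add: power_mult_distrib)
          qed
          then have "H * 1 \<le> H * (min ((r / t)\<^sup>2) 1 * (r0\<^sup>2 * t\<^sup>2))" using H(1) by (rule mult_left_mono)
          then show ?thesis using u r1 by (simp add: divide_le_eq mult_ac)
        qed
        finally have 1: "f (r / t) \<le> H * r0\<^sup>2 * t powr 2" using t by (simp add: powr_numeral mult_ac)
        have "f r0 \<le> C * (r / r0) powr (\<rho> + \<eta>) * f r" by (rule p(4)[OF order_refl r])
        also have "\<dots> \<le> C * t powr (\<rho> + \<eta>) * f r"
          using rt p(1,2) r1 fr eta t by (intro mult_right_mono mult_left_mono powr_mono2) (auto simp: divide_le_eq mult.commute)
        finally have 2: "1 / f r \<le> C / f r0 * t powr (\<rho> + \<eta>)" using fr f0 by (simp add: field_simps)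
        have "f (r / t) / f r = f (r / t) * (1 / f r)" by simp
        also have "\<dots> \<le> (H * r0\<^sup>2 * t powr 2) * (C / f r0 * t powr (\<rho> + \<eta>))"
          using 1 2 fr H(1) by (intro mult_mono) auto
        also have "\<dots> = (H * r0\<^sup>2 * C / f r0) * t powr (\<rho> + \<eta> + 2)" by (simp add: powr_add mult_ac)
        also have "\<dots> \<le> A * t powr (\<rho> + \<eta> + 2)" using A by (intro mult_right_mono) auto
        finally show ?thesis by (intro le1) auto
      qed
    qed
  qed
  show thesis
    using A(1) main by (intro that[of A] eventually_mono[OF eventually_ge_at_top[of r0]]) (auto simp: f_def)
qed

context
  fixes R :: "'a::euclidean_space measure" and p \<alpha> \<rho> :: real
  assumes R: "levy_measure R" and M: "levy_measure (TS_levy_measure p \<alpha> R)"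
    and p: "p > 0" and rho: "\<rho> > max \<alpha> 0"
begin

text \<open>
  Dominated convergence. The lower exponent \<open>\<rho> - \<eta>\<close> of the dominating function must stay above \<open>\<alpha>\<close>
  for integrability at \<open>0\<close>; such an \<open>\<eta> > 0\<close> exists because \<open>\<rho> > max \<alpha> 0\<close>.
\<close>

lemma tempered_tail_abelian:
  assumes f: "rv_function (\<lambda>r. measure R {x. norm x > r}) \<rho>" and D: "D \<in> sets borel"
    and lim: "\<And>t. t > 0 \<Longrightarrow> ((\<lambda>r. measure R (directional_tail (r * t) D) / measure R {x. norm x > r}) \<longlongrightarrow> t powr (- \<rho>) * c) at_top"
  shows "((\<lambda>r. measure (TS_levy_measure p \<alpha> R) (directional_tail r D) / measure R {x. norm x > r}) \<longlongrightarrow>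
      c * (Gamma ((\<rho> - \<alpha>) / p) / p)) at_top"
proof -
  define f where "f r = measure R {x. norm x > r}" for r
  define \<eta> where "\<eta> = (\<rho> - max \<alpha> 0) / 2"
  have eta: "0 < \<eta>" "\<eta> \<le> \<rho>" "\<alpha> < \<rho> - \<eta>" using rho by (auto simp: \<eta>_def max_def field_simps)
  obtain A where A: "A \<ge> 0"
    "\<forall>\<^sub>F r in at_top. \<forall>t>0. f (r / t) / f r \<le> A * (t powr (\<rho> - \<eta>) + t powr (\<rho> + \<eta>) + t powr (\<rho> + \<eta> + 2))"
    using scaled_tail_domination[OF R assms(1) eta(1,2)] unfolding f_def by blast
  define w where "w t = A * (t powr (\<rho> - \<eta>) + t powr (\<rho> + \<eta>) + t powr (\<rho> + \<eta> + 2))" for t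
  define s where "s r t = (if r > 0 then scaled_tail R r D t / f r else 0)" for r t
  have "((\<lambda>r. \<integral>t. s r t \<partial>tempering p \<alpha>) \<longlongrightarrow> (\<integral>t. c * t powr \<rho> \<partial>tempering p \<alpha>)) at_top"
  proof (rule integral_dominated_convergence_at_top[where w=w])
    show "(\<lambda>t. c * t powr \<rho>) \<in> borel_measurable (tempering p \<alpha>)" by measurable
    show "s r \<in> borel_measurable (tempering p \<alpha>)" for r
    proof (cases "r > 0")
      case True
      note [measurable] = scaled_tail_measurable[OF R True D]
      show ?thesis using True unfolding s_def by simp
    qed (simp add: s_def[abs_def])
    show "integrable (tempering p \<alpha>) w" unfolding w_def
      using eta by (intro integrable_mult_right Bochner_Integration.integrable_add tempering_power p) auto
    show "AE t in tempering p \<alpha>. ((\<lambda>r. s r t) \<longlongrightarrow> c * t powr \<rho>) at_top"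
      using AE_tempering_pos
    proof eventually_elim
      case (elim t)
      have "((\<lambda>r. measure R (directional_tail (r * (1 / t)) D) / f r) \<longlongrightarrow> (1 / t) powr (- \<rho>) * c) at_top"
        unfolding f_def using elim by (intro lim) simp
      moreover have "(1 / t) powr (- \<rho>) * c = c * t powr \<rho>" using elim by (simp add: powr_divide powr_minus_divide)
      moreover have "\<forall>\<^sub>F r in at_top. measure R (directional_tail (r * (1 / t)) D) / f r = s r t"
        by (rule eventually_mono[OF eventually_gt_at_top[of 0]]) (use elim in \<open>simp add: s_def scaled_tail_pos\<close>)
      ultimately show ?case by (auto intro: Lim_transform_eventually)
    qed
    show "\<forall>\<^sub>F r in at_top. AE t in tempering p \<alpha>. norm (s r t) \<le> w t"
      using A(2) eventually_gt_at_top[of 0]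
    proof eventually_elim
      case (elim r)
      show ?case using AE_tempering_pos
      proof eventually_elim
        case t: (elim t)
        have "scaled_tail R r D t \<le> f (r / t)"
          unfolding scaled_tail_pos[OF t] f_def
          using elim t levy_tail_finite[OF R, of "r / t"] directional_tail_borel[OF D]
          by (intro measure_mono_fmeasurable directional_tail_subset) (auto simp: sets_levy[OF R] fmeasurable_def)
        then have "s r t \<le> f (r / t) / f r" using elim by (simp add: s_def divide_right_mono f_def)
        also have "\<dots> \<le> w t" using elim t by (simp add: w_def)
        finally show ?case by (simp add: s_def scaled_tail_nonneg f_def)
      qed
    qed
  qed
  moreover have "(\<integral>t. c * t powr \<rho> \<partial>tempering p \<alpha>) = c * (Gamma ((\<rho> - \<alpha>) / p) / p)"
    using tempering_power[OF p, of \<alpha> \<rho>] rho by simp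
  moreover have "\<forall>\<^sub>F r in at_top. (\<integral>t. s r t \<partial>tempering p \<alpha>) = measure (TS_levy_measure p \<alpha> R) (directional_tail r D) / f r"
    by (rule eventually_mono[OF eventually_gt_at_top[of 0]])
      (simp add: s_def scaled_tail_integral(2)[OF R M _ D])
  ultimately show ?thesis unfolding f_def by (auto intro: Lim_transform_eventually)
qed

end

text \<open>
  Karamata's method. The integrals against powers of \<open>exp(-t^p)\<close> determine, by the Weierstrass theorem,
  the limits of the integrals against all continuous functions of \<open>exp(-t^p)\<close>. Testing with functions supported
  in a small interval to the left or to the right of \<open>t\<close> and using monotonicity pins down the value at a point
  of continuity.
\<close>

lemma monotone_from_exponential_moments:
  fixes K :: "real measure" and \<Psi> :: "real \<Rightarrow> real \<Rightarrow> real" and \<Phi> :: "real \<Rightarrow> real"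
  assumes sK: "sets K = sets borel" and K0: "AE t in K. t > 0"
    and Kpos: "\<And>a b. 0 < a \<Longrightarrow> a < b \<Longrightarrow> emeasure K {a<..<b} \<noteq> 0"
    and p: "p > 0"
    and int: "\<And>r. r > 0 \<Longrightarrow> integrable K (\<Psi> r)" and intP: "integrable K \<Phi>"
    and nn: "\<And>r t. r > 0 \<Longrightarrow> 0 \<le> \<Psi> r t" and nnP: "\<And>t. 0 \<le> \<Phi> t"
    and mono: "\<And>r s t. r > 0 \<Longrightarrow> 0 < s \<Longrightarrow> s \<le> t \<Longrightarrow> \<Psi> r s \<le> \<Psi> r t"
    and monoP: "\<And>s t. 0 < s \<Longrightarrow> s \<le> t \<Longrightarrow> \<Phi> s \<le> \<Phi> t"
    and mom: "\<And>j::nat. ((\<lambda>r. \<integral>t. \<Psi> r t * exp (- (t powr p)) ^ j \<partial>K) \<longlongrightarrow> (\<integral>t. \<Phi> t * exp (- (t powr p)) ^ j \<partial>K)) at_top"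
    and t: "t > 0" and cont: "isCont \<Phi> t"
    and Kfin: "\<And>a b. 0 < a \<Longrightarrow> a < b \<Longrightarrow> emeasure K {a..b} < \<infinity>"
  shows "((\<lambda>r. \<Psi> r t) \<longlongrightarrow> \<Phi> t) at_top"
proof -
  define y where "y t = exp (- (t powr p))" for t
  have ym[measurable]: "y \<in> borel_measurable borel" unfolding y_def by measurable
  note [measurable_cong] = sK
  have y01: "0 < y t" "y t \<le> 1" for t by (auto simp: y_def)
  have ymono: "y b < y a" if "0 < a" "a < b" for a b using that p by (auto simp: y_def intro: powr_less_mono2)
  have bdd_int: "integrable K (\<lambda>t. g t * h (y t))"
    if g: "integrable K g" and h: "continuous_on {0..1} h" for g h :: "real \<Rightarrow> real"
  proof -
    have "compact (h ` {0..1})" using h by (intro compact_continuous_image) auto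
    then obtain B where B: "\<And>u. u \<in> {0..1} \<Longrightarrow> norm (h u) \<le> B"
      using compact_imp_bounded bounded_iff by (metis imageI)
    define h' where "h' u = h (max 0 (min 1 u))" for u
    have h': "continuous_on UNIV h'" unfolding h'_def
      by (rule continuous_on_compose2[OF h]) (auto intro!: continuous_intros)
    then have [measurable]: "h' \<in> borel_measurable borel" by (rule borel_measurable_continuous_onI)
    have eq: "h (y t) = h' (y t)" for t using y01[of t] by (simp add: h'_def)
    have [measurable]: "g \<in> borel_measurable K" using g by auto
    have "integrable K (\<lambda>t. B * g t)" using g by simp
    then show ?thesis unfolding eq
    proof (rule Bochner_Integration.integrable_bound)
      show "AE t in K. norm (g t * h' (y t)) \<le> norm (B * g t)"
      proof (rule AE_I2)
        fix t
        have hb: "norm (h' (y t)) \<le> B" using B[of "y t"] y01[of t] unfolding eq[symmetric] by auto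
        then have "norm (g t) * norm (h' (y t)) \<le> norm (g t) * \<bar>B\<bar>" by (intro mult_left_mono) auto
        then show "norm (g t * h' (y t)) \<le> norm (B * g t)" by (simp add: abs_mult mult.commute)
      qed
    qed measurable
  qed
  \<comment> \<open>Polynomials in \<open>y\<close>: linear combinations of the assumed limits.\<close>
  have poly: "((\<lambda>r. \<integral>t. \<Psi> r t * q (y t) \<partial>K) \<longlongrightarrow> (\<integral>t. \<Phi> t * q (y t) \<partial>K)) at_top"
    if q: "real_polynomial_function q" for q
  proof -
    obtain a n where a: "q = (\<lambda>x. \<Sum>i\<le>n. a i * x ^ i)" using q real_polynomial_function_iff_sum by blast
    have e: "(\<integral>t. g t * q (y t) \<partial>K) = (\<Sum>i\<le>n. a i * (\<integral>t. g t * y t ^ i \<partial>K))" if g: "integrable K g" for g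
    proof -
      have i: "integrable K (\<lambda>t. g t * y t ^ i)" for i
        by (rule bdd_int[OF g]) (intro continuous_intros)
      have "(\<integral>t. g t * q (y t) \<partial>K) = (\<integral>t. (\<Sum>i\<le>n. a i * (g t * y t ^ i)) \<partial>K)"
        unfolding a by (simp add: sum_distrib_left mult_ac)
      also have "\<dots> = (\<Sum>i\<le>n. a i * (\<integral>t. g t * y t ^ i \<partial>K))"
        using i by (subst Bochner_Integration.integral_sum) auto
      finally show ?thesis .
    qed
    have "((\<lambda>r. \<Sum>i\<le>n. a i * (\<integral>t. \<Psi> r t * y t ^ i \<partial>K)) \<longlongrightarrow> (\<Sum>i\<le>n. a i * (\<integral>t. \<Phi> t * y t ^ i \<partial>K))) at_top"
      using mom by (intro tendsto_intros) (simp add: y_def)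
    moreover have "\<forall>\<^sub>F r in at_top. (\<Sum>i\<le>n. a i * (\<integral>t. \<Psi> r t * y t ^ i \<partial>K)) = (\<integral>t. \<Psi> r t * q (y t) \<partial>K)"
      by (rule eventually_mono[OF eventually_gt_at_top[of 0]]) (simp add: e int)
    ultimately show ?thesis unfolding e[OF intP] by (rule Lim_transform_eventually)
  qed
  have mass: "((\<lambda>r. \<integral>t. \<Psi> r t \<partial>K) \<longlongrightarrow> (\<integral>t. \<Phi> t \<partial>K)) at_top" using mom[of 0] by simp
  have weier: "((\<lambda>r. \<integral>t. \<Psi> r t * h (y t) \<partial>K) \<longlongrightarrow> (\<integral>t. \<Phi> t * h (y t) \<partial>K)) at_top"
    if h: "continuous_on {0..1} h" for h
  proof (rule tendstoI)
    fix e :: real assume e: "e > 0"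
    define m where "m = (\<integral>t. \<Phi> t \<partial>K) + 1"
    have m: "m > 0" using nnP by (simp add: m_def add_nonneg_pos)
    \<comment> \<open>\<open>m\<close> eventually bounds the total integrals, so a uniform error \<open>e / (3 m)\<close> contributes at most \<open>e / 3\<close>.\<close>
    obtain q where q: "real_polynomial_function q" "\<And>u. u \<in> {0..1} \<Longrightarrow> \<bar>h u - q u\<bar> < e / (3 * m)"
      using Stone_Weierstrass_real_polynomial_function[OF compact_Icc h, of "e / (3 * m)"] e m by auto
    have qc: "continuous_on {0..1} q"
      using q(1) by (auto simp: real_polynomial_function_iff_sum intro!: continuous_intros)
    have close: "\<bar>(\<integral>t. g t * h (y t) \<partial>K) - (\<integral>t. g t * q (y t) \<partial>K)\<bar> \<le> e / 3"
      if g: "integrable K g" "\<And>t. 0 \<le> g t" "(\<integral>t. g t \<partial>K) \<le> m" for g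
    proof -
      have "(\<integral>t. g t * h (y t) \<partial>K) - (\<integral>t. g t * q (y t) \<partial>K) = (\<integral>t. g t * h (y t) - g t * q (y t) \<partial>K)"
        by (rule Bochner_Integration.integral_diff[symmetric]) (intro bdd_int g h qc)+
      also have "\<bar>\<dots>\<bar> \<le> (\<integral>t. \<bar>g t * h (y t) - g t * q (y t)\<bar> \<partial>K)" by (rule integral_abs_bound)
      also have "\<dots> \<le> (\<integral>t. (e / (3 * m)) * g t \<partial>K)"
      proof (rule integral_mono)
        show "integrable K (\<lambda>t. \<bar>g t * h (y t) - g t * q (y t)\<bar>)"
          by (intro integrable_abs Bochner_Integration.integrable_diff bdd_int g h qc)
        show "integrable K (\<lambda>t. (e / (3 * m)) * g t)" using g by simp
        fix t
        have "\<bar>g t * h (y t) - g t * q (y t)\<bar> = g t * \<bar>h (y t) - q (y t)\<bar>"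
          using g(2)[of t] by (simp add: right_diff_distrib[symmetric] abs_mult)
        also have "\<dots> \<le> g t * (e / (3 * m))"
          using q(2)[of "y t"] y01[of t] g(2) by (intro mult_left_mono) auto
        finally show "\<bar>g t * h (y t) - g t * q (y t)\<bar> \<le> (e / (3 * m)) * g t" by (simp add: mult.commute)
      qed
      also have "\<dots> = (e / (3 * m)) * (\<integral>t. g t \<partial>K)" by simp
      also have "\<dots> \<le> (e / (3 * m)) * m" using g(3) e m by (intro mult_left_mono) auto
      also have "\<dots> = e / 3" using m by simp
      finally show ?thesis .
    qed
    have "\<forall>\<^sub>F r in at_top. (\<integral>t. \<Psi> r t \<partial>K) < m" using mass by (rule order_tendstoD) (simp add: m_def)
    moreover have "\<forall>\<^sub>F r in at_top. dist (\<integral>t. \<Psi> r t * q (y t) \<partial>K) (\<integral>t. \<Phi> t * q (y t) \<partial>K) < e / 3"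
      using poly[OF q(1)] e by (intro tendstoD) auto
    ultimately show "\<forall>\<^sub>F r in at_top. dist (\<integral>t. \<Psi> r t * h (y t) \<partial>K) (\<integral>t. \<Phi> t * h (y t) \<partial>K) < e"
      using eventually_gt_at_top[of 0]
    proof eventually_elim
      case (elim r)
      have "\<bar>(\<integral>t. \<Psi> r t * h (y t) \<partial>K) - (\<integral>t. \<Psi> r t * q (y t) \<partial>K)\<bar> \<le> e / 3"
        using elim by (intro close int nn) auto
      moreover have "\<bar>(\<integral>t. \<Phi> t * h (y t) \<partial>K) - (\<integral>t. \<Phi> t * q (y t) \<partial>K)\<bar> \<le> e / 3"
        by (intro close intP nnP) (simp add: m_def)
      ultimately show ?case using elim unfolding dist_real_def by linarith
    qed
  qed
  \<comment> \<open>A continuous function of \<open>y t\<close> that is positive exactly for \<open>a < t < b\<close>, \<open>y\<close> being decreasing.\<close>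
  define h where "h a b u = max 0 ((u - y b) * (y a - u))" for a b u
  have hc: "continuous_on {0..1} (h a b)" for a b unfolding h_def by (intro continuous_intros)
  have hpos: "h a b (y t) > 0 \<longleftrightarrow> t \<in> {a<..<b}" if "0 < a" "a < b" "t > 0" for a b t
  proof
    assume "t \<in> {a<..<b}"
    then show "h a b (y t) > 0" using that ymono[of a t] ymono[of t b] by (auto simp: h_def)
  next
    assume "h a b (y t) > 0"
    then have *: "(y t - y b) * (y a - y t) > 0" by (simp add: h_def less_max_iff_disj)
    have yab: "y b < y a" using ymono that by simp
    have "y b < y t" "y t < y a" using * yab by (auto simp: zero_less_mult_iff)
    then show "t \<in> {a<..<b}"
      using ymono[of t a] ymono[of b t] that by (cases t a rule: linorder_cases; cases t b rule: linorder_cases) auto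
  qed
  have h0: "0 \<le> h a b u" for a b u by (simp add: h_def)
  have hint: "integrable K (\<lambda>t. h a b (y t))" "(\<integral>t. h a b (y t) \<partial>K) > 0" if ab: "0 < a" "a < b" for a b
  proof -
    have [measurable]: "(\<lambda>t. h a b (y t)) \<in> borel_measurable K" unfolding h_def by measurable
    have "integrable K (indicator {a..b} :: real \<Rightarrow> real)" using Kfin[OF ab] by (simp add: sK)
    then have "integrable K (\<lambda>t. 1 * indicator {a..b} t :: real)" by simp
    then show i: "integrable K (\<lambda>t. h a b (y t))"
    proof (rule Bochner_Integration.integrable_bound)
      show "AE t in K. norm (h a b (y t)) \<le> norm (1 * indicator {a..b} t :: real)"
        using K0
      proof eventually_elim
        case (elim t)
        show ?case
        proof (cases "t \<in> {a<..<b}")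
          case True
          have "(y t - y b) * (y a - y t) \<le> 1 * 1"
            using y01[of a] y01[of b] y01[of t] ymono[of a t] True ab by (intro mult_mono) auto
          then show ?thesis using True by (simp add: h_def)
        next
          case False
          then have "h a b (y t) = 0" using hpos[OF ab elim] h0[of a b "y t"] by linarith
          then show ?thesis by simp
        qed
      qed
    qed measurable
    show "(\<integral>t. h a b (y t) \<partial>K) > 0"
    proof (rule ccontr)
      assume "\<not> ?thesis"
      then have "(\<integral>t. h a b (y t) \<partial>K) = 0"
        using Bochner_Integration.integral_nonneg[of K "\<lambda>t. h a b (y t)"] h0 by fastforce
      then have "AE t in K. h a b (y t) = 0"
        using integral_nonneg_eq_0_iff_AE[OF i] h0 by simp
      with K0 have "AE t in K. \<not> (t \<in> {a<..<b})"
      proof eventually_elim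
        case (elim t)
        then show ?case using hpos[OF ab, of t] by auto
      qed
      then have "emeasure K {t \<in> space K. t \<in> {a<..<b}} = 0" by (rule emeasure_eq_0_AE)
      moreover have "{t \<in> space K. t \<in> {a<..<b}} = {a<..<b}"
        using sets_eq_imp_space_eq[OF sK] by auto
      ultimately show False using Kpos[OF ab] by simp
    qed
  qed
  have tent_mono: "(\<integral>x. g1 x * h a b (y x) \<partial>K) \<le> (\<integral>x. g2 x * h a b (y x) \<partial>K)"
    if ab: "0 < a" "a < b" and le: "\<And>x. a < x \<Longrightarrow> x < b \<Longrightarrow> g1 x \<le> g2 x"
      and g: "integrable K (\<lambda>x. g1 x * h a b (y x))" "integrable K (\<lambda>x. g2 x * h a b (y x))" for a b g1 g2
  proof (rule integral_mono_AE[OF g])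
    show "AE x in K. g1 x * h a b (y x) \<le> g2 x * h a b (y x)"
      using K0
    proof eventually_elim
      case (elim x)
      show ?case
      proof (cases "x \<in> {a<..<b}")
        case True
        then show ?thesis using le h0 by (intro mult_right_mono) auto
      next
        case False
        then have "h a b (y x) = 0" using hpos[OF ab elim] h0[of a b "y x"] by linarith
        then show ?thesis by simp
      qed
    qed
  qed
  have near: "\<exists>d>0. \<forall>x. \<bar>x - t\<bar> < d \<longrightarrow> P (\<Phi> x)" if "\<forall>\<^sub>F x in nhds (\<Phi> t). P x" for P
  proof -
    have "\<forall>\<^sub>F x in nhds t. P (\<Phi> x)"
      using cont that by (auto simp: isCont_def tendsto_at_iff_tendsto_nhds intro: eventually_compose_filterlim)
    then show ?thesis by (auto simp: eventually_nhds_metric dist_real_def)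
  qed
  show ?thesis
  proof (rule order_tendstoI)
    fix a0 assume "a0 < \<Phi> t"
    then have "\<forall>\<^sub>F x in nhds (\<Phi> t). a0 < x" by (rule eventually_nhds_in_open[of "{a0<..}", simplified])
    then obtain d where d: "d > 0" "\<And>x. \<bar>x - t\<bar> < d \<Longrightarrow> a0 < \<Phi> x" using near by blast
    define s where "s = max (t / 2) (t - d / 2)"
    have s: "0 < s" "s < t" "a0 < \<Phi> s" using t d(1) by (auto simp: s_def intro!: d(2))
    note H = hint[OF s(1,2)]
    have "a0 * (\<integral>x. h s t (y x) \<partial>K) < \<Phi> s * (\<integral>x. h s t (y x) \<partial>K)" using s(3) H(2) by (rule mult_strict_right_mono)
    also have "\<dots> = (\<integral>x. \<Phi> s * h s t (y x) \<partial>K)" by simp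
    also have "\<dots> \<le> (\<integral>x. \<Phi> x * h s t (y x) \<partial>K)"
      using H(1) bdd_int[OF intP hc] monoP s(1,2) by (intro tent_mono) auto
    finally have "\<forall>\<^sub>F r in at_top. a0 * (\<integral>x. h s t (y x) \<partial>K) < (\<integral>x. \<Psi> r x * h s t (y x) \<partial>K)"
      using weier[OF hc] by (rule order_tendstoD(1)[rotated])
    then show "\<forall>\<^sub>F r in at_top. a0 < \<Psi> r t"
      using eventually_gt_at_top[of 0]
    proof eventually_elim
      case (elim r)
      have "(\<integral>x. \<Psi> r x * h s t (y x) \<partial>K) \<le> (\<integral>x. \<Psi> r t * h s t (y x) \<partial>K)"
        using H(1) bdd_int[OF int hc] mono elim s(1,2) by (intro tent_mono) auto
      also have "\<dots> = \<Psi> r t * (\<integral>x. h s t (y x) \<partial>K)" by simp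
      finally have "a0 * (\<integral>x. h s t (y x) \<partial>K) < \<Psi> r t * (\<integral>x. h s t (y x) \<partial>K)" using elim by linarith
      then show ?case using H(2) by (simp add: mult_less_cancel_right)
    qed
  next
    fix a0 assume "\<Phi> t < a0"
    then have "\<forall>\<^sub>F x in nhds (\<Phi> t). x < a0" by (rule eventually_nhds_in_open[of "{..<a0}", simplified])
    then obtain d where d: "d > 0" "\<And>x. \<bar>x - t\<bar> < d \<Longrightarrow> \<Phi> x < a0" using near by blast
    define s where "s = t + d / 2"
    have s: "t < s" "\<Phi> s < a0" using t d(1) by (auto simp: s_def intro!: d(2))
    note H = hint[OF t s(1)]
    have "(\<integral>x. \<Phi> x * h t s (y x) \<partial>K) \<le> (\<integral>x. \<Phi> s * h t s (y x) \<partial>K)"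
      using H(1) bdd_int[OF intP hc] monoP s(1) t by (intro tent_mono) auto
    also have "\<dots> = \<Phi> s * (\<integral>x. h t s (y x) \<partial>K)" by simp
    also have "\<dots> < a0 * (\<integral>x. h t s (y x) \<partial>K)" using s(2) H(2) by (rule mult_strict_right_mono)
    finally have "\<forall>\<^sub>F r in at_top. (\<integral>x. \<Psi> r x * h t s (y x) \<partial>K) < a0 * (\<integral>x. h t s (y x) \<partial>K)"
      using weier[OF hc] by (rule order_tendstoD(2)[rotated])
    then show "\<forall>\<^sub>F r in at_top. \<Psi> r t < a0"
      using eventually_gt_at_top[of 0]
    proof eventually_elim
      case (elim r)
      have "\<Psi> r t * (\<integral>x. h t s (y x) \<partial>K) = (\<integral>x. \<Psi> r t * h t s (y x) \<partial>K)" by simp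
      also have "\<dots> \<le> (\<integral>x. \<Psi> r x * h t s (y x) \<partial>K)"
        using H(1) bdd_int[OF int hc] mono elim s(1) t by (intro tent_mono) auto
      finally have "\<Psi> r t * (\<integral>x. h t s (y x) \<partial>K) < a0 * (\<integral>x. h t s (y x) \<partial>K)" using elim by linarith
      then show ?case using H(2) by (simp add: mult_less_cancel_right)
    qed
  qed
qed

section \<open>Tempered stable distributions\<close>

text \<open>
  The dilation by \<open>l = (j+1)^(1/p)\<close> produces exactly the \<open>j\<close>-th power of \<open>exp(-t^p)\<close> as a weight.
\<close>

lemma tempering_exponential_moment:
  fixes g :: "real \<Rightarrow> real" and j :: nat
  assumes p: "p > 0" and g[measurable]: "g \<in> borel_measurable borel" and nn: "\<And>t. 0 \<le> g t"
  defines "l \<equiv> real (Suc j) powr (1 / p)"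
  shows "(\<integral>t. g (t / l) \<partial>tempering p \<alpha>) = l powr (- \<alpha>) * (\<integral>t. g t * exp (- (t powr p)) ^ j \<partial>tempering p \<alpha>)"
proof -
  have l: "l > 0" by (simp add: l_def)
  have lp: "l powr p - 1 = real j" using p by (simp add: l_def powr_powr)
  have e: "exp (- ((l powr p - 1) * t powr p)) = exp (- (t powr p)) ^ j" for t
    unfolding lp by (simp add: exp_of_nat_mult[symmetric])
  have "(\<integral>t. g (t / l) \<partial>tempering p \<alpha>) = enn2real (\<integral>\<^sup>+t. ennreal (g (t / l)) \<partial>tempering p \<alpha>)"
    by (rule integral_eq_nn_integral) (auto simp: nn)
  also have "(\<integral>\<^sup>+t. ennreal (g (t / l)) \<partial>tempering p \<alpha>) =
     ennreal (l powr (- \<alpha>)) * (\<integral>\<^sup>+t. ennreal (g t) * ennreal (exp (- (t powr p)) ^ j) \<partial>tempering p \<alpha>)"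
    using tempering_scaling[OF p l, of "\<lambda>t. ennreal (g t)" \<alpha>] unfolding e by simp
  also have "(\<integral>\<^sup>+t. ennreal (g t) * ennreal (exp (- (t powr p)) ^ j) \<partial>tempering p \<alpha>) =
      (\<integral>\<^sup>+t. ennreal (g t * exp (- (t powr p)) ^ j) \<partial>tempering p \<alpha>)"
    by (intro nn_integral_cong) (simp add: ennreal_mult nn)
  also have "enn2real (ennreal (l powr (- \<alpha>)) * \<dots>) = l powr (- \<alpha>) * enn2real (\<integral>\<^sup>+t. ennreal (g t * exp (- (t powr p)) ^ j) \<partial>tempering p \<alpha>)"
    by (simp add: enn2real_mult)
  also have "enn2real (\<integral>\<^sup>+t. ennreal (g t * exp (- (t powr p)) ^ j) \<partial>tempering p \<alpha>) =
      (\<integral>t. g t * exp (- (t powr p)) ^ j \<partial>tempering p \<alpha>)"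
    by (rule integral_eq_nn_integral[symmetric]) (auto simp: nn)
  finally show ?thesis .
qed

lemma tempering_compact_finite:
  assumes p: "p > 0" and \<alpha>: "\<beta> > \<alpha>" "\<beta> \<ge> 0" and ab: "0 < a"
  shows "emeasure (tempering p \<alpha>) {a..b} < \<infinity>"
proof -
  have "emeasure (tempering p \<alpha>) {a..b} = (\<integral>\<^sup>+t. indicator {a..b} t \<partial>tempering p \<alpha>)" by simp
  also have "\<dots> \<le> (\<integral>\<^sup>+t. ennreal (a powr (- \<beta>)) * ennreal (t powr \<beta>) \<partial>tempering p \<alpha>)"
  proof (intro nn_integral_mono)
    fix t
    show "indicator {a..b} t \<le> ennreal (a powr (- \<beta>)) * ennreal (t powr \<beta>)"
    proof (cases "t \<in> {a..b}")
      case True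
      have "a powr (- \<beta>) * a powr \<beta> \<le> a powr (- \<beta>) * t powr \<beta>"
        using True ab \<alpha> by (intro mult_left_mono powr_mono2) auto
      then have "1 \<le> a powr (- \<beta>) * t powr \<beta>" using ab by (simp add: powr_add[symmetric])
      then show ?thesis using True by (simp add: ennreal_mult[symmetric])
    qed simp
  qed
  also have "\<dots> = ennreal (a powr (- \<beta>)) * ennreal (Gamma ((\<beta> - \<alpha>) / p) / p)"
    by (subst nn_integral_cmult) (auto simp: nn_integral_tempering_power[OF p \<alpha>(1)])
  also have "\<dots> < \<infinity>" by (simp add: ennreal_mult_less_top)
  finally show ?thesis .
qed

text \<open>
  The limit function is \<open>t \<mapsto> (c/G) t\<^sup>\<rho>\<close> with \<open>G\<close> the \<open>\<rho>\<close>-th moment of the kernel; its weighted integrals are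
  computed by the same dilation as those of the tails.
\<close>

lemma tempered_tail_tauberian:
  fixes R :: "'a::euclidean_space measure"
  assumes R: "levy_measure R" and M: "levy_measure (TS_levy_measure p \<alpha> R)"
    and p: "p > 0" and rho: "\<rho> > max \<alpha> 0"
    and f: "\<And>r. r > 0 \<Longrightarrow> f r > 0" and c: "c \<ge> 0" and D: "D \<in> sets borel"
    and lim: "\<And>t. t > 0 \<Longrightarrow> ((\<lambda>r. measure (TS_levy_measure p \<alpha> R) (directional_tail (r * t) D) / f r) \<longlongrightarrow> t powr (- \<rho>) * c) at_top"
    and t: "t > 0"
  shows "((\<lambda>r. measure R (directional_tail (r * t) D) / f r) \<longlongrightarrow> p / Gamma ((\<rho> - \<alpha>) / p) * t powr (- \<rho>) * c) at_top"
proof -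
  let ?K = "tempering p \<alpha>"
  define G where "G = Gamma ((\<rho> - \<alpha>) / p) / p"
  have ra: "\<rho> > \<alpha>" "\<rho> > 0" using rho by auto
  have G: "G > 0" using p ra by (simp add: G_def Gamma_real_pos)
  define \<Psi> where "\<Psi> r s = scaled_tail R r D s / f r" for r s
  define \<Phi> where "\<Phi> s = (c / G) * s powr \<rho>" for s
  have "((\<lambda>r. \<Psi> r (1 / t)) \<longlongrightarrow> \<Phi> (1 / t)) at_top"
  proof (rule monotone_from_exponential_moments[where K="?K" and p=p and \<Psi>=\<Psi> and \<Phi>=\<Phi> and t="1 / t"])
    show "sets ?K = sets borel" by simp
    show "AE s in ?K. s > 0" by (rule AE_tempering_pos)
    show "emeasure ?K {a<..<b} \<noteq> 0" if "0 < a" "a < b" for a b by (rule tempering_interval_pos[OF that])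
    show "p > 0" by (rule p)
    show "integrable ?K (\<Psi> r)" if "r > 0" for r
      unfolding \<Psi>_def using scaled_tail_integral(1)[OF R M that D] by simp
    show "integrable ?K \<Phi>" unfolding \<Phi>_def by (intro integrable_mult_right tempering_power p ra)
    show "0 \<le> \<Psi> r s" if "r > 0" for r s using f[OF that] by (simp add: \<Psi>_def scaled_tail_nonneg)
    show "0 \<le> \<Phi> s" for s using c G by (simp add: \<Phi>_def)
    show "\<Psi> r s \<le> \<Psi> r u" if "r > 0" "0 < s" "s \<le> u" for r s u
      unfolding \<Psi>_def using f[OF that(1)] scaled_tail_mono[OF R that(1) D that(2,3)] by (intro divide_right_mono) auto
    show "\<Phi> s \<le> \<Phi> u" if "0 < s" "s \<le> u" for s u
      unfolding \<Phi>_def using that c G ra by (intro mult_left_mono powr_mono2) auto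
    show "1 / t > 0" using t by simp
    show "isCont \<Phi> (1 / t)" unfolding \<Phi>_def using t by (intro continuous_intros) auto
    show "emeasure ?K {a..b} < \<infinity>" if "0 < a" "a < b" for a b
      using tempering_compact_finite[OF p ra(1) _ that(1)] ra by simp
    fix j :: nat
    define l where "l = real (Suc j) powr (1 / p)"
    have l: "l > 0" by (simp add: l_def)
    have PsiJ: "(\<integral>s. \<Psi> r s * exp (- (s powr p)) ^ j \<partial>?K) =
        l powr \<alpha> * (measure (TS_levy_measure p \<alpha> R) (directional_tail (r * l) D) / f r)" if r: "r > 0" for r
    proof -
      note [measurable] = scaled_tail_measurable[OF R r D]
      have rl: "r * l > 0" using r l by simp
      have "measure (TS_levy_measure p \<alpha> R) (directional_tail (r * l) D) = (\<integral>s. scaled_tail R (r * l) D s \<partial>?K)"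
        by (rule scaled_tail_integral(2)[OF R M rl D])
      also have "\<dots> = (\<integral>s. scaled_tail R r D (s / l) \<partial>?K)"
      proof (rule integral_cong_AE)
        show "AE s in ?K. scaled_tail R (r * l) D s = scaled_tail R r D (s / l)"
          using AE_tempering_pos
        proof eventually_elim
          case (elim s)
          then show ?case using l by (simp add: scaled_tail_pos)
        qed
        show "scaled_tail R (r * l) D \<in> borel_measurable ?K" using scaled_tail_measurable[OF R rl D] by simp
      qed measurable
      also have "\<dots> = l powr (- \<alpha>) * (\<integral>s. scaled_tail R r D s * exp (- (s powr p)) ^ j \<partial>?K)"
        unfolding l_def by (rule tempering_exponential_moment[OF p]) (auto simp: scaled_tail_nonneg)
      finally have "l powr \<alpha> * measure (TS_levy_measure p \<alpha> R) (directional_tail (r * l) D) =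
          (\<integral>s. scaled_tail R r D s * exp (- (s powr p)) ^ j \<partial>?K)"
        using l by (simp add: mult.assoc[symmetric] powr_add[symmetric])
      then show ?thesis by (simp add: \<Psi>_def)
    qed
    have PhiJ: "(\<integral>s. \<Phi> s * exp (- (s powr p)) ^ j \<partial>?K) = l powr \<alpha> * (l powr (- \<rho>) * c)"
    proof -
      have "l powr (- \<rho>) * G = (\<integral>s. l powr (- \<rho>) * s powr \<rho> \<partial>?K)"
        using tempering_power(2)[OF p ra(1)] by (simp add: G_def)
      also have "\<dots> = (\<integral>s. (s / l) powr \<rho> \<partial>?K)"
      proof (rule integral_cong_AE)
        show "AE s in ?K. l powr (- \<rho>) * s powr \<rho> = (s / l) powr \<rho>"
          using AE_tempering_pos
        proof eventually_elim
          case (elim s)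
          then show ?case using l by (simp add: powr_divide powr_minus_divide)
        qed
      qed measurable
      also have "\<dots> = l powr (- \<alpha>) * (\<integral>s. s powr \<rho> * exp (- (s powr p)) ^ j \<partial>?K)"
        unfolding l_def by (rule tempering_exponential_moment[OF p]) auto
      finally have "l powr \<alpha> * (l powr (- \<rho>) * G) = (\<integral>s. s powr \<rho> * exp (- (s powr p)) ^ j \<partial>?K)"
        using l by (simp add: mult.assoc[symmetric] powr_add[symmetric])
      then have "(\<integral>s. \<Phi> s * exp (- (s powr p)) ^ j \<partial>?K) = (c / G) * (l powr \<alpha> * (l powr (- \<rho>) * G))"
        unfolding \<Phi>_def mult.assoc by simp
      also have "\<dots> = l powr \<alpha> * (l powr (- \<rho>) * c)" using G by simp
      finally show ?thesis .
    qed
    have "((\<lambda>r. l powr \<alpha> * (measure (TS_levy_measure p \<alpha> R) (directional_tail (r * l) D) / f r)) \<longlongrightarrow> l powr \<alpha> * (l powr (- \<rho>) * c)) at_top"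
      by (intro tendsto_mult_left lim l)
    then show "((\<lambda>r. \<integral>s. \<Psi> r s * exp (- (s powr p)) ^ j \<partial>?K) \<longlongrightarrow> (\<integral>s. \<Phi> s * exp (- (s powr p)) ^ j \<partial>?K)) at_top"
      unfolding PhiJ
      by (rule Lim_transform_eventually) (rule eventually_mono[OF eventually_gt_at_top[of 0]], simp add: PsiJ)
  qed
  moreover have "\<Phi> (1 / t) = p / Gamma ((\<rho> - \<alpha>) / p) * t powr (- \<rho>) * c"
    using t by (simp add: \<Phi>_def G_def powr_divide powr_minus_divide)
  moreover have "\<Psi> r (1 / t) = measure R (directional_tail (r * t) D) / f r" for r
    using t by (simp add: \<Psi>_def scaled_tail_pos)
  ultimately show ?thesis by simp
qed

theorem theorem17:
  fixes \<alpha> p \<rho> :: real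
    and R M \<mu> \<sigma> :: "'a::euclidean_space measure"
    and b :: 'a
  assumes "\<alpha> < 2" and "p > 0"
    and "is_TS p \<alpha> R b \<mu>"
    and "M = TS_levy_measure p \<alpha> R"
    and "finite_measure \<sigma>" and "sets \<sigma> = sets borel_sphere"
    and "emeasure \<sigma> (sphere 0 1) \<noteq> 0"
    and "\<rho> > max \<alpha> 0"
  shows "(regularly_varying \<mu> \<rho> \<sigma> \<longleftrightarrow> regularly_varying M \<rho> \<sigma>) \<and>
    (regularly_varying M \<rho> \<sigma> \<longleftrightarrow> regularly_varying R \<rho> \<sigma>) \<and>
    (regularly_varying M \<rho> \<sigma> \<longrightarrow>
      (\<forall>D. continuity_set \<sigma> D \<and> emeasure \<sigma> D > 0 \<longrightarrow>
        ((\<lambda>r. measure R (directional_tail r D) / measure M (directional_tail r D))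
          \<longlongrightarrow> p / Gamma ((\<rho> - \<alpha>) / p)) at_top))"
proof -
  note fin = assms(5) and sets = assms(6) and p = assms(2) and rho = assms(8)
  interpret sig: finite_measure \<sigma> by (rule fin)
  have sig: "measure \<sigma> (sphere 0 1) \<noteq> 0" using assms(7) by (simp add: sig.emeasure_eq_measure)
  have sig0: "measure \<sigma> (sphere 0 1) > 0" using sig by (simp add: order_less_le)
  have ID: "is_ID M b \<mu>" and ros: "rosinski_measure \<alpha> R" using assms(3,4) by (auto simp: is_TS_def)
  have R: "levy_measure R" by (rule rosinski_imp_levy_measure[OF ros assms(1)])
  have M: "levy_measure M" using ID by (simp add: is_ID_def)
  have MT: "levy_measure (TS_levy_measure p \<alpha> R)" using M assms(4) by simp
  have sR: "sets R = sets borel" by (rule sets_levy[OF R])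
  have sM: "sets M = sets borel" by (rule sets_levy[OF M])
  have fR: "emeasure R {x. norm x > r} < \<infinity>" if "r > 0" for r by (rule levy_tail_finite[OF R that])
  have fM: "emeasure M {x. norm x > r} < \<infinity>" if "r > 0" for r by (rule levy_tail_finite[OF M that])
  define G where "G = Gamma ((\<rho> - \<alpha>) / p) / p"
  have G: "G > 0" using p rho by (simp add: G_def Gamma_real_pos)
  have Ginv: "p / Gamma ((\<rho> - \<alpha>) / p) = 1 / G" by (simp add: G_def)
  define c where "c D = measure \<sigma> D / measure \<sigma> (sphere 0 1)" for D
  have R_lim: "((\<lambda>r. measure R (directional_tail (r * t) D) / measure M {x. norm x > r}) \<longlongrightarrow> 1 / G * t powr (- \<rho>) * c D) at_top"
    if rv: "regularly_varying M \<rho> \<sigma>" and t: "t > 0" and D: "continuity_set \<sigma> D" for t D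
  proof -
    have f: "rv_function (\<lambda>r. measure M {x. norm x > r}) \<rho>"
      by (rule regularly_varying_rv_function[OF fin sets rv sig fM])
    have lim: "((\<lambda>r. measure (TS_levy_measure p \<alpha> R) (directional_tail (r * u) D) / measure M {x. norm x > r}) \<longlongrightarrow> u powr (- \<rho>) * c D) at_top"
      if "u > 0" for u
      using rv that D unfolding regularly_varying_def assms(4) c_def by blast
    show ?thesis
      unfolding Ginv[symmetric]
      by (rule tempered_tail_tauberian[OF R MT p rho _ _ continuity_set_borel(1)[OF fin sets D] lim t])
        (use f in \<open>auto simp: rv_function_def c_def\<close>)
  qed
  have MR: "regularly_varying R \<rho> \<sigma>" if rv: "regularly_varying M \<rho> \<sigma>"
  proof (rule regularly_varying_if_normalised[OF fin sets sR sig fR, where f="\<lambda>r. measure M {x. norm x > r}" and c="1 / G"])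
    have "rv_function (\<lambda>r. measure M {x. norm x > r}) \<rho>"
      by (rule regularly_varying_rv_function[OF fin sets rv sig fM])
    then show "measure M {x. norm x > r} > 0" if "r > 0" for r using that by (simp add: rv_function_def)
  qed (use G R_lim[OF rv] in \<open>auto simp: c_def\<close>)
  have RM: "regularly_varying M \<rho> \<sigma>" if rv: "regularly_varying R \<rho> \<sigma>"
  proof (rule regularly_varying_if_normalised[OF fin sets sM sig fM, where f="\<lambda>r. measure R {x. norm x > r}" and c=G])
    let ?f = "\<lambda>r. measure R {x::'a. norm x > r}"
    have f: "rv_function ?f \<rho>"
      by (rule regularly_varying_rv_function[OF fin sets rv sig fR])
    then show pos: "measure R {x. norm x > r} > 0" if "r > 0" for r using that by (simp add: rv_function_def)
    show "G > 0" by (rule G)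
    fix t D assume t: "(t::real) > 0" and D: "continuity_set \<sigma> D"
    have lim: "((\<lambda>r. measure R (directional_tail (r * u) D) / ?f r) \<longlongrightarrow> u powr (- \<rho>) * c D) at_top" if "u > 0" for u
      using rv that D unfolding regularly_varying_def c_def by blast
    have "((\<lambda>r. measure M (directional_tail r D) / ?f r) \<longlongrightarrow> c D * G) at_top"
      using tempered_tail_abelian[OF R MT p rho f continuity_set_borel(1)[OF fin sets D] lim] unfolding G_def assms(4) .
    then have "((\<lambda>r. measure M (directional_tail (r * t) D) / ?f (r * t)) \<longlongrightarrow> c D * G) at_top"
      by (rule filterlim_compose) (use t in real_asymp)
    moreover have "((\<lambda>r. ?f (r * t) / ?f r) \<longlongrightarrow> t powr (- \<rho>)) at_top" using f t by (simp add: rv_function_def)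
    ultimately have "((\<lambda>r. measure M (directional_tail (r * t) D) / ?f (r * t) * (?f (r * t) / ?f r)) \<longlongrightarrow> c D * G * t powr (- \<rho>)) at_top"
      by (rule tendsto_mult)
    then have "((\<lambda>r. measure M (directional_tail (r * t) D) / ?f r) \<longlongrightarrow> c D * G * t powr (- \<rho>)) at_top"
    proof (rule Lim_transform_eventually)
      show "\<forall>\<^sub>F r in at_top. measure M (directional_tail (r * t) D) / ?f (r * t) * (?f (r * t) / ?f r) = measure M (directional_tail (r * t) D) / ?f r"
      proof (rule eventually_mono[OF eventually_gt_at_top[of 0]])
        fix r :: real assume "r > 0"
        then have "?f (r * t) \<noteq> 0" using pos[of "r * t"] t by simp
        then show "measure M (directional_tail (r * t) D) / ?f (r * t) * (?f (r * t) / ?f r) = measure M (directional_tail (r * t) D) / ?f r" by simp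
      qed
    qed
    then show "((\<lambda>r. measure M (directional_tail (r * t) D) / ?f r) \<longlongrightarrow> G * t powr (- \<rho>) * (measure \<sigma> D / measure \<sigma> (sphere 0 1))) at_top"
      by (simp add: c_def mult_ac)
  qed
  have ratio: "((\<lambda>r. measure R (directional_tail r D) / measure M (directional_tail r D)) \<longlongrightarrow> p / Gamma ((\<rho> - \<alpha>) / p)) at_top"
    if rv: "regularly_varying M \<rho> \<sigma>" and D: "continuity_set \<sigma> D" and pos: "emeasure \<sigma> D > 0" for D
  proof -
    let ?f = "\<lambda>r. measure M {x::'a. norm x > r}"
    have cD: "c D > 0" using pos sig0 by (simp add: c_def sig.emeasure_eq_measure)
    have 1: "((\<lambda>r. measure R (directional_tail (r * 1) D) / ?f r) \<longlongrightarrow> 1 / G * 1 powr (- \<rho>) * c D) at_top"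
      by (rule R_lim[OF rv _ D]) simp
    have 2: "((\<lambda>r. measure M (directional_tail (r * 1) D) / ?f r) \<longlongrightarrow> 1 powr (- \<rho>) * c D) at_top"
      using rv D zero_less_one unfolding regularly_varying_def c_def by blast
    have "((\<lambda>r. (measure R (directional_tail r D) / ?f r) / (measure M (directional_tail r D) / ?f r)) \<longlongrightarrow> (1 / G * c D) / c D) at_top"
      using 1 2 cD by (intro tendsto_divide) auto
    then have "((\<lambda>r. (measure R (directional_tail r D) / ?f r) / (measure M (directional_tail r D) / ?f r)) \<longlongrightarrow> p / Gamma ((\<rho> - \<alpha>) / p)) at_top"
      using cD by (simp add: Ginv)
    then show ?thesis
    proof (rule Lim_transform_eventually)
      have f: "rv_function ?f \<rho>" by (rule regularly_varying_rv_function[OF fin sets rv sig fM])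
      show "\<forall>\<^sub>F r in at_top. (measure R (directional_tail r D) / ?f r) / (measure M (directional_tail r D) / ?f r) =
          measure R (directional_tail r D) / measure M (directional_tail r D)"
      proof (rule eventually_mono[OF eventually_gt_at_top[of 0]])
        fix r :: real assume "r > 0"
        then have "?f r > 0" using f by (simp add: rv_function_def)
        then show "(measure R (directional_tail r D) / ?f r) / (measure M (directional_tail r D) / ?f r) =
          measure R (directional_tail r D) / measure M (directional_tail r D)" by simp
      qed
    qed
  qed
  have "\<rho> > 0" using rho by simp
  then have "regularly_varying \<mu> \<rho> \<sigma> \<longleftrightarrow> regularly_varying M \<rho> \<sigma>"
    by (rule ID_regularly_varying_iff[OF ID fin sets sig])
  then show ?thesis using MR RM ratio by blast
qed

end
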